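(* For any locally finite, infinite, connected graph $G$, we have $$\mathsf{FSF}\bigl(\overline{\mathfrak{F}_{\mathrm w}(G)}\bigr)=\mathsf{WSF}(G)\quad\text{and}\quad \mathsf{FSF}\bigl(\overline{\mathfrak{F}_{\mathrm f}(G)}\bigr)=\mathsf{FSF}(G)$$ (equalities of probability measures). In particular, the free spanning forest on each component of $\overline{\mathfrak{F}_{\mathrm w}(G)}$ and on each component of $\overline{\mathfrak{F}_{\mathrm f}(G)}$ has a unique connected component a.s.
   Context: For a finite connected graph $K$, $\mathsf{UST}(K)$ is the uniform measure on spanning trees of $K$. Let $G$ be a locally finite, infinite, connected graph. An exhaustion of $G$ is a sequence $\langle G_n\rangle$ of finite connected subgraphs with $G_n\subset G_{n+1}$ and $\bigcup_n G_n=G$. Free spanning forest: given an exhaustion and a fixed finite subgraph $H$ of $G$, the weak limit of $\mathsf{UST}(G_n)\cap H$ exists; varying $H$ gives a probability measure $\mathsf{FSF}(G)$ on subgraphs of $G$. Wired spanning forest: for a finite connected subgraph $H$ of $G$, let $\widehat H$ be the finite graph obtained from $G$ by identifying all vertices not in $H$ to a single vertex, and $\mathsf{WSF}(H):=\mathsf{UST}(\widehat H)$. Given an exhaustion by induced subgraphs and a fixed finite subgraph $H$, the weak limit of $\mathsf{WSF}(G_n)\cap H$ exists; varying $H$ gives a probability measure $\mathsf{WSF}(G)$ on subgraphs of $G$. $\mathfrak{F}_{\mathrm w}(G)$ and $\mathfrak{F}_{\mathrm f}(G)$ denote random samples with laws $\mathsf{WSF}(G)$ and $\mathsf{FSF}(G)$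 respectively; their components are a.s. infinite. Induced-component graph: for a subgraph $H$ of $G$, $\overline H$ is the subgraph of $G$ with the same vertex set as $H$ in which an edge of $G$ is present iff both its endpoints lie in the same connected component of $H$. For a random subgraph $H$ of $G$ all of whose components are infinite, $\mathsf{FSF}(H)$ denotes the unconditional law of the random subgraph of $G$ obtained by first sampling $H$ and then, given $H$, sampling a free spanning forest independently on each component of $H$. *)

theory Defs
  imports "HOL-Probability.Probability"
begin

section \<open>Undirected multigraphs\<close>

text \<open>Parallel edges and loops are allowed, since contracting a simple graph creates them.
  An edge \<open>e\<close> has the endpoint set \<open>ends G e\<close>, a singleton when \<open>e\<close> is a loop.\<close>

record ('v, 'e) mgraph =
  verts :: "'v set"
  edges :: "'e set"
  ends :: "'e \<Rightarrow> 'v set"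

definition wf_graph :: "('v, 'e) mgraph \<Rightarrow> bool" where
  "wf_graph G \<longleftrightarrow> (\<forall>e\<in>edges G. \<exists>u\<in>verts G. \<exists>v\<in>verts G. ends G e = {u, v})"

definition locally_finite :: "('v, 'e) mgraph \<Rightarrow> bool" where
  "locally_finite G \<longleftrightarrow> (\<forall>v\<in>verts G. finite {e \<in> edges G. v \<in> ends G e})"

definition finite_graph :: "('v, 'e) mgraph \<Rightarrow> bool" where
  "finite_graph G \<longleftrightarrow> finite (verts G) \<and> finite (edges G)"

fun walk :: "('v, 'e) mgraph \<Rightarrow> 'v \<Rightarrow> 'e list \<Rightarrow> 'v \<Rightarrow> bool" where
  "walk G u [] v \<longleftrightarrow> u \<in> verts G \<and> u = v"
| "walk G u (e # es) v \<longleftrightarrow>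
     u \<in> verts G \<and> e \<in> edges G \<and> (\<exists>w. ends G e = {u, w} \<and> walk G w es v)"

definition joined :: "('v, 'e) mgraph \<Rightarrow> 'v \<Rightarrow> 'v \<Rightarrow> bool" where
  "joined G u v \<longleftrightarrow> (\<exists>es. walk G u es v)"

definition connected_graph :: "('v, 'e) mgraph \<Rightarrow> bool" where
  "connected_graph G \<longleftrightarrow> verts G \<noteq> {} \<and> (\<forall>u\<in>verts G. \<forall>v\<in>verts G. joined G u v)"

text \<open>A cycle of length 1 is a loop; one of length 2 is a pair of distinct parallel edges.\<close>

definition is_cycle :: "('v, 'e) mgraph \<Rightarrow> 'v list \<Rightarrow> 'e list \<Rightarrow> bool" where
  "is_cycle G vs es \<longleftrightarrow>
     es \<noteq> [] \<and> length vs = length es \<and> distinct vs \<and> distinct es \<and>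
     set vs \<subseteq> verts G \<and> set es \<subseteq> edges G \<and>
     (\<forall>i<length es. ends G (es ! i) = {vs ! i, vs ! (Suc i mod length es)})"

definition acyclic_graph :: "('v, 'e) mgraph \<Rightarrow> bool" where
  "acyclic_graph G \<longleftrightarrow> (\<nexists>vs es. is_cycle G vs es)"

definition subgraph :: "('v, 'e) mgraph \<Rightarrow> ('v, 'e) mgraph \<Rightarrow> bool" where
  "subgraph H G \<longleftrightarrow> wf_graph H \<and> verts H \<subseteq> verts G \<and> edges H \<subseteq> edges G \<and>
     (\<forall>e\<in>edges H. ends H e = ends G e)"

definition induced_subgraph :: "('v, 'e) mgraph \<Rightarrow> ('v, 'e) mgraph \<Rightarrow> bool" where
  "induced_subgraph H G \<longleftrightarrow>
     subgraph H G \<and> edges H = {e \<in> edges G. ends G e \<subseteq> verts H}"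

definition spanning_subgraph :: "('v, 'e) mgraph \<Rightarrow> 'e set \<Rightarrow> ('v, 'e) mgraph" where
  "spanning_subgraph G T = \<lparr>verts = verts G, edges = T, ends = ends G\<rparr>"

definition component_of :: "('v, 'e) mgraph \<Rightarrow> 'v \<Rightarrow> ('v, 'e) mgraph" where
  "component_of G v =
     \<lparr>verts = {u. joined G v u},
      edges = {e \<in> edges G. ends G e \<subseteq> {u. joined G v u}},
      ends = ends G\<rparr>"

definition graph_components :: "('v, 'e) mgraph \<Rightarrow> ('v, 'e) mgraph set" where
  "graph_components G = component_of G ` verts G"

definition induced_component_graph ::
  "('v, 'e) mgraph \<Rightarrow> ('v, 'e) mgraph \<Rightarrow> ('v, 'e) mgraph" where
  "induced_component_graph G H =
     \<lparr>verts = verts H,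
      edges = {e \<in> edges G. \<exists>C\<in>graph_components H. ends G e \<subseteq> verts C},
      ends = ends G\<rparr>"

section \<open>Uniform spanning trees\<close>

definition spanning_trees :: "('v, 'e) mgraph \<Rightarrow> 'e set set" where
  "spanning_trees K = {T. T \<subseteq> edges K \<and> connected_graph (spanning_subgraph K T) \<and>
     acyclic_graph (spanning_subgraph K T)}"

definition UST :: "('v, 'e) mgraph \<Rightarrow> 'e set pmf" where
  "UST K = pmf_of_set (spanning_trees K)"

text \<open>Wiring identifies all vertices outside \<open>H\<close> to the single vertex \<open>None\<close> and keeps the
  edges of \<open>G\<close> as edges. Edges with no endpoint in \<open>H\<close> would become (infinitely many) loops
  at \<open>None\<close>; they are dropped, so that the graph is finite.\<close>

definition wire :: "('v, 'e) mgraph \<Rightarrow> 'v \<Rightarrow> 'v option" where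
  "wire H v = (if v \<in> verts H then Some v else None)"

definition wired_graph :: "('v, 'e) mgraph \<Rightarrow> ('v, 'e) mgraph \<Rightarrow> ('v option, 'e) mgraph" where
  "wired_graph G H =
     \<lparr>verts = wire H ` verts G,
      edges = {e \<in> edges G. ends G e \<inter> verts H \<noteq> {}},
      ends = (\<lambda>e. wire H ` ends G e)\<rparr>"

definition exhaustion :: "('v, 'e) mgraph \<Rightarrow> (nat \<Rightarrow> ('v, 'e) mgraph) \<Rightarrow> bool" where
  "exhaustion G Gs \<longleftrightarrow>
     (\<forall>n. subgraph (Gs n) G \<and> finite_graph (Gs n) \<and> connected_graph (Gs n) \<and>
          subgraph (Gs n) (Gs (Suc n))) \<and>
     (\<Union>n. verts (Gs n)) = verts G \<and> (\<Union>n. edges (Gs n)) = edges G"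

section \<open>Free and wired spanning forests\<close>

text \<open>All random subgraphs below are spanning, so a subgraph is represented by its edge set; the
  \<open>\<sigma>\<close>-algebra is the one generated by the presence of single edges.\<close>

definition subgraph_space :: "('v, 'e) mgraph \<Rightarrow> 'e set measure" where
  "subgraph_space G = sigma (Pow (edges G)) {{T \<in> Pow (edges G). e \<in> T} |e. e \<in> edges G}"

text \<open>\<open>P n\<close> restricted to any finite edge set \<open>F\<close> converges weakly to \<open>M\<close> restricted to \<open>F\<close>:
  on the finite set of subsets of \<open>F\<close>, weak convergence is convergence of point masses.\<close>

definition local_weak_limit ::
  "('v, 'e) mgraph \<Rightarrow> (nat \<Rightarrow> 'e set pmf) \<Rightarrow> 'e set measure \<Rightarrow> bool" where
  "local_weak_limit G P M \<longleftrightarrow>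
     (\<forall>F A. finite F \<longrightarrow> F \<subseteq> edges G \<longrightarrow> A \<subseteq> F \<longrightarrow>
        (\<lambda>n. measure_pmf.prob (P n) {T. T \<inter> F = A})
          \<longlonglongrightarrow> measure M {T \<in> space M. T \<inter> F = A})"

definition FSF :: "('v, 'e) mgraph \<Rightarrow> 'e set measure" where
  "FSF G = (THE M. prob_space M \<and> sets M = sets (subgraph_space G) \<and>
     (\<forall>Gs. exhaustion G Gs \<longrightarrow> local_weak_limit G (\<lambda>n. UST (Gs n)) M))"

definition WSF :: "('v, 'e) mgraph \<Rightarrow> 'e set measure" where
  "WSF G = (THE M. prob_space M \<and> sets M = sets (subgraph_space G) \<and>
     (\<forall>Gs. exhaustion G Gs \<longrightarrow> (\<forall>n. induced_subgraph (Gs n) G) \<longrightarrow>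
        local_weak_limit G (\<lambda>n. UST (wired_graph G (Gs n))) M))"

text \<open>The union of independent free spanning forests on the components of a fixed subgraph \<open>H\<close>
  of \<open>G\<close>. On a finite component every exhaustion is eventually constant, so \<open>FSF\<close> is the
  uniform spanning tree there.\<close>

definition FSF_on_components ::
  "('v, 'e) mgraph \<Rightarrow> ('v, 'e) mgraph \<Rightarrow> 'e set measure" where
  "FSF_on_components G H =
     distr (PiM (graph_components H) FSF) (subgraph_space G)
       (\<lambda>f. \<Union>C\<in>graph_components H. f C)"

text \<open>\<open>FSF_random G N\<close> is the unconditional law of the free spanning forest of a random spanning
  subgraph of \<open>G\<close> with law \<open>N\<close>.\<close>

definition FSF_random :: "('v, 'e) mgraph \<Rightarrow> 'e set measure \<Rightarrow> 'e set measure" where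
  "FSF_random G N = N \<bind> (\<lambda>T. FSF_on_components G (spanning_subgraph G T))"

definition induced_component_law :: "('v, 'e) mgraph \<Rightarrow> 'e set measure \<Rightarrow> 'e set measure" where
  "induced_component_law G N =
     distr N (subgraph_space G)
       (\<lambda>T. edges (induced_component_graph G (spanning_subgraph G T)))"

end

(* Orient the edges and call a set of edges independent if it supports no nonzero circulation;
   spanning trees of a finite connected graph are then the bases of its edge set. For a uniform
   basis containing a fixed set F, the probability of a further edge e is the energy of a unit
   current, i.e. the squared distance of e from the space of circulations enlarged by F. Deleting
   edges shrinks the circulations and identifying vertices enlarges them, so inclusion
   probabilities are monotone along free and along wired exhaustions, and both forests exist.

   For a finite edge set Y, a uniform spanning tree has the following Gibbs property: given its
   edges outside Y and the partition its trace on Y induces, this trace is a uniform basis of the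
   edges of Y inside the blocks. The inclusion probability of F under the resampled trace depends
   on finitely many edges, so the identity passes to the limit forest. Letting Y increase to all
   edges, the uniform basis converges, for every configuration, to the independent free spanning
   forests of the components; dominated convergence gives the two equalities. The resampled forest
   refines the components and has the same law as the original, so almost surely it connects every
   pair of vertices that the original connects. *)

theory Submission
  imports Defs
begin

section \<open>Uniform bases of unimodular spaces\<close>

text \<open>Being connected in the limit forest is not a local event: the joining path may leave any
  given finite set, so one cannot condition on the components before passing to a weak limit. The
  resampling therefore uses only the partition that the trace on a finite \<open>Y\<close> itself
  induces, and two limits are taken in a fixed order: the exhaustion grows with \<open>Y\<close>
  held fixed, and only then does \<open>Y\<close> grow.

  The edges of \<open>Y\<close> inside the blocks need not form a connected graph. This is why bases
  replace spanning trees: monotonicity, limits and resampling are then available for arbitrary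
  finite edge sets. Wiring becomes an enlargement of the space of circulations over the same edges.
  Away from the wired vertex the two spaces agree, so resampling the wired forest also produces
  free, not wired, forests on the components.

  Laws are compared only on the events that a given finite edge set is contained in the forest;
  these events are closed under intersection and generate the sigma-algebra.\<close>

definition supp :: "('e \<Rightarrow> real) \<Rightarrow> 'e set" where
  "supp z = {e. z e \<noteq> 0}"

definition indep :: "('e \<Rightarrow> real) set \<Rightarrow> 'e set \<Rightarrow> bool" where
  "indep Z I \<longleftrightarrow> (\<forall>z\<in>Z. supp z \<subseteq> I \<longrightarrow> supp z = {})"

definition bases :: "('e \<Rightarrow> real) set \<Rightarrow> 'e set \<Rightarrow> 'e set set" where
  "bases Z X = {B. B \<subseteq> X \<and> indep Z B \<and> (\<forall>e\<in>X - B. \<not> indep Z (insert e B))}"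

definition basis_count :: "('e \<Rightarrow> real) set \<Rightarrow> 'e set \<Rightarrow> 'e set \<Rightarrow> nat" where
  "basis_count Z X F = card {B \<in> bases Z X. F \<subseteq> B}"

definition inclusion_prob :: "('e \<Rightarrow> real) set \<Rightarrow> 'e set \<Rightarrow> 'e set \<Rightarrow> real" where
  "inclusion_prob Z X F = basis_count Z X F / basis_count Z X {}"

text \<open>For \<open>e\<close> outside \<open>B\<close> this is the fundamental circuit of
  \<open>e\<close>, normalised to 1 at \<open>e\<close>. For \<open>e\<close> in \<open>B\<close>
  the support condition confines \<open>z\<close> to \<open>B\<close>, so independence leaves only
  0; this convention lets later sums run over all of \<open>X\<close>.\<close>

definition is_fundamental :: "('e \<Rightarrow> real) set \<Rightarrow> 'e set \<Rightarrow> 'e \<Rightarrow> ('e \<Rightarrow> real) \<Rightarrow> bool" where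
  "is_fundamental Z B e z \<longleftrightarrow> z \<in> Z \<and> supp z \<subseteq> insert e B \<and> (e \<notin> B \<longrightarrow> z e = 1)"

definition fundamental :: "('e \<Rightarrow> real) set \<Rightarrow> 'e set \<Rightarrow> 'e \<Rightarrow> 'e \<Rightarrow> real" where
  "fundamental Z B e = (SOME z. is_fundamental Z B e z)"

lemma supp_outside: "supp z \<subseteq> A \<Longrightarrow> e \<notin> A \<Longrightarrow> z e = 0"
  by (auto simp: supp_def)

lemma supp_subsetI: "(\<And>e. e \<notin> A \<Longrightarrow> z e = 0) \<Longrightarrow> supp z \<subseteq> A"
  by (auto simp: supp_def)

lemma supp_nonempty: "z e \<noteq> 0 \<Longrightarrow> supp z \<noteq> {}"
  by (auto simp: supp_def)

lemma indep_mono: "indep Z J \<Longrightarrow> I \<subseteq> J \<Longrightarrow> indep Z I"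
  unfolding indep_def by blast

lemma indep_empty [simp]: "indep Z {}"
  unfolding indep_def by auto

lemma basesD:
  assumes "B \<in> bases Z X"
  shows "B \<subseteq> X" "indep Z B" "\<And>e. e \<in> X \<Longrightarrow> e \<notin> B \<Longrightarrow> \<not> indep Z (insert e B)"
  using assms by (auto simp: bases_def)

lemma finite_bases: "finite X \<Longrightarrow> finite (bases Z X)"
  by (rule finite_subset[of _ "Pow X"]) (auto simp: bases_def)

lemma indep_extends_to_basis:
  assumes "finite X" "I \<subseteq> X" "indep Z I"
  shows "\<exists>B\<in>bases Z X. I \<subseteq> B"
proof -
  let ?S = "{B. I \<subseteq> B \<and> B \<subseteq> X \<and> indep Z B}"
  have "finite ?S" by (rule finite_subset[of _ "Pow X"]) (use assms in auto)
  moreover have "I \<in> ?S" using assms by auto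
  ultimately have "\<exists>B\<in>?S. I \<subseteq> B \<and> (\<forall>C\<in>?S. B \<subseteq> C \<longrightarrow> B = C)"
    by (rule finite_has_maximal2)
  then obtain B where B: "B \<in> ?S" "\<forall>C\<in>?S. B \<subseteq> C \<longrightarrow> B = C" by (elim bexE conjE)
  have "\<not> indep Z (insert e B)" if "e \<in> X" "e \<notin> B" for e
    using B(1) bspec[OF B(2), of "insert e B"] that by auto
  then have "B \<in> bases Z X" using B(1) by (auto simp: bases_def)
  then show ?thesis using B(1) by auto
qed

lemma bases_nonempty: "finite X \<Longrightarrow> bases Z X \<noteq> {}"
  using indep_extends_to_basis[of X "{}" Z] by auto

lemma basis_count_empty_pos: "finite X \<Longrightarrow> basis_count Z X {} > 0"
  unfolding basis_count_def using bases_nonempty[of X Z] finite_bases[of X Z]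
  by (simp add: card_gt_0_iff)

lemma inclusion_prob_nonneg: "inclusion_prob Z X F \<ge> 0"
  by (simp add: inclusion_prob_def)

lemma basis_count_mono: "finite X \<Longrightarrow> F \<subseteq> F' \<Longrightarrow> basis_count Z X F' \<le> basis_count Z X F"
  unfolding basis_count_def by (rule card_mono) (auto simp: finite_bases)

lemma inclusion_prob_le_1: "finite X \<Longrightarrow> inclusion_prob Z X F \<le> 1"
  using basis_count_mono[of X "{}" F Z] basis_count_empty_pos[of X Z] by (simp add: inclusion_prob_def)

lemma inclusion_prob_eq_0: "\<not> F \<subseteq> X \<Longrightarrow> inclusion_prob Z X F = 0"
proof -
  assume "\<not> F \<subseteq> X"
  then have "{B \<in> bases Z X. F \<subseteq> B} = {}" by (auto simp: bases_def)
  then show ?thesis unfolding inclusion_prob_def basis_count_def by (simp only: card.empty)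
qed

locale unimodular =
  fixes Z :: "('e \<Rightarrow> real) set"
  assumes finite_supp: "z \<in> Z \<Longrightarrow> finite (supp z)"
    and zero: "(\<lambda>_. 0) \<in> Z"
    and lincomb: "x \<in> Z \<Longrightarrow> y \<in> Z \<Longrightarrow> (\<lambda>e. a * x e + b * y e) \<in> Z"
    and signed: "z \<in> Z \<Longrightarrow> supp z \<noteq> {} \<Longrightarrow>
      \<exists>y\<in>Z. supp y \<noteq> {} \<and> supp y \<subseteq> supp z \<and> (\<forall>f. y f \<in> {-1, 0, 1})"
begin

lemma scale: "x \<in> Z \<Longrightarrow> (\<lambda>e. a * x e) \<in> Z"
  using lincomb[of x x a 0] by simp

lemma diff: "x \<in> Z \<Longrightarrow> y \<in> Z \<Longrightarrow> (\<lambda>e. x e - a * y e) \<in> Z"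
  using lincomb[of x y 1 "-a"] by simp

lemma sum_closed: "finite A \<Longrightarrow> (\<And>i. i \<in> A \<Longrightarrow> f i \<in> Z) \<Longrightarrow> (\<lambda>e. \<Sum>i\<in>A. a i * f i e) \<in> Z"
proof (induction A rule: finite_induct)
  case empty
  then show ?case using zero by simp
next
  case (insert i A)
  then have "(\<lambda>e. \<Sum>i\<in>A. a i * f i e) \<in> Z" "f i \<in> Z" by auto
  from lincomb[OF this(2) this(1), of "a i" 1] show ?case using insert by simp
qed

lemma is_fundamental_unique:
  assumes "indep Z B" "is_fundamental Z B e z" "is_fundamental Z B e y"
  shows "z = y"
proof -
  let ?w = "\<lambda>f. z f - 1 * y f"
  have z: "z \<in> Z" "supp z \<subseteq> insert e B" "e \<notin> B \<Longrightarrow> z e = 1"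
    and y: "y \<in> Z" "supp y \<subseteq> insert e B" "e \<notin> B \<Longrightarrow> y e = 1"
    using assms by (auto simp: is_fundamental_def)
  have "?w \<in> Z" using diff[OF z(1) y(1)] .
  moreover have "supp ?w \<subseteq> B"
  proof (rule supp_subsetI)
    fix f assume "f \<notin> B"
    then show "?w f = 0"
      using z(3) y(3) supp_outside[OF z(2), of f] supp_outside[OF y(2), of f] by (cases "f = e") auto
  qed
  ultimately have "supp ?w = {}" using assms(1) unfolding indep_def by blast
  then show ?thesis by (auto simp: supp_def fun_eq_iff)
qed

lemma fundamental_exists:
  assumes "B \<in> bases Z X" "e \<in> X"
  shows "\<exists>z. is_fundamental Z B e z"
proof (cases "e \<in> B")
  case True
  then show ?thesis using zero by (auto simp: is_fundamental_def supp_def intro!: exI[of _ "\<lambda>_. 0"])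
next
  case False
  then have "\<not> indep Z (insert e B)" using basesD[OF assms(1)] assms(2) by auto
  then obtain z where z: "z \<in> Z" "supp z \<subseteq> insert e B" "supp z \<noteq> {}" by (auto simp: indep_def)
  have ze: "z e \<noteq> 0"
  proof
    assume "z e = 0"
    then have "supp z \<subseteq> B" using z(2) by (auto simp: supp_def)
    then show False using z basesD(2)[OF assms(1)] by (auto simp: indep_def)
  qed
  have "is_fundamental Z B e (\<lambda>f. (1 / z e) * z f)"
    using z ze scale[OF z(1), of "1 / z e"] by (auto simp: is_fundamental_def supp_def)
  then show ?thesis by blast
qed

lemma
  assumes "B \<in> bases Z X" "e \<in> X"
  shows is_fundamental_fundamental: "is_fundamental Z B e (fundamental Z B e)"
    and fundamental_mem: "fundamental Z B e \<in> Z"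
    and fundamental_supp: "supp (fundamental Z B e) \<subseteq> insert e B"
    and fundamental_self: "e \<notin> B \<Longrightarrow> fundamental Z B e e = 1"
    and fundamental_eqI: "is_fundamental Z B e z \<Longrightarrow> fundamental Z B e = z"
proof -
  show *: "is_fundamental Z B e (fundamental Z B e)"
    unfolding fundamental_def using fundamental_exists[OF assms] by (rule someI_ex)
  then show "fundamental Z B e \<in> Z" "supp (fundamental Z B e) \<subseteq> insert e B" "e \<notin> B \<Longrightarrow> fundamental Z B e e = 1"
    by (auto simp: is_fundamental_def)
  show "fundamental Z B e = z" if "is_fundamental Z B e z"
    using is_fundamental_unique[OF _ * that] basesD(2)[OF assms(1)] by blast
qed

lemma fundamental_zero:
  assumes "B \<in> bases Z X" "e \<in> B"
  shows "fundamental Z B e = (\<lambda>_. 0)"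
  using assms zero basesD(1)[OF assms(1)] by (intro fundamental_eqI[of B X]) (auto simp: is_fundamental_def supp_def)

text \<open>A signed vector inside the support of the fundamental one must involve \<open>e\<close>,
  since otherwise \<open>B\<close> would be dependent. Divided by its value 1 or -1 at
  \<open>e\<close>, it satisfies the conditions that determine the fundamental vector.\<close>

lemma fundamental_signed:
  assumes B: "B \<in> bases Z X" and e: "e \<in> X"
  shows "fundamental Z B e f \<in> {-1, 0, 1}"
proof (cases "e \<in> B")
  case True
  then show ?thesis using fundamental_zero[OF B] by simp
next
  case False
  have "fundamental Z B e e = 1" using fundamental_self[OF B e False] .
  then have "supp (fundamental Z B e) \<noteq> {}" by (intro supp_nonempty[of _ e]) simp
  from signed[OF fundamental_mem[OF B e] this]
  obtain y where y: "y \<in> Z" "supp y \<noteq> {}" "supp y \<subseteq> supp (fundamental Z B e)" "\<forall>f. y f \<in> {-1, 0, 1}"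
    by (elim bexE conjE)
  have sy: "supp y \<subseteq> insert e B" using y fundamental_supp[OF B e] by auto
  have ye: "y e \<noteq> 0"
  proof
    assume "y e = 0"
    then have "supp y \<subseteq> B" using sy by (auto simp: supp_def)
    then show False using y(1,2) basesD(2)[OF B] unfolding indep_def by blast
  qed
  have "fundamental Z B e = (\<lambda>f. (1 / y e) * y f)"
    by (rule fundamental_eqI[OF B e]) (use ye sy scale[OF y(1), of "1 / y e"] in \<open>auto simp: is_fundamental_def supp_def\<close>)
  moreover have "y e \<in> {-1, 0, 1}" "y f \<in> {-1, 0, 1}" using y(4) by (rule spec)+
  ultimately show ?thesis using ye by auto
qed

text \<open>The circuit of \<open>e\<close> passes through \<open>g\<close>, so \<open>g\<close> can
  be traded for \<open>e\<close>. The new circuit of \<open>g\<close> is the old vector divided by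
  its coefficient c at \<open>g\<close>; its value at \<open>e\<close> is 1/c, which equals c
  because c is 1 or -1. This last clause is the symmetry behind the reciprocity of currents.\<close>

lemma basis_exchange:
  assumes B: "B \<in> bases Z X" and e: "e \<in> X" and ne: "e \<noteq> g" and nz: "fundamental Z B e g \<noteq> 0"
  shows "e \<notin> B" "g \<in> B" "insert e (B - {g}) \<in> bases Z X"
    "fundamental Z (insert e (B - {g})) g e = fundamental Z B e g"
proof -
  let ?z = "fundamental Z B e" and ?B = "insert e (B - {g})"
  show eB: "e \<notin> B" using nz fundamental_zero[OF B] by auto
  show gB: "g \<in> B" using nz ne fundamental_supp[OF B e] by (auto simp: supp_def)
  have z: "?z \<in> Z" "supp ?z \<subseteq> insert e B" "?z e = 1"
    using fundamental_mem[OF B e] fundamental_supp[OF B e] fundamental_self[OF B e eB] .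
  have ind: "indep Z ?B"
    unfolding indep_def
  proof (intro ballI impI)
    fix y assume y: "y \<in> Z" "supp y \<subseteq> ?B"
    \<comment> \<open>Subtracting this multiple clears the coordinate \<open>e\<close> and leaves an
      element supported in \<open>B\<close>, hence 0. The coordinate \<open>g\<close>, absent from
      \<open>y\<close>, then forces \<open>y e = 0\<close>.\<close>
    let ?w = "\<lambda>f. y f - y e * ?z f"
    have w: "?w \<in> Z" using diff[OF y(1) z(1)] .
    have "supp ?w \<subseteq> B"
    proof (rule supp_subsetI)
      fix f assume "f \<notin> B"
      then show "?w f = 0"
        using z(3) supp_outside[OF z(2), of f] supp_outside[OF y(2), of f] by (cases "f = e") auto
    qed
    then have "supp ?w = {}" using w basesD(2)[OF B] unfolding indep_def by blast
    then have w0: "y f = y e * ?z f" for f using supp_outside[of ?w "{}" f] by simp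
    have "y g = 0" using y(2) ne by (auto simp: supp_def)
    then have ye: "y e = 0" using w0[of g] nz by simp
    have "y f = 0" for f using w0[of f] unfolding ye by simp
    then show "supp y = {}" by (simp add: supp_def)
  qed
  have "\<not> indep Z (insert h ?B)" if h: "h \<in> X" "h \<notin> ?B" for h
  proof (cases "h = g")
    case True
    then have "supp ?z \<subseteq> insert h ?B" using z(2) by auto
    moreover have "supp ?z \<noteq> {}" using z(3) by (intro supp_nonempty[of _ e]) simp
    ultimately show ?thesis using z(1) unfolding indep_def by blast
  next
    case False
    then have hB: "h \<notin> B" "h \<noteq> e" using h by auto
    let ?y = "fundamental Z B h"
    have y: "?y \<in> Z" "supp ?y \<subseteq> insert h B" "?y h = 1"
      using fundamental_mem[OF B h(1)] fundamental_supp[OF B h(1)] fundamental_self[OF B h(1) hB(1)] .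
    \<comment> \<open>The multiple is chosen to clear the coordinate \<open>g\<close>; the
      coordinate \<open>h\<close> stays 1 because \<open>?z\<close> vanishes there.\<close>
    let ?w = "\<lambda>f. ?y f - (?y g / ?z g) * ?z f"
    have w: "?w \<in> Z" using diff[OF y(1) z(1)] .
    have "?z h = 0" using supp_outside[OF z(2), of h] hB by auto
    then have "?w h \<noteq> 0" using y(3) by simp
    then have "supp ?w \<noteq> {}" by (rule supp_nonempty)
    moreover have "supp ?w \<subseteq> insert h ?B"
    proof (rule supp_subsetI)
      fix f assume "f \<notin> insert h ?B"
      then show "?w f = 0"
        using nz supp_outside[OF z(2), of f] supp_outside[OF y(2), of f] by (cases "f = g") auto
    qed
    ultimately show ?thesis using w unfolding indep_def by blast
  qed
  then show B': "?B \<in> bases Z X"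
    using ind basesD(1)[OF B] e by (auto simp: bases_def)
  have gX: "g \<in> X" using gB basesD(1)[OF B] by auto
  have "fundamental Z ?B g = (\<lambda>f. (1 / ?z g) * ?z f)"
    by (rule fundamental_eqI[OF B' gX])
      (use z nz ne scale[OF z(1), of "1 / ?z g"] in \<open>auto simp: is_fundamental_def supp_def\<close>)
  then have "fundamental Z ?B g e = 1 / ?z g" using z(3) by simp
  moreover have "?z g \<in> {-1, 0, 1}" using fundamental_signed[OF B e] .
  ultimately show "fundamental Z ?B g e = ?z g" using nz by auto
qed

text \<open>Off \<open>B\<close> the fundamental vectors act as unit vectors, so both sides agree
  there; the difference is an element of \<open>Z\<close> supported in \<open>B\<close> and
  therefore vanishes.\<close>

lemma fundamental_expansion:
  assumes B: "B \<in> bases Z X" and X: "finite X" and z: "z \<in> Z" "supp z \<subseteq> X"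
  shows "z f = (\<Sum>g\<in>X. z g * fundamental Z B g f)"
proof -
  let ?w = "\<lambda>f. z f - 1 * (\<Sum>g\<in>X. z g * fundamental Z B g f)"
  have w: "?w \<in> Z"
    by (rule diff[OF z(1)]) (rule sum_closed[OF X fundamental_mem[OF B]])
  have "supp ?w \<subseteq> B"
  proof (rule supp_subsetI)
    fix h assume h: "h \<notin> B"
    have *: "fundamental Z B g h = (if g = h then 1 else 0)" if "g \<in> X" for g
      using that h supp_outside[OF fundamental_supp[OF B that], of h] fundamental_self[OF B that] by auto
    have "(\<Sum>g\<in>X. z g * fundamental Z B g h) = (\<Sum>g\<in>X. if g = h then z g else 0)"
      by (rule sum.cong) (use * in auto)
    also have "\<dots> = z h" using X supp_outside[OF z(2), of h] by auto
    finally show "?w h = 0" by simp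
  qed
  then have "supp ?w = {}" using w basesD(2)[OF B] unfolding indep_def by blast
  then show ?thesis using supp_outside[of ?w "{}" f] by simp
qed

text \<open>Up to the normalisation by \<open>basis_count Z X F\<close>, \<open>j\<close> is the unit current through \<open>e\<close> after
  contracting \<open>F\<close>: the average over the bases containing \<open>F\<close> of the coordinates of \<open>e\<close> in the
  basis. The orthogonality to \<open>Z\<close> rests on the symmetry of the exchange of \<open>e\<close> and \<open>g\<close>, which is
  where unimodularity enters.\<close>

lemma current_exists:
  assumes X: "finite X" and F: "F \<subseteq> X" and e: "e \<in> X" "e \<notin> F"
  shows "\<exists>j z r. j e = real (basis_count Z X (insert e F)) \<and>
    (\<forall>y\<in>Z. supp y \<subseteq> X \<longrightarrow> (\<Sum>g\<in>X. j g * y g) = 0) \<and>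
    (\<forall>g\<in>F. j g = 0) \<and> supp j \<subseteq> X \<and> z \<in> Z \<and> supp z \<subseteq> X \<and> supp r \<subseteq> F \<and>
    (\<forall>g. (if g = e then real (basis_count Z X F) else 0) - j g = z g + r g)"
proof -
  define BB where "BB = {B \<in> bases Z X. F \<subseteq> B}"
  have fin: "finite BB" unfolding BB_def using finite_bases[OF X] by auto
  have BB: "B \<in> bases Z X" "F \<subseteq> B" if "B \<in> BB" for B using that by (auto simp: BB_def)
  \<comment> \<open>\<open>c B e\<close> is the unit vector at \<open>e\<close> reduced modulo
    \<open>Z\<close> to a vector on \<open>B\<close>: the flow through the tree \<open>B\<close>
    that replaces the edge \<open>e\<close>.\<close>
  define c where "c = (\<lambda>B e g. (if e = g then 1 else 0) - fundamental Z B e g)"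
  \<comment> \<open>Forcing 0 on \<open>F\<close> expresses the contraction of \<open>F\<close>; the
    discarded values are collected in \<open>r\<close>.\<close>
  define j where "j = (\<lambda>g. if g \<in> F then 0 else \<Sum>B\<in>BB. c B e g)"
  define z where "z = (\<lambda>g. \<Sum>B\<in>BB. 1 * fundamental Z B e g)"
  define r where "r = (\<lambda>g. if g \<in> F then - z g else 0)"
  have sym: "(\<Sum>B\<in>BB. c B e g) = (\<Sum>B\<in>BB. c B g e)" if g: "g \<in> X" "g \<notin> F" for g
  proof (cases "g = e")
    case False
    have *: "(\<Sum>B\<in>BB. c B a b) = - (\<Sum>B\<in>{B \<in> BB. fundamental Z B a b \<noteq> 0}. fundamental Z B a b)" if "a \<noteq> b" for a b
    proof -
      have "(\<Sum>B\<in>BB. c B a b) = - (\<Sum>B\<in>BB. fundamental Z B a b)"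
        using that by (simp add: c_def sum_negf)
      also have "(\<Sum>B\<in>BB. fundamental Z B a b) = (\<Sum>B\<in>{B \<in> BB. fundamental Z B a b \<noteq> 0}. fundamental Z B a b)"
        by (rule sum.mono_neutral_right) (use fin in auto)
      finally show ?thesis .
    qed
    \<comment> \<open>Exchanging \<open>g\<close> for \<open>e\<close> is a bijection from the bases
      whose circuit of \<open>e\<close> uses \<open>g\<close> to those whose circuit of
      \<open>g\<close> uses \<open>e\<close>. It preserves the coefficient, and it keeps
      \<open>F\<close> in the basis because neither edge lies in \<open>F\<close>.\<close>
    have "(\<Sum>B\<in>{B \<in> BB. fundamental Z B e g \<noteq> 0}. fundamental Z B e g) = (\<Sum>B\<in>{B \<in> BB. fundamental Z B g e \<noteq> 0}. fundamental Z B g e)"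
    proof (rule sum.reindex_bij_witness[where i = "\<lambda>B. insert g (B - {e})" and j = "\<lambda>B. insert e (B - {g})"])
      fix B assume "B \<in> {B \<in> BB. fundamental Z B e g \<noteq> 0}"
      then have B: "B \<in> bases Z X" "F \<subseteq> B" "fundamental Z B e g \<noteq> 0" using BB by auto
      note ex = basis_exchange[OF B(1) e(1) False[symmetric] B(3)]
      show "insert g (insert e (B - {g}) - {e}) = B" using ex by auto
      show "insert e (B - {g}) \<in> {B \<in> BB. fundamental Z B g e \<noteq> 0}" using ex B g by (auto simp: BB_def)
      show "fundamental Z (insert e (B - {g})) g e = fundamental Z B e g" using ex by auto
    next
      fix B assume "B \<in> {B \<in> BB. fundamental Z B g e \<noteq> 0}"
      then have B: "B \<in> bases Z X" "F \<subseteq> B" "fundamental Z B g e \<noteq> 0" using BB by auto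
      note ex = basis_exchange[OF B(1) g(1) False B(3)]
      show "insert e (insert g (B - {e}) - {g}) = B" using ex by auto
      show "insert g (B - {e}) \<in> {B \<in> BB. fundamental Z B e g \<noteq> 0}" using ex B e by (auto simp: BB_def)
    qed
    then show ?thesis using *[of e g] *[of g e] False by simp
  qed simp
  have "c B e e = (if e \<in> B then 1 else 0)" if "B \<in> BB" for B
    using fundamental_zero[of B X e] fundamental_self[of B X e] BB[OF that] e by (auto simp: c_def)
  then have "j e = (\<Sum>B\<in>BB. if e \<in> B then 1 else 0)" using e by (simp add: j_def)
  also have "\<dots> = card {B \<in> BB. e \<in> B}" using fin by (simp add: sum.If_cases Int_def)
  also have "{B \<in> BB. e \<in> B} = {B \<in> bases Z X. insert e F \<subseteq> B}" by (auto simp: BB_def)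
  finally have j1: "j e = basis_count Z X (insert e F)" by (simp add: basis_count_def)
  have j2: "(\<Sum>g\<in>X. j g * y g) = 0" if y: "y \<in> Z" "supp y \<subseteq> X" for y
  proof -
    have "(\<Sum>g\<in>X. j g * y g) = (\<Sum>g\<in>X-F. j g * y g)"
      by (rule sum.mono_neutral_right) (use X in \<open>auto simp: j_def\<close>)
    \<comment> \<open>By symmetry the coordinate \<open>g\<close> of \<open>e\<close> becomes the
      coordinate \<open>e\<close> of \<open>g\<close>. For each \<open>B\<close> the sum over
      \<open>g\<close> is then \<open>y e\<close> minus its expansion in fundamental vectors, which
      is 0.\<close>
    also have "\<dots> = (\<Sum>g\<in>X-F. \<Sum>B\<in>BB. y g * c B g e)"
      by (rule sum.cong) (auto simp: j_def sym sum_distrib_left mult.commute)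
    also have "\<dots> = (\<Sum>B\<in>BB. \<Sum>g\<in>X-F. y g * c B g e)" by (rule sum.swap)
    also have "\<dots> = (\<Sum>B\<in>BB. 0)"
    proof (rule sum.cong[OF refl])
      fix B assume B: "B \<in> BB"
      have "(\<Sum>g\<in>X-F. y g * c B g e) = (\<Sum>g\<in>X. y g * c B g e)"
        by (rule sum.mono_neutral_left) (use X e fundamental_zero[of B X] BB[OF B] in \<open>auto simp: c_def\<close>)
      also have "\<dots> = (\<Sum>g\<in>X. if g = e then y g else 0) - (\<Sum>g\<in>X. y g * fundamental Z B g e)"
        unfolding sum_subtractf[symmetric] by (rule sum.cong) (auto simp: c_def algebra_simps)
      also have "\<dots> = 0"
        using X e fundamental_expansion[OF BB(1)[OF B] X y, of e] by simp
      finally show "(\<Sum>g\<in>X-F. y g * c B g e) = 0" .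
    qed
    finally show ?thesis by simp
  qed
  have fX: "supp (fundamental Z B e) \<subseteq> X" if "B \<in> BB" for B
    using fundamental_supp[OF BB(1)[OF that] e(1)] basesD(1)[OF BB(1)[OF that]] e by auto
  have j3: "supp j \<subseteq> X"
  proof
    fix g assume g: "g \<in> supp j"
    show "g \<in> X"
    proof (rule ccontr)
      assume "g \<notin> X"
      then have "c B e g = 0" if "B \<in> BB" for B
        using fX[OF that] e by (auto simp: c_def supp_def)
      then have "j g = 0" by (simp add: j_def)
      then show False using g by (simp add: supp_def)
    qed
  qed
  have z1: "z \<in> Z" unfolding z_def by (rule sum_closed[OF fin fundamental_mem[OF BB(1) e(1)]])
  have z2: "supp z \<subseteq> X"
  proof
    fix g assume g: "g \<in> supp z"
    show "g \<in> X"
    proof (rule ccontr)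
      assume "g \<notin> X"
      then have "fundamental Z B e g = 0" if "B \<in> BB" for B
        using fX[OF that] by (auto simp: supp_def)
      then show False using g by (simp add: supp_def z_def)
    qed
  qed
  have j4: "(if g = e then real (basis_count Z X F) else 0) - j g = z g + r g" for g
  proof (cases "g \<in> F")
    case True
    then show ?thesis using e by (auto simp: j_def r_def)
  next
    case False
    have "card BB = basis_count Z X F" by (simp add: basis_count_def BB_def)
    then show ?thesis using False by (auto simp: j_def r_def c_def z_def sum_subtractf)
  qed
  have jF: "j g = 0" if "g \<in> F" for g using that by (simp add: j_def)
  have rF: "supp r \<subseteq> F" by (auto simp: r_def supp_def)
  show ?thesis using j1 j2 jF j3 z1 z2 rF j4 by (intro exI[of _ j] exI[of _ z] exI[of _ r]) simp
qed

end

section \<open>Monotonicity of inclusion probabilities\<close>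

lemma sum_supp_extend:
  assumes "finite Y" "X \<subseteq> Y" "supp a \<subseteq> X"
  shows "(\<Sum>g\<in>X. a g * b g) = (\<Sum>g\<in>Y. a g * (b g :: real))"
  by (rule sum.mono_neutral_left) (use assms in \<open>auto simp: supp_def\<close>)

text \<open>The energy of the current only decreases when the space it has to be orthogonal to grows.\<close>

lemma basis_count_insert_mono:
  assumes "unimodular Z" "unimodular Z'"
    and X: "finite X'" "X \<subseteq> X'" and ZZ: "\<And>z. z \<in> Z \<Longrightarrow> supp z \<subseteq> X \<Longrightarrow> z \<in> Z'"
    and F: "F \<subseteq> X" and e: "e \<in> X" "e \<notin> F"
  shows "basis_count Z X F * basis_count Z' X' (insert e F) \<le> basis_count Z' X' F * basis_count Z X (insert e F)"
proof -
  interpret A: unimodular Z by fact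
  interpret B: unimodular Z' by fact
  have fX: "finite X" using X finite_subset by blast
  obtain j z r where j: "j e = real (basis_count Z X (insert e F))"
    "\<forall>y\<in>Z. supp y \<subseteq> X \<longrightarrow> (\<Sum>g\<in>X. j g * y g) = 0"
    "\<forall>g\<in>F. j g = 0" "supp j \<subseteq> X" "z \<in> Z" "supp z \<subseteq> X" "supp r \<subseteq> F"
    "\<forall>g. (if g = e then real (basis_count Z X F) else 0) - j g = z g + r g"
    using A.current_exists[OF fX F e] by (elim exE conjE)
  have F': "F \<subseteq> X'" "e \<in> X'" using F e X by auto
  obtain j' z' r' where j': "j' e = real (basis_count Z' X' (insert e F))"
    "\<forall>y\<in>Z'. supp y \<subseteq> X' \<longrightarrow> (\<Sum>g\<in>X'. j' g * y g) = 0"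
    "\<forall>g\<in>F. j' g = 0" "supp j' \<subseteq> X'" "z' \<in> Z'" "supp z' \<subseteq> X'" "supp r' \<subseteq> F"
    "\<forall>g. (if g = e then real (basis_count Z' X' F) else 0) - j' g = z' g + r' g"
    using B.current_exists[OF X(1) F' e(2)] by (elim exE conjE)
  have orth: "(\<Sum>g\<in>X'. j g * z g) = 0" "(\<Sum>g\<in>X'. j' g * z g) = 0" "(\<Sum>g\<in>X'. j' g * z' g) = 0"
    using j(2) j'(2) ZZ j(5,6) j'(5,6) sum_supp_extend[OF X j(4)] X(2) by auto
  \<comment> \<open>Pairing \<open>k\<close> with N times the unit vector at \<open>e\<close> sees
    only the component \<open>i\<close>, since \<open>k\<close> is orthogonal to the rest. Used for
    the pairs (j, j), (j', j) and (j', j').\<close>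
  have energy: "N * k e = (\<Sum>g\<in>X'. k g * i g)"
    if "\<And>g. (if g = e then N else 0) - i g = y g + s g" "(\<Sum>g\<in>X'. k g * y g) = 0"
      "\<And>g. k g * s g = 0" for k i y s :: "'a \<Rightarrow> real" and N
  proof -
    have "(\<Sum>g\<in>X'. k g * i g) = (\<Sum>g\<in>X'. if g = e then N * k g else 0) - (\<Sum>g\<in>X'. k g * y g) - (\<Sum>g\<in>X'. k g * s g)"
      unfolding sum_subtractf[symmetric]
    proof (rule sum.cong[OF refl])
      fix g
      have "i g = (if g = e then N else 0) - y g - s g" using that(1)[of g] by simp
      then show "k g * i g = (if g = e then N * k g else 0) - k g * y g - k g * s g"
        by (simp add: right_diff_distrib)
    qed
    then show ?thesis using that(2,3) F' X by simp
  qed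
  have js: "j g * r g = 0" "j' g * r g = 0" "j' g * r' g = 0" for g
    using j(3,7) j'(3,7) by (auto simp: supp_def)
  have 1: "basis_count Z X F * j e = (\<Sum>g\<in>X'. j g * j g)"
    by (rule energy[OF spec[OF j(8)] orth(1) js(1)])
  have 2: "basis_count Z X F * j' e = (\<Sum>g\<in>X'. j' g * j g)"
    by (rule energy[OF spec[OF j(8)] orth(2) js(2)])
  have 3: "basis_count Z' X' F * j' e = (\<Sum>g\<in>X'. j' g * j' g)"
    by (rule energy[OF spec[OF j'(8)] orth(3) js(3)])
  \<comment> \<open>With n and m the counts for \<open>F\<close> in \<open>X\<close> and
    \<open>X'\<close>, the three identities turn this into (n j'(e))^2 \<le> (m j'(e)) (n j(e)).
    Cancelling the common factor n j'(e) is all that remains.\<close>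
  have "(\<Sum>g\<in>X'. j' g * j g)\<^sup>2 \<le> (\<Sum>g\<in>X'. (j' g)\<^sup>2) * (\<Sum>g\<in>X'. (j g)\<^sup>2)"
    by (rule Cauchy_Schwarz_ineq_sum)
  then have CS: "(basis_count Z X F * j' e)\<^sup>2 \<le> (basis_count Z' X' F * j' e) * (basis_count Z X F * j e)"
    using 1 2 3 by (simp add: power2_eq_square)
  have "basis_count Z X F * j' e \<le> basis_count Z' X' F * j e"
  proof (cases "basis_count Z X F = 0 \<or> j' e = 0")
    case True
    then show ?thesis using j(1) by auto
  next
    case False
    then have pos: "basis_count Z X F * j' e > 0" using j'(1) by auto
    have "(basis_count Z X F * j' e) * (basis_count Z X F * j' e) \<le> (basis_count Z X F * j' e) * (basis_count Z' X' F * j e)"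
      using CS by (simp add: power2_eq_square algebra_simps)
    then show ?thesis using pos by (simp add: mult_le_cancel_left_pos)
  qed
  then show ?thesis unfolding j(1) j'(1) by (metis of_nat_le_iff of_nat_mult)
qed

text \<open>The chain rule: the probability of \<open>insert e F\<close> is that of \<open>F\<close>
  times the conditional probability of \<open>e\<close>, and each conditional factor was compared
  above. If no basis of \<open>X\<close> contains \<open>F\<close>, the induction hypothesis makes
  both sides vanish.\<close>

theorem inclusion_prob_antimono:
  assumes Z: "unimodular Z" "unimodular Z'"
    and X: "finite X'" "X \<subseteq> X'" and ZZ: "\<And>z. z \<in> Z \<Longrightarrow> supp z \<subseteq> X \<Longrightarrow> z \<in> Z'"
    and F: "F \<subseteq> X"
  shows "inclusion_prob Z' X' F \<le> inclusion_prob Z X F"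
proof -
  have fX: "finite X" using X finite_subset by blast
  have "finite F" using F fX finite_subset by blast
  then show ?thesis using F
  proof (induction F rule: finite_induct)
    case empty
    then show ?case using basis_count_empty_pos[OF X(1), of Z'] basis_count_empty_pos[OF fX, of Z] by (simp add: inclusion_prob_def)
  next
    case (insert e F)
    have IH: "inclusion_prob Z' X' F \<le> inclusion_prob Z X F" using insert by auto
    have p: "real (basis_count Z' X' {}) > 0" "real (basis_count Z X {}) > 0"
      using basis_count_empty_pos[OF X(1), of Z'] basis_count_empty_pos[OF fX, of Z] by simp_all
    have "real (basis_count Z X F * basis_count Z' X' (insert e F)) \<le> real (basis_count Z' X' F * basis_count Z X (insert e F))"
      using basis_count_insert_mono[OF Z X ZZ, of F e] insert by (intro of_nat_mono) auto
    then have main: "real (basis_count Z X F) * basis_count Z' X' (insert e F) \<le> basis_count Z' X' F * real (basis_count Z X (insert e F))"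
      by simp
    show ?case
    proof (cases "basis_count Z X F = 0")
      case True
      then have "inclusion_prob Z' X' F \<le> 0" using IH by (simp add: inclusion_prob_def)
      then have "basis_count Z' X' F = 0" using p by (simp add: inclusion_prob_def divide_le_0_iff)
      then have "basis_count Z' X' (insert e F) = 0" using basis_count_mono[OF X(1), of F "insert e F" Z'] by auto
      then show ?thesis by (simp add: inclusion_prob_def)
    next
      case False
      then have q: "real (basis_count Z X F) > 0" by simp
      have "basis_count Z' X' (insert e F) \<le> basis_count Z' X' F * (basis_count Z X (insert e F) / basis_count Z X F)"
        using main q by (simp add: field_simps)
      then have "inclusion_prob Z' X' (insert e F) \<le> basis_count Z' X' F * (basis_count Z X (insert e F) / basis_count Z X F) / basis_count Z' X' {}"
        unfolding inclusion_prob_def by (rule divide_right_mono) simp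
      also have "\<dots> = inclusion_prob Z' X' F * (basis_count Z X (insert e F) / basis_count Z X F)" by (simp add: inclusion_prob_def)
      also have "\<dots> \<le> inclusion_prob Z X F * (basis_count Z X (insert e F) / basis_count Z X F)"
        by (rule mult_right_mono[OF IH]) simp
      also have "\<dots> = inclusion_prob Z X (insert e F)" using q by (simp add: inclusion_prob_def)
      finally show ?thesis .
    qed
  qed
qed

section \<open>Spans, traces and resampling\<close>

text \<open>Matroid closure of \<open>I\<close>, in the linear form that \<open>e\<close> equals a
  combination of \<open>I\<close> modulo \<open>Z\<close>. For circulations it means that
  \<open>I\<close> joins the ends of \<open>e\<close>. No ambient edge set is built in; uses
  intersect with one.\<close>

definition spanned :: "('e \<Rightarrow> real) set \<Rightarrow> 'e set \<Rightarrow> 'e set" where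
  "spanned Z I = {e. \<exists>x. supp x \<subseteq> I \<and> (\<lambda>f. of_bool (f = e) - x f) \<in> Z}"

lemma spanned_mono: "I \<subseteq> J \<Longrightarrow> spanned Z I \<subseteq> spanned Z J"
  unfolding spanned_def by blast

text \<open>This lemma and the next two express locality: whatever happens inside \<open>Y\<close>
  depends only on the elements of the space supported in \<open>Y\<close>. They will replace the
  space of a wired graph by that of the original graph.\<close>

lemma indep_cong:
  assumes "\<And>z. supp z \<subseteq> Y \<Longrightarrow> z \<in> Z \<longleftrightarrow> z \<in> Z'" "I \<subseteq> Y"
  shows "indep Z I \<longleftrightarrow> indep Z' I"
  unfolding indep_def using assms by (meson subset_trans)

lemma inclusion_prob_cong:
  assumes Z: "\<And>z. supp z \<subseteq> Y \<Longrightarrow> z \<in> Z \<longleftrightarrow> z \<in> Z'" and "X \<subseteq> Y"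
  shows "inclusion_prob Z X F = inclusion_prob Z' X F"
proof -
  have "indep Z I \<longleftrightarrow> indep Z' I" if "I \<subseteq> X" for I
    using indep_cong[of Y Z Z' I, OF Z] assms(2) that by auto
  then have "bases Z X = bases Z' X"
    unfolding bases_def by (intro Collect_cong conj_cong ball_cong refl) simp_all
  then show ?thesis by (simp add: inclusion_prob_def basis_count_def)
qed

lemma spanned_cong:
  assumes Z: "\<And>z. supp z \<subseteq> Y \<Longrightarrow> z \<in> Z \<longleftrightarrow> z \<in> Z'" and "I \<subseteq> Y"
  shows "Y \<inter> spanned Z I = Y \<inter> spanned Z' I"
proof -
  have "(\<lambda>f. of_bool (f = e) - x f) \<in> Z \<longleftrightarrow> (\<lambda>f. of_bool (f = e) - x f) \<in> Z'"
    if "e \<in> Y" "supp x \<subseteq> I" for e x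
  proof (rule Z)
    show "supp (\<lambda>f. of_bool (f = e) - x f) \<subseteq> Y"
      using that assms(2) by (auto simp: supp_def split: if_splits)
  qed
  then show ?thesis unfolding spanned_def by blast
qed

context unimodular
begin

lemma subset_spanned: "I \<subseteq> spanned Z I"
proof
  fix e assume "e \<in> I"
  then show "e \<in> spanned Z I"
    using zero unfolding spanned_def
    by (intro CollectI exI[of _ "\<lambda>f. of_bool (f = e)"]) (auto simp: supp_def)
qed

lemma spanned_iff_dependent:
  assumes "indep Z I" "e \<notin> I"
  shows "e \<in> spanned Z I \<longleftrightarrow> \<not> indep Z (insert e I)"
proof
  assume "e \<in> spanned Z I"
  then obtain x where x: "supp x \<subseteq> I" "(\<lambda>f. of_bool (f = e) - x f) \<in> Z" by (auto simp: spanned_def)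
  let ?z = "\<lambda>f. of_bool (f = e) - x f"
  have "x e = 0" using supp_outside[OF x(1)] assms(2) by auto
  then have "supp ?z \<noteq> {}" by (intro supp_nonempty[of _ e]) simp
  moreover have "supp ?z \<subseteq> insert e I"
    using supp_outside[OF x(1)] by (intro supp_subsetI) auto
  ultimately show "\<not> indep Z (insert e I)" using x(2) unfolding indep_def by blast
next
  assume "\<not> indep Z (insert e I)"
  then obtain z where z: "z \<in> Z" "supp z \<subseteq> insert e I" "supp z \<noteq> {}" unfolding indep_def by blast
  have ze: "z e \<noteq> 0"
  proof
    assume "z e = 0"
    then have "supp z \<subseteq> I" using z(2) by (auto simp: supp_def)
    then show False using z assms(1) unfolding indep_def by blast
  qed
  let ?x = "\<lambda>f. of_bool (f = e) - (1 / z e) * z f"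
  have "supp ?x \<subseteq> I"
  proof (rule supp_subsetI)
    fix f assume "f \<notin> I"
    then show "?x f = 0" using supp_outside[OF z(2), of f] ze by (cases "f = e") auto
  qed
  moreover have "(\<lambda>f. of_bool (f = e) - ?x f) \<in> Z" using scale[OF z(1), of "1 / z e"] by simp
  ultimately show "e \<in> spanned Z I" unfolding spanned_def by blast
qed

text \<open>Linearity: replace each unit vector in \<open>x\<close> by its representative on
  \<open>J\<close> and add up; finiteness of the support keeps the sum in \<open>Z\<close>.\<close>

lemma combination_spanned:
  assumes I: "I \<subseteq> spanned Z J" and x: "finite (supp x)" "supp x \<subseteq> I"
  shows "\<exists>y. supp y \<subseteq> J \<and> (\<lambda>f. x f - y f) \<in> Z"
proof -
  have "\<forall>e\<in>supp x. \<exists>u. supp u \<subseteq> J \<and> (\<lambda>f. of_bool (f = e) - u f) \<in> Z"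
    using I x(2) unfolding spanned_def by blast
  then obtain u where u: "\<forall>e\<in>supp x. supp (u e) \<subseteq> J \<and> (\<lambda>f. of_bool (f = e) - u e f) \<in> Z"
    by (rule bchoice[THEN exE])
  define y where "y = (\<lambda>f. \<Sum>e\<in>supp x. x e * u e f)"
  have "supp y \<subseteq> J"
  proof (rule supp_subsetI)
    fix f assume "f \<notin> J"
    then have "u e f = 0" if "e \<in> supp x" for e using u that supp_outside by fastforce
    then show "y f = 0" by (simp add: y_def)
  qed
  moreover have "(\<lambda>f. \<Sum>e\<in>supp x. x e * (of_bool (f = e) - u e f)) \<in> Z"
    by (rule sum_closed[OF x(1), of "\<lambda>e f. of_bool (f = e) - u e f"]) (use u in auto)
  moreover have "(\<Sum>e\<in>supp x. x e * (of_bool (f = e) - u e f)) = x f - y f" for f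
  proof -
    have "(\<Sum>e\<in>supp x. x e * (of_bool (f = e) - u e f)) = (\<Sum>e\<in>supp x. if e = f then x e else 0) - y f"
      unfolding y_def sum_subtractf[symmetric] by (rule sum.cong) (auto simp: algebra_simps)
    also have "(\<Sum>e\<in>supp x. if e = f then x e else 0) = x f"
      using x(1) by (auto simp: supp_def)
    finally show ?thesis .
  qed
  ultimately show ?thesis by auto
qed

lemma add: "x \<in> Z \<Longrightarrow> y \<in> Z \<Longrightarrow> (\<lambda>e. x e + y e) \<in> Z"
  using lincomb[of x y 1 1] by simp

lemma spanned_trans:
  assumes "I \<subseteq> spanned Z J"
  shows "spanned Z I \<subseteq> spanned Z J"
proof
  fix e assume "e \<in> spanned Z I"
  then obtain x where x: "supp x \<subseteq> I" "(\<lambda>f. of_bool (f = e) - x f) \<in> Z" by (auto simp: spanned_def)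
  have "supp x \<subseteq> insert e (supp (\<lambda>f. of_bool (f = e) - x f))" by (auto simp: supp_def)
  then have "finite (supp x)" using finite_supp[OF x(2)] finite_subset by blast
  then obtain y where y: "supp y \<subseteq> J" "(\<lambda>f. x f - y f) \<in> Z"
    using combination_spanned[OF assms _ x(1)] by blast
  have "(\<lambda>f. of_bool (f = e) - y f) \<in> Z" using add[OF x(2) y(2)] by simp
  then show "e \<in> spanned Z J" using y(1) unfolding spanned_def by blast
qed

lemma basis_spans:
  assumes "B \<in> bases Z X"
  shows "X \<subseteq> spanned Z B"
  using basesD[OF assms] subset_spanned[of B] spanned_iff_dependent[of B] by blast

lemma basisI:
  assumes "B \<subseteq> X" "indep Z B" "X \<subseteq> spanned Z B"
  shows "B \<in> bases Z X"
  using assms spanned_iff_dependent[of B] unfolding bases_def by blast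

lemma trace_basis:
  assumes "B \<in> bases Z X"
  shows "B \<inter> Y \<in> bases Z (Y \<inter> spanned Z (B \<inter> Y))"
  using basesD[OF assms] subset_spanned[of "B \<inter> Y"] indep_mono[of Z B "B \<inter> Y"]
  by (intro basisI) auto

text \<open>\<open>S\<close> and \<open>B \<inter> Y\<close> span each other, so exchanging one for
  the other changes no span. For independence, rewrite the part of a relation on \<open>S\<close>
  through \<open>B \<inter> Y\<close>: the result is a relation inside \<open>B\<close>, hence
  trivial, so the original relation was supported in \<open>S\<close> alone and vanishes
  too.\<close>

lemma replace_trace:
  assumes B: "B \<in> bases Z X" and Y: "Y \<subseteq> X" and S: "S \<in> bases Z (Y \<inter> spanned Z (B \<inter> Y))"
  shows "(B - Y) \<union> S \<in> bases Z X" "spanned Z S = spanned Z (B \<inter> Y)"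
proof -
  note S' = basesD[OF S] and B' = basesD[OF B]
  have S_sp: "S \<subseteq> spanned Z (B \<inter> Y)" using S'(1) by auto
  have BY_sp: "B \<inter> Y \<subseteq> spanned Z S" using basis_spans[OF S] subset_spanned[of "B \<inter> Y"] by auto
  show "spanned Z S = spanned Z (B \<inter> Y)"
    using spanned_trans[OF S_sp] spanned_trans[OF BY_sp] by auto
  show "(B - Y) \<union> S \<in> bases Z X"
  proof (rule basisI)
    show "(B - Y) \<union> S \<subseteq> X" using B'(1) S'(1) Y by auto
    show "indep Z ((B - Y) \<union> S)"
      unfolding indep_def
    proof (intro ballI impI)
      fix z assume z: "z \<in> Z" "supp z \<subseteq> (B - Y) \<union> S"
      define x where "x = (\<lambda>f. if f \<in> S then z f else 0)"
      have "supp x \<subseteq> supp z" "supp x \<subseteq> S" by (auto simp: x_def supp_def)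
      then obtain y where y: "supp y \<subseteq> B \<inter> Y" "(\<lambda>f. x f - y f) \<in> Z"
        using combination_spanned[OF S_sp, of x] finite_supp[OF z(1)] finite_subset by blast
      let ?w = "\<lambda>f. z f - 1 * (x f - y f)"
      have w: "?w \<in> Z" by (rule diff[OF z(1) y(2)])
      have "supp ?w \<subseteq> B"
      proof (rule supp_subsetI)
        fix f assume "f \<notin> B"
        then show "?w f = 0" using supp_outside[OF z(2), of f] supp_outside[OF y(1), of f]
          by (auto simp: x_def)
      qed
      then have "supp ?w = {}" using w B'(2) unfolding indep_def by blast
      then have w0: "?w f = 0" for f using supp_outside[of ?w "{}" f] by simp
      have "supp z \<subseteq> S"
      proof (rule supp_subsetI)
        fix f assume f: "f \<notin> S"
        show "z f = 0"
        proof (cases "f \<in> Y")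
          case True
          then show ?thesis using supp_outside[OF z(2), of f] f by auto
        next
          case False
          then show ?thesis using w0[of f] f supp_outside[OF y(1), of f] by (auto simp: x_def)
        qed
      qed
      then show "supp z = {}" using z(1) S'(2) unfolding indep_def by blast
    qed
    have "B \<subseteq> spanned Z ((B - Y) \<union> S)"
      using BY_sp spanned_mono[of S "(B - Y) \<union> S" Z] subset_spanned[of "(B - Y) \<union> S"] by auto
    then show "X \<subseteq> spanned Z ((B - Y) \<union> S)"
      using spanned_trans basis_spans[OF B] by blast
  qed
qed

end

text \<open>The tower property for a uniform measure: each \<open>b'\<close> satisfying
  \<open>P\<close> is counted once per element of its fibre, with weight one over the size of the
  fibre.\<close>

lemma sum_card_fibers:
  assumes "finite A"
  shows "(\<Sum>b\<in>A. card {b'\<in>A. k b' = k b \<and> P b'} / real (card {b'\<in>A. k b' = k b})) = card {b\<in>A. P b}"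
proof -
  define n where "n = (\<lambda>v. real (card {b'\<in>A. k b' = v}))"
  have "(\<Sum>b\<in>A. card {b'\<in>A. k b' = k b \<and> P b'} / n (k b))
      = (\<Sum>b\<in>A. \<Sum>b'\<in>A. if k b' = k b \<and> P b' then 1 / n (k b) else 0)"
    using assms by (intro sum.cong refl) (simp add: sum.If_cases Int_def)
  also have "\<dots> = (\<Sum>b'\<in>A. \<Sum>b\<in>A. if k b' = k b \<and> P b' then 1 / n (k b) else 0)"
    by (rule sum.swap)
  also have "\<dots> = (\<Sum>b'\<in>A. if P b' then 1 else 0)"
  proof (rule sum.cong[OF refl])
    fix b' assume b': "b' \<in> A"
    have "(\<Sum>b\<in>A. if k b' = k b \<and> P b' then 1 / n (k b) else 0)
        = (\<Sum>b\<in>A. if k b = k b' then of_bool (P b') / n (k b') else 0)"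
      by (rule sum.cong) auto
    also have "\<dots> = n (k b') * (of_bool (P b') / n (k b'))"
      using assms by (simp add: sum.If_cases Int_def n_def)
    also have "n (k b') \<noteq> 0" using assms b' by (auto simp: n_def card_eq_0_iff)
    then have "n (k b') * (of_bool (P b') / n (k b')) = (if P b' then 1 else 0)" by simp
    finally show "(\<Sum>b\<in>A. if k b' = k b \<and> P b' then 1 / n (k b) else 0) = (if P b' then 1 else 0)" .
  qed
  also have "\<dots> = card {b\<in>A. P b}" using assms by (simp add: sum.If_cases Int_def)
  finally show ?thesis by (simp add: n_def)
qed

text \<open>Given its trace outside \<open>Y\<close> and the span of its trace on \<open>Y\<close>, a uniform basis has a
  uniform trace on \<open>Y\<close>.\<close>

theorem (in unimodular) inclusion_prob_resample:
  assumes X: "finite X" "Y \<subseteq> X" and F: "F \<subseteq> Y"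
  shows "(\<Sum>B\<in>bases Z X. inclusion_prob Z (Y \<inter> spanned Z (B \<inter> Y)) F) = basis_count Z X F"
proof -
  let ?c = "\<lambda>B. Y \<inter> spanned Z (B \<inter> Y)"
  let ?k = "\<lambda>B. (B - Y, ?c B)"
  \<comment> \<open>The bases with the same data \<open>?k\<close> as \<open>B\<close> are exactly
    the sets \<open>(B - Y) \<union> S\<close> with \<open>S\<close> a basis of \<open>?c B\<close>.
    With \<open>G\<close> empty this gives the denominator of the conditional probability, with
    \<open>G = F\<close> the numerator.\<close>
  have fib: "card {S \<in> bases Z (?c B). G \<subseteq> S} = card {B' \<in> bases Z X. ?k B' = ?k B \<and> G \<subseteq> B'}"
    if B: "B \<in> bases Z X" and G: "G \<subseteq> Y" for B G
  proof (rule bij_betw_same_card[of "\<lambda>S. (B - Y) \<union> S"], rule bij_betw_byWitness[where f' = "\<lambda>B. B \<inter> Y"])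
    have SY: "S \<subseteq> Y" if "S \<in> bases Z (?c B)" for S using basesD(1)[OF that] by auto
    show "\<forall>S\<in>{S \<in> bases Z (?c B). G \<subseteq> S}. (B - Y \<union> S) \<inter> Y = S" using SY by auto
    show "\<forall>B'\<in>{B' \<in> bases Z X. ?k B' = ?k B \<and> G \<subseteq> B'}. B - Y \<union> B' \<inter> Y = B'" by auto
    show "(\<lambda>S. B - Y \<union> S) ` {S \<in> bases Z (?c B). G \<subseteq> S} \<subseteq> {B' \<in> bases Z X. ?k B' = ?k B \<and> G \<subseteq> B'}"
    proof clarsimp
      fix S assume S: "S \<in> bases Z (?c B)" and "G \<subseteq> S"
      have "(B - Y \<union> S) \<inter> Y = S" "B - Y \<union> S - Y = B - Y" using SY[OF S] by auto
      then show "B - Y \<union> S \<in> bases Z X \<and> B - Y \<union> S - Y = B - Y \<and>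
          Y \<inter> spanned Z ((B - Y \<union> S) \<inter> Y) = ?c B \<and> G \<subseteq> B - Y \<union> S"
        using replace_trace[OF B X(2) S] \<open>G \<subseteq> S\<close> by auto
    qed
    show "(\<lambda>B. B \<inter> Y) ` {B' \<in> bases Z X. ?k B' = ?k B \<and> G \<subseteq> B'} \<subseteq> {S \<in> bases Z (?c B). G \<subseteq> S}"
    proof clarsimp
      fix B' assume "B' \<in> bases Z X" "?c B' = ?c B" "G \<subseteq> B'"
      then show "B' \<inter> Y \<in> bases Z (?c B) \<and> G \<subseteq> Y" using trace_basis[of B' X Y] G by auto
    qed
  qed
  have "(\<Sum>B\<in>bases Z X. inclusion_prob Z (?c B) F) =
      (\<Sum>B\<in>bases Z X. card {B' \<in> bases Z X. ?k B' = ?k B \<and> F \<subseteq> B'} / real (card {B' \<in> bases Z X. ?k B' = ?k B}))"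
    using fib[OF _ F] fib[of _ "{}"] by (intro sum.cong refl) (simp add: inclusion_prob_def basis_count_def)
  also have "\<dots> = card {B \<in> bases Z X. F \<subseteq> B}"
    by (rule sum_card_fibers[OF finite_bases[OF X(1)]])
  finally show ?thesis by (simp add: basis_count_def)
qed

text \<open>The condition \<open>sep\<close> makes the space a direct sum over the two parts, so
  independence is checked on each part separately, bases are unions of bases, and counts
  multiply.\<close>

lemma (in unimodular) inclusion_prob_union:
  assumes fin: "finite X1" "finite X2" and disj: "X1 \<inter> X2 = {}"
    and sep: "\<And>z. z \<in> Z \<Longrightarrow> supp z \<subseteq> X1 \<union> X2 \<Longrightarrow> (\<lambda>e. if e \<in> X1 then z e else 0) \<in> Z"
    and F: "F \<subseteq> X1 \<union> X2"
  shows "inclusion_prob Z (X1 \<union> X2) F = inclusion_prob Z X1 (F \<inter> X1) * inclusion_prob Z X2 (F \<inter> X2)"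
proof -
  have ind: "indep Z (B1 \<union> B2) \<longleftrightarrow> indep Z B1 \<and> indep Z B2" if "B1 \<subseteq> X1" "B2 \<subseteq> X2" for B1 B2
  proof
    assume "indep Z B1 \<and> indep Z B2"
    then have I: "indep Z B1" "indep Z B2" by auto
    show "indep Z (B1 \<union> B2)" unfolding indep_def
    proof (intro ballI impI)
      fix z assume z: "z \<in> Z" "supp z \<subseteq> B1 \<union> B2"
      let ?y = "\<lambda>e. if e \<in> X1 then z e else 0"
      have y: "?y \<in> Z" using sep z that by blast
      have "supp ?y \<subseteq> B1" using z(2) that disj by (auto simp: supp_def)
      then have "supp ?y = {}" using I(1) y unfolding indep_def by blast
      then have "z e = 0" if "e \<in> X1" for e using supp_outside[of ?y "{}" e] that by auto
      then have "supp z \<subseteq> B2" using z(2) that by (auto simp: supp_def)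
      then show "supp z = {}" using I(2) z(1) unfolding indep_def by blast
    qed
  qed (auto intro: indep_mono)
  have iff: "B1 \<union> B2 \<in> bases Z (X1 \<union> X2) \<longleftrightarrow> B1 \<in> bases Z X1 \<and> B2 \<in> bases Z X2"
    if "B1 \<subseteq> X1" "B2 \<subseteq> X2" for B1 B2
  proof -
    have d: "(X1 \<union> X2) - (B1 \<union> B2) = (X1 - B1) \<union> (X2 - B2)" using that disj by auto
    have "indep Z (insert e (B1 \<union> B2)) \<longleftrightarrow> indep Z (insert e B1) \<and> indep Z B2" if "e \<in> X1" for e
      using ind[of "insert e B1" B2] that \<open>B1 \<subseteq> X1\<close> \<open>B2 \<subseteq> X2\<close> by simp
    moreover have "indep Z (insert e (B1 \<union> B2)) \<longleftrightarrow> indep Z B1 \<and> indep Z (insert e B2)" if "e \<in> X2" for e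
      using ind[of B1 "insert e B2"] that \<open>B1 \<subseteq> X1\<close> \<open>B2 \<subseteq> X2\<close> by simp
    ultimately show ?thesis
      using ind[OF that] that unfolding bases_def mem_Collect_eq d ball_Un by auto
  qed
  have split: "basis_count Z (X1 \<union> X2) G = basis_count Z X1 (G \<inter> X1) * basis_count Z X2 (G \<inter> X2)" if "G \<subseteq> X1 \<union> X2" for G
  proof -
    have "bij_betw (\<lambda>(B1, B2). B1 \<union> B2)
      ({B \<in> bases Z X1. G \<inter> X1 \<subseteq> B} \<times> {B \<in> bases Z X2. G \<inter> X2 \<subseteq> B}) {B \<in> bases Z (X1 \<union> X2). G \<subseteq> B}"
    proof (rule bij_betw_byWitness[where f' = "\<lambda>B. (B \<inter> X1, B \<inter> X2)"])
      have sub: "B \<subseteq> X" if "B \<in> bases Z X" for B X using basesD(1)[OF that] .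
      show "\<forall>a\<in>{B \<in> bases Z X1. G \<inter> X1 \<subseteq> B} \<times> {B \<in> bases Z X2. G \<inter> X2 \<subseteq> B}.
          ((case a of (B1, B2) \<Rightarrow> B1 \<union> B2) \<inter> X1, (case a of (B1, B2) \<Rightarrow> B1 \<union> B2) \<inter> X2) = a"
        using sub disj by fastforce
      show "\<forall>B\<in>{B \<in> bases Z (X1 \<union> X2). G \<subseteq> B}. (case (B \<inter> X1, B \<inter> X2) of (B1, B2) \<Rightarrow> B1 \<union> B2) = B"
        using sub by fastforce
      show "(\<lambda>(B1, B2). B1 \<union> B2) ` ({B \<in> bases Z X1. G \<inter> X1 \<subseteq> B} \<times> {B \<in> bases Z X2. G \<inter> X2 \<subseteq> B})
          \<subseteq> {B \<in> bases Z (X1 \<union> X2). G \<subseteq> B}"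
        using iff sub that by fastforce
      show "(\<lambda>B. (B \<inter> X1, B \<inter> X2)) ` {B \<in> bases Z (X1 \<union> X2). G \<subseteq> B}
          \<subseteq> {B \<in> bases Z X1. G \<inter> X1 \<subseteq> B} \<times> {B \<in> bases Z X2. G \<inter> X2 \<subseteq> B}"
      proof clarsimp
        fix B assume B: "B \<in> bases Z (X1 \<union> X2)" "G \<subseteq> B"
        have "B \<inter> X1 \<union> B \<inter> X2 = B" using sub[OF B(1)] by auto
        then show "B \<inter> X1 \<in> bases Z X1 \<and> G \<inter> X1 \<subseteq> B \<and> B \<inter> X2 \<in> bases Z X2 \<and> G \<inter> X2 \<subseteq> B"
          using iff[of "B \<inter> X1" "B \<inter> X2"] B by auto
      qed
    qed
    then show ?thesis unfolding basis_count_def card_cartesian_product[symmetric]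
      by (rule bij_betw_same_card[symmetric])
  qed
  show ?thesis using split[OF F] split[of "{}"] by (simp add: inclusion_prob_def)
qed

section \<open>Orientations\<close>

text \<open>The functions \<open>s\<close> and \<open>t\<close> are kept outside the graph, so that
  one choice serves all subgraphs and, composed with a vertex map, all contractions; the resulting
  spaces of circulations then live on the same edges and can be compared.\<close>

definition oriented :: "('v, 'e) mgraph \<Rightarrow> ('e \<Rightarrow> 'v) \<Rightarrow> ('e \<Rightarrow> 'v) \<Rightarrow> bool" where
  "oriented K s t \<longleftrightarrow> (\<forall>e\<in>edges K. ends K e = {s e, t e} \<and> s e \<in> verts K \<and> t e \<in> verts K)"

lemma orientedD:
  assumes "oriented K s t" "e \<in> edges K"
  shows "ends K e = {s e, t e}" "s e \<in> verts K" "t e \<in> verts K"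
  using assms by (auto simp: oriented_def)

lemma orientation_exists: "wf_graph K \<Longrightarrow> \<exists>s t. oriented K s t"
proof -
  assume "wf_graph K"
  then have "\<forall>e. \<exists>p. e \<in> edges K \<longrightarrow> fst p \<in> verts K \<and> snd p \<in> verts K \<and> ends K e = {fst p, snd p}"
    unfolding wf_graph_def by (metis fst_conv snd_conv)
  then obtain p where "\<forall>e. e \<in> edges K \<longrightarrow> fst (p e) \<in> verts K \<and> snd (p e) \<in> verts K \<and> ends K e = {fst (p e), snd (p e)}"
    by metis
  then show ?thesis by (intro exI[of _ "fst \<circ> p"] exI[of _ "snd \<circ> p"]) (auto simp: oriented_def)
qed

lemma spanning_subgraph_simps [simp]:
  "verts (spanning_subgraph K T) = verts K"
  "edges (spanning_subgraph K T) = T"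
  "ends (spanning_subgraph K T) = ends K"
  by (simp_all add: spanning_subgraph_def)

lemma oriented_spanning: "oriented K s t \<Longrightarrow> T \<subseteq> edges K \<Longrightarrow> oriented (spanning_subgraph K T) s t"
  by (auto simp: oriented_def)

section \<open>Connection by walks\<close>

lemma walk_verts: "walk K u es v \<Longrightarrow> u \<in> verts K \<and> v \<in> verts K"
  by (induction K u es v rule: walk.induct) auto

lemma walk_edges: "walk K u es v \<Longrightarrow> set es \<subseteq> edges K"
  by (induction K u es v rule: walk.induct) auto

lemma joined_refl: "u \<in> verts K \<Longrightarrow> joined K u u"
  unfolding joined_def by (intro exI[of _ "[]"]) simp

lemma joined_verts: "joined K u v \<Longrightarrow> u \<in> verts K \<and> v \<in> verts K"
  unfolding joined_def using walk_verts by metis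

lemma walk_append: "walk K u es v \<Longrightarrow> walk K v fs w \<Longrightarrow> walk K u (es @ fs) w"
  by (induction K u es v rule: walk.induct) auto

lemma joined_trans: "joined K u v \<Longrightarrow> joined K v w \<Longrightarrow> joined K u w"
  unfolding joined_def using walk_append by metis

lemma joined_edge:
  assumes "e \<in> edges K" "ends K e = {u, v}" "u \<in> verts K" "v \<in> verts K"
  shows "joined K u v"
  unfolding joined_def using assms by (intro exI[of _ "[e]"]) auto

lemma walk_rev: "walk K u es v \<Longrightarrow> walk K v (rev es) u"
proof (induction K u es v rule: walk.induct)
  case (2 K u e es v)
  then obtain w where w: "u \<in> verts K" "e \<in> edges K" "ends K e = {u, w}" "walk K w es v" by auto
  then have "walk K w [e] u" using walk_verts[OF w(4)] by (auto simp: insert_commute)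
  then show ?case using walk_append[OF 2(1)[OF w(4)]] by simp
qed auto

lemma joined_sym: "joined K u v \<Longrightarrow> joined K v u"
  unfolding joined_def using walk_rev by metis

lemma walk_mono:
  assumes "walk H u es v" "set es \<subseteq> edges K" "verts H \<subseteq> verts K" "\<And>e. e \<in> set es \<Longrightarrow> ends H e = ends K e"
  shows "walk K u es v"
  using assms by (induction H u es v rule: walk.induct) auto

lemma joined_mono:
  assumes "joined H u v" "edges H \<subseteq> edges K" "verts H \<subseteq> verts K" "\<And>e. e \<in> edges H \<Longrightarrow> ends H e = ends K e"
  shows "joined K u v"
proof -
  from assms(1) obtain es where es: "walk H u es v" by (auto simp: joined_def)
  then show ?thesis
    using walk_mono[OF es, of K] walk_edges[OF es] assms(2-) unfolding joined_def by blast
qed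

lemma joined_spanning_mono:
  "joined (spanning_subgraph K S) u v \<Longrightarrow> S \<subseteq> T \<Longrightarrow> joined (spanning_subgraph K T) u v"
  by (erule joined_mono) auto

lemma joined_finite:
  assumes "joined (spanning_subgraph K T) u v"
  shows "\<exists>F. finite F \<and> F \<subseteq> T \<and> joined (spanning_subgraph K F) u v"
proof -
  from assms obtain es where es: "walk (spanning_subgraph K T) u es v" by (auto simp: joined_def)
  then have "walk (spanning_subgraph K (set es)) u es v" by (rule walk_mono) auto
  then show ?thesis using walk_edges[OF es] unfolding joined_def
    by (intro exI[of _ "set es"]) auto
qed

lemma joined_invariant:
  assumes "joined K u v" "\<And>e a b. e \<in> edges K \<Longrightarrow> ends K e = {a, b} \<Longrightarrow> a \<in> verts K \<Longrightarrow> b \<in> verts K \<Longrightarrow> P a \<Longrightarrow> P b" "P u"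
  shows "P v"
proof -
  from assms(1) obtain es where "walk K u es v" by (auto simp: joined_def)
  then show ?thesis using assms(2,3)
  proof (induction K u es v rule: walk.induct)
    case (2 K u e es v)
    then obtain w where w: "u \<in> verts K" "e \<in> edges K" "ends K e = {u, w}" "walk K w es v" by auto
    then show ?case using 2(1)[OF w(4)] 2(3)[OF w(2,3,1)] 2(3,4) walk_verts[OF w(4)] by blast
  qed auto
qed

text \<open>Loop erasure along the walk: when the new first vertex already occurs on the path,
  everything before that occurrence is dropped. The clause on suffix walks survives this dropping
  and, for \<open>k = 0\<close>, says that the path is itself a walk.\<close>

lemma joined_path:
  assumes "joined K u v"
  shows "\<exists>ws es. length ws = Suc (length es) \<and> ws ! 0 = u \<and> ws ! length es = v \<and> distinct ws \<and>
    set ws \<subseteq> verts K \<and> set es \<subseteq> edges K \<and>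
    (\<forall>i<length es. ends K (es ! i) = {ws ! i, ws ! Suc i}) \<and>
    (\<forall>k\<le>length es. walk K (ws ! k) (drop k es) v)"
proof -
  from assms obtain es where "walk K u es v" by (auto simp: joined_def)
  then show ?thesis
  proof (induction K u es v rule: walk.induct)
    case (1 K u v)
    then show ?case by (intro exI[of _ "[u]"] exI[of _ "[]"]) auto
  next
    case (2 K u e es v)
    then obtain w where w: "u \<in> verts K" "e \<in> edges K" "ends K e = {u, w}" "walk K w es v" by auto
    from 2(1)[OF w(4)] obtain ws fs where IH: "length ws = Suc (length fs)" "ws ! 0 = w" "ws ! length fs = v" "distinct ws"
      "set ws \<subseteq> verts K" "set fs \<subseteq> edges K" "\<forall>i<length fs. ends K (fs ! i) = {ws ! i, ws ! Suc i}"
      "\<forall>k\<le>length fs. walk K (ws ! k) (drop k fs) v"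
      by blast
    show ?case
    proof (cases "u \<in> set ws")
      case True
      then obtain k where k: "k < length ws" "ws ! k = u" by (auto simp: in_set_conv_nth)
      show ?thesis
        by (rule exI[of _ "drop k ws"], rule exI[of _ "drop k fs"])
          (use k IH in \<open>auto simp: add.commute dest: in_set_dropD\<close>)
    next
      case False
      have "walk K ((u # ws) ! k) (drop k (e # fs)) v" if "k \<le> length (e # fs)" for k
        using that IH(8)[rule_format, of 0] IH(8)[rule_format, of "k - 1"] w IH(2) by (cases k) auto
      moreover have "ends K ((e # fs) ! i) = {(u # ws) ! i, (u # ws) ! Suc i}" if "i < length (e # fs)" for i
        using that IH(7) w IH(2) by (cases i) auto
      ultimately show ?thesis using IH False w
        by (intro exI[of _ "u # ws"] exI[of _ "e # fs"]) auto
    qed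
  qed
qed

lemma path_edges_distinct:
  assumes "distinct ws" "length ws = Suc (length es)" "\<forall>i<length es. f (es ! i) = {ws ! i, ws ! Suc i}"
  shows "distinct es"
proof -
  have "es ! i \<noteq> es ! j" if "i < j" "j < length es" for i j
  proof
    assume "es ! i = es ! j"
    then have "{ws ! i, ws ! Suc i} = {ws ! j, ws ! Suc j}" using assms(3) that by (metis less_trans)
    then have "ws ! i = ws ! j \<or> ws ! i = ws ! Suc j" by blast
    then show False using assms(1,2) that by (auto simp: nth_eq_iff_index_eq)
  qed
  then show ?thesis unfolding distinct_conv_nth by (metis linorder_neqE_nat)
qed

section \<open>Circulations\<close>

text \<open>Kirchhoff's node law in weak form: the circulation is tested against every potential
  \<open>g\<close>. Identifying vertices restricts the potentials, hence enlarges the space.\<close>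

definition flows :: "('e \<Rightarrow> 'v) \<Rightarrow> ('e \<Rightarrow> 'v) \<Rightarrow> ('e \<Rightarrow> real) set" where
  "flows s t = {z. finite (supp z) \<and> (\<forall>g :: 'v \<Rightarrow> real. (\<Sum>e\<in>supp z. z e * (g (s e) - g (t e))) = 0)}"

lemma flowsD:
  assumes "z \<in> flows s t" "finite X" "supp z \<subseteq> X"
  shows "(\<Sum>e\<in>X. z e * (g (s e) - g (t e))) = (0 :: real)"
proof -
  have "(\<Sum>e\<in>X. z e * (g (s e) - g (t e))) = (\<Sum>e\<in>supp z. z e * (g (s e) - g (t e)))"
    by (rule sum.mono_neutral_right) (use assms in \<open>auto simp: supp_def\<close>)
  then show ?thesis using assms(1) by (simp add: flows_def)
qed

lemma flowsI:
  assumes "finite X" "supp z \<subseteq> X" "\<And>g :: 'v \<Rightarrow> real. (\<Sum>e\<in>X. z e * (g (s e) - g (t e))) = 0"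
  shows "z \<in> flows s t"
proof -
  have "(\<Sum>e\<in>X. z e * (g (s e) - g (t e))) = (\<Sum>e\<in>supp z. z e * (g (s e) - g (t e)))" for g :: "'v \<Rightarrow> real"
    by (rule sum.mono_neutral_right) (use assms in \<open>auto simp: supp_def\<close>)
  then show ?thesis using assms finite_subset by (auto simp: flows_def)
qed

lemma flows_finite: "z \<in> flows s t \<Longrightarrow> finite (supp z)"
  by (simp add: flows_def)

lemma flows_comp: "flows s t \<subseteq> flows (\<phi> \<circ> s) (\<phi> \<circ> t)"
proof
  fix z assume z: "z \<in> flows s t"
  show "z \<in> flows (\<phi> \<circ> s) (\<phi> \<circ> t)"
  proof (rule flowsI[OF flows_finite[OF z] order_refl])
    fix g :: "'c \<Rightarrow> real"
    show "(\<Sum>e\<in>supp z. z e * (g ((\<phi> \<circ> s) e) - g ((\<phi> \<circ> t) e))) = 0"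
      using flowsD[OF z flows_finite[OF z] order_refl, of "g \<circ> \<phi>"] by simp
  qed
qed

text \<open>A unit flow along the walk, with sign given by the direction of traversal; tested
  against a potential, it telescopes. Distinct edges keep the coefficients in {-1, 0, 1}.\<close>

lemma walk_flow:
  assumes "walk K u es v" "distinct es" "oriented K s t"
  shows "\<exists>x. supp x = set es \<and> (\<forall>e. x e \<in> {-1, 0, 1}) \<and>
    (\<forall>g :: 'v \<Rightarrow> real. (\<Sum>e\<in>set es. x e * (g (s e) - g (t e))) = g u - g (v :: 'v))"
  using assms
proof (induction K u es v rule: walk.induct)
  case (1 K u v)
  then show ?case by (intro exI[of _ "\<lambda>_. 0"]) (auto simp: supp_def)
next
  case (2 K u e es v)
  then obtain w where w: "u \<in> verts K" "e \<in> edges K" "ends K e = {u, w}" "walk K w es v" by auto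
  from 2(1)[OF w(4)] 2(3,4) obtain x where x: "supp x = set es" "\<forall>e. x e \<in> {-1, 0, 1}"
    "\<forall>g :: 'v \<Rightarrow> real. (\<Sum>e\<in>set es. x e * (g (s e) - g (t e))) = g w - g v" by auto
  \<comment> \<open>A loop receives coefficient 1: its potential difference is 0, but it still
    belongs to the support.\<close>
  define a :: real where "a = (if s e = u then 1 else -1)"
  have "{s e, t e} = {u, w}" using w orientedD(1)[OF 2(4) w(2)] by simp
  then have a: "a * (g (s e) - g (t e)) = g u - g w" for g :: "'v \<Rightarrow> real"
    by (auto simp: a_def doubleton_eq_iff)
  have a1: "a \<in> {-1, 0, 1}" "a \<noteq> 0" by (auto simp: a_def)
  have e: "e \<notin> set es" using 2(3) by simp
  have "(\<Sum>f\<in>set (e # es). (x(e := a)) f * (g (s f) - g (t f))) = g u - g v" for g :: "'v \<Rightarrow> real"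
  proof -
    have "(\<Sum>f\<in>set es. (x(e := a)) f * (g (s f) - g (t f))) = (\<Sum>f\<in>set es. x f * (g (s f) - g (t f)))"
      by (rule sum.cong) (use e in auto)
    then show ?thesis using e x(3) a[of g] by simp
  qed
  moreover have "supp (x(e := a)) = set (e # es)" using x(1) a1 by (auto simp: supp_def)
  moreover have "\<forall>f. (x(e := a)) f \<in> {-1, 0, 1}" using x(2) a1 by simp
  ultimately show ?case by blast
qed

lemma cycle_flow:
  assumes "is_cycle K vs es" "oriented K s t"
  shows "\<exists>x\<in>flows s t. supp x = set es \<and> (\<forall>e. x e \<in> {-1, 0, 1})"
proof -
  let ?n = "length es"
  have c: "es \<noteq> []" "length vs = ?n" "distinct es" "set vs \<subseteq> verts K" "set es \<subseteq> edges K"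
    "\<forall>i<?n. ends K (es ! i) = {vs ! i, vs ! (Suc i mod ?n)}"
    using assms(1) by (auto simp: is_cycle_def)
  then have n: "?n > 0" by simp
  have v0: "vs ! (k mod ?n) \<in> verts K" for k
    using c(2,4) n by (metis mod_less_divisor nth_mem subsetD)
  \<comment> \<open>The suffixes of the cycle are built from the end; the index modulo
    \<open>?n\<close> lets the empty suffix at \<open>k = ?n\<close> start at
    \<open>vs ! 0\<close>.\<close>
  have "k \<le> ?n \<Longrightarrow> walk K (vs ! (k mod ?n)) (drop k es) (vs ! 0)" for k
  proof (induction "?n - k" arbitrary: k)
    case 0
    then show ?case using v0[of 0] by simp
  next
    case (Suc d)
    then have k: "k < ?n" by simp
    have "walk K (vs ! (Suc k mod ?n)) (drop (Suc k) es) (vs ! 0)"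
      using Suc k by simp
    then have "walk K (vs ! k) (es ! k # drop (Suc k) es) (vs ! 0)"
      using c k v0[of k] by auto
    then show ?case using k by (simp add: Cons_nth_drop_Suc)
  qed
  from this[of 0] have w: "walk K (vs ! 0) es (vs ! 0)" by simp
  from walk_flow[OF w c(3) assms(2)] obtain x where x: "supp x = set es" "\<forall>e. x e \<in> {-1, 0, 1}"
    "\<forall>g :: _ \<Rightarrow> real. (\<Sum>e\<in>set es. x e * (g (s e) - g (t e))) = g (vs ! 0) - g (vs ! 0)" by blast
  have "x \<in> flows s t" by (rule flowsI[of "set es"]) (use x in auto)
  then show ?thesis using x by blast
qed

text \<open>Test the flow against the indicator of the component of \<open>u\<close>: it is constant
  along every edge of the support, so its values at \<open>u\<close> and \<open>v\<close> must
  agree.\<close>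

lemma flow_joined:
  assumes K: "oriented K s t" and u: "u \<in> verts K"
    and x: "finite (supp x)" "supp x \<subseteq> edges K" "a \<noteq> 0"
    "\<And>g :: 'v \<Rightarrow> real. (\<Sum>e\<in>supp x. x e * (g (s e) - g (t e))) = a * (g u - g v)"
  shows "joined K u v"
proof (rule ccontr)
  assume n: "\<not> joined K u v"
  define g :: "_ \<Rightarrow> real" where "g w = of_bool (joined K u w)" for w
  have "g (s e) = g (t e)" if "e \<in> supp x" for e
  proof -
    have "e \<in> edges K" using that x by auto
    then have "joined K (s e) (t e)" using orientedD[OF K] joined_edge by metis
    then have "joined K u (s e) \<longleftrightarrow> joined K u (t e)" using joined_trans joined_sym by metis
    then show ?thesis by (simp add: g_def)
  qed
  then have "a * (g u - g v) = 0" using x(4)[of g] by simp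
  then show False using x(3) n joined_refl[OF u] by (simp add: g_def)
qed

text \<open>Deleting one edge \<open>e\<close> of the support leaves a nonzero multiple of a unit
  flow between its ends. These ends are therefore joined by the remaining support, and a path there
  closes up with \<open>e\<close>; a loop is a cycle on its own.\<close>

lemma flow_cycle:
  assumes K: "oriented K s t" and z: "z \<in> flows s t" "supp z \<noteq> {}" "supp z \<subseteq> edges K"
  shows "\<exists>vs es. is_cycle K vs es \<and> set es \<subseteq> supp z"
proof -
  obtain e where e: "e \<in> supp z" using z by auto
  then have eK: "e \<in> edges K" using z by auto
  note ends = orientedD[OF K eK]
  show ?thesis
  proof (cases "s e = t e")
    case True
    then have "is_cycle K [s e] [e]" using ends eK by (auto simp: is_cycle_def)
    then show ?thesis using e by (intro exI[of _ "[s e]"] exI[of _ "[e]"]) auto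
  next
    case False
    let ?H = "spanning_subgraph K (supp z - {e})"
    have H: "oriented ?H s t" by (rule oriented_spanning[OF K]) (use z in auto)
    let ?x = "z(e := 0)"
    have sx: "supp ?x = supp z - {e}" by (auto simp: supp_def)
    have "joined ?H (s e) (t e)"
    proof (rule flow_joined[OF H, of _ ?x "- z e"])
      fix g :: "_ \<Rightarrow> real"
      have "(\<Sum>f\<in>supp z - {e}. ?x f * (g (s f) - g (t f))) = (\<Sum>f\<in>supp z - {e}. z f * (g (s f) - g (t f)))"
        by (rule sum.cong) auto
      then show "(\<Sum>f\<in>supp ?x. ?x f * (g (s f) - g (t f))) = - z e * (g (s e) - g (t e))"
        unfolding sx using flowsD[OF z(1) flows_finite[OF z(1)] order_refl, of g] e
        by (simp add: sum.remove[OF flows_finite[OF z(1)] e])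
    qed (use ends e sx flows_finite[OF z(1)] in \<open>auto simp: supp_def\<close>)
    from joined_path[OF this] obtain ws es where p: "length ws = Suc (length es)" "ws ! 0 = s e" "ws ! length es = t e"
      "distinct ws" "set ws \<subseteq> verts K" "set es \<subseteq> supp z - {e}" "\<forall>i<length es. ends K (es ! i) = {ws ! i, ws ! Suc i}"
      by auto
    have "distinct es" by (rule path_edges_distinct[OF p(4,1,7)])
    moreover have "ends K ((es @ [e]) ! i) = {ws ! i, ws ! (Suc i mod length (es @ [e]))}" if "i < length (es @ [e])" for i
    proof (cases "i = length es")
      case True
      then show ?thesis using ends p by (auto simp: nth_append)
    next
      case False
      then have "i < length es" using that by simp
      then show ?thesis using p(7) by (simp add: nth_append)
    qed
    ultimately have "is_cycle K ws (es @ [e])" using p eK z(3) by (auto simp: is_cycle_def)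
    then show ?thesis using p(6) e by (intro exI[of _ ws] exI[of _ "es @ [e]"]) auto
  qed
qed

theorem unimodular_flows: "unimodular (flows s t)"
proof
  fix z assume "z \<in> flows s t" then show "finite (supp z)" by (rule flows_finite)
next
  show "(\<lambda>_. 0) \<in> flows s t" by (rule flowsI[of "{}"]) (auto simp: supp_def)
next
  fix x y a b assume xy: "x \<in> flows s t" "y \<in> flows s t"
  let ?X = "supp x \<union> supp y"
  have fin: "finite ?X" using xy flows_finite by auto
  show "(\<lambda>e. a * x e + b * y e) \<in> flows s t"
  proof (rule flowsI[OF fin])
    fix g :: "_ \<Rightarrow> real"
    have "(\<Sum>e\<in>?X. (a * x e + b * y e) * (g (s e) - g (t e)))
      = a * (\<Sum>e\<in>?X. x e * (g (s e) - g (t e))) + b * (\<Sum>e\<in>?X. y e * (g (s e) - g (t e)))"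
      by (simp add: sum_distrib_left sum.distrib distrib_right mult.assoc)
    then show "(\<Sum>e\<in>?X. (a * x e + b * y e) * (g (s e) - g (t e))) = 0"
      using flowsD[OF xy(1) fin, of g] flowsD[OF xy(2) fin, of g] by simp
  qed (auto simp: supp_def)
next
  fix z assume z: "z \<in> flows s t" "supp z \<noteq> {}"
  \<comment> \<open>Taking exactly the support as the edge set puts the cycle inside the support;
    the unit flow around it is the required signed vector.\<close>
  let ?K = "\<lparr>verts = UNIV, edges = supp z, ends = (\<lambda>e. {s e, t e})\<rparr>"
  have K: "oriented ?K s t" by (simp add: oriented_def)
  from flow_cycle[OF K z] obtain vs es where c: "is_cycle ?K vs es" "set es \<subseteq> supp z" by auto
  then have "set es \<noteq> {}" by (auto simp: is_cycle_def)
  then show "\<exists>y\<in>flows s t. supp y \<noteq> {} \<and> supp y \<subseteq> supp z \<and> (\<forall>f. y f \<in> {-1, 0, 1})"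
    using cycle_flow[OF c(1) K] c(2) by metis
qed

lemma acyclic_iff_indep:
  assumes "oriented K s t"
  shows "acyclic_graph K \<longleftrightarrow> indep (flows s t) (edges K)"
proof
  assume "acyclic_graph K"
  then show "indep (flows s t) (edges K)"
    unfolding indep_def acyclic_graph_def using flow_cycle[OF assms] by metis
next
  assume i: "indep (flows s t) (edges K)"
  have False if c: "is_cycle K vs es" for vs es
  proof -
    obtain x where "x \<in> flows s t" "supp x = set es" using cycle_flow[OF c assms] by blast
    moreover have "set es \<subseteq> edges K" "set es \<noteq> {}" using c by (auto simp: is_cycle_def)
    ultimately show False using i unfolding indep_def by metis
  qed
  then show "acyclic_graph K" by (auto simp: acyclic_graph_def)
qed

text \<open>Modulo circulations, a representation of \<open>e\<close> on \<open>T\<close> is the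
  same as a unit flow in \<open>T\<close> from \<open>s e\<close> to \<open>t e\<close>. Such a flow
  forces the ends to be joined, and conversely a path carries one.\<close>

lemma spanned_iff_joined:
  assumes K: "oriented K s t" and T: "T \<subseteq> edges K" and e: "e \<in> edges K"
  shows "e \<in> spanned (flows s t) T \<longleftrightarrow> joined (spanning_subgraph K T) (s e) (t e)"
proof
  let ?H = "spanning_subgraph K T"
  have H: "oriented ?H s t" using oriented_spanning[OF K T] .
  {
    assume "e \<in> spanned (flows s t) T"
    then obtain x where x: "supp x \<subseteq> T" "(\<lambda>f. of_bool (f = e) - x f) \<in> flows s t"
      by (auto simp: spanned_def)
    let ?z = "\<lambda>f. of_bool (f = e) - x f"
    have sz: "supp x \<subseteq> insert e (supp ?z)" by (auto simp: supp_def)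
    then have fin: "finite (insert e (supp ?z))" "finite (supp x)" using flows_finite[OF x(2)] finite_subset by auto
    show "joined ?H (s e) (t e)"
    proof (rule flow_joined[OF H _ fin(2), of _ 1])
      fix g :: "_ \<Rightarrow> real"
      have "(\<Sum>f\<in>insert e (supp ?z). of_bool (f = e) * (g (s f) - g (t f)))
         = (\<Sum>f\<in>insert e (supp ?z). if f = e then g (s e) - g (t e) else 0)"
        by (rule sum.cong) auto
      also have "\<dots> = g (s e) - g (t e)" using fin(1) by (subst sum.delta) auto
      finally have "0 = (g (s e) - g (t e)) - (\<Sum>f\<in>insert e (supp ?z). x f * (g (s f) - g (t f)))"
        using flowsD[OF x(2) fin(1), of g] by (simp add: left_diff_distrib sum_subtractf subset_insertI)
      also have "(\<Sum>f\<in>insert e (supp ?z). x f * (g (s f) - g (t f))) = (\<Sum>f\<in>supp x. x f * (g (s f) - g (t f)))"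
        by (rule sum.mono_neutral_right) (use fin sz in \<open>auto simp: supp_def\<close>)
      finally show "(\<Sum>f\<in>supp x. x f * (g (s f) - g (t f))) = 1 * (g (s e) - g (t e))" by simp
    qed (use x orientedD[OF K e] in auto)
  }
  assume j: "joined ?H (s e) (t e)"
  from joined_path[OF this] obtain ws es where p: "length ws = Suc (length es)" "distinct ws"
    "ws ! 0 = s e" "set es \<subseteq> T" "\<forall>i<length es. ends K (es ! i) = {ws ! i, ws ! Suc i}"
    "\<forall>k\<le>length es. walk ?H (ws ! k) (drop k es) (t e)" by auto
  have "distinct es" by (rule path_edges_distinct[OF p(2,1,5)])
  moreover have "walk ?H (s e) es (t e)" using p(6)[rule_format, of 0] p(3) by simp
  ultimately obtain x where x: "supp x = set es" 
    "\<forall>g :: _ \<Rightarrow> real. (\<Sum>f\<in>set es. x f * (g (s f) - g (t f))) = g (s e) - g (t e)"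
    using walk_flow[OF _ _ H] by blast
  have "(\<lambda>f. of_bool (f = e) - x f) \<in> flows s t"
  proof (rule flowsI[of "insert e (set es)"])
    fix g :: "_ \<Rightarrow> real"
    have "(\<Sum>f\<in>insert e (set es). (of_bool (f = e) - x f) * (g (s f) - g (t f)))
       = (\<Sum>f\<in>insert e (set es). if f = e then g (s e) - g (t e) else 0) - (\<Sum>f\<in>insert e (set es). x f * (g (s f) - g (t f)))"
      unfolding sum_subtractf[symmetric] by (rule sum.cong) (auto simp: left_diff_distrib)
    also have "(\<Sum>f\<in>insert e (set es). if f = e then g (s e) - g (t e) else 0) = g (s e) - g (t e)"
      by (subst sum.delta) auto
    also have "(\<Sum>f\<in>insert e (set es). x f * (g (s f) - g (t f))) = (\<Sum>f\<in>set es. x f * (g (s f) - g (t f)))"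
      by (rule sum.mono_neutral_right) (use x in \<open>auto simp: supp_def\<close>)
    finally show "(\<Sum>f\<in>insert e (set es). (of_bool (f = e) - x f) * (g (s f) - g (t f))) = 0" using x(2) by simp
  qed (use x(1) in \<open>auto simp: supp_def\<close>)
  then show "e \<in> spanned (flows s t) T" using x(1) p(4) unfolding spanned_def by auto
qed

text \<open>Acyclicity is independence. Connectedness is spanning all of \<open>edges K\<close>: in
  the connected graph \<open>K\<close>, each edge of a walk can be replaced by a walk in
  \<open>T\<close> as soon as \<open>T\<close> spans it.\<close>

theorem spanning_trees_eq_bases:
  assumes K: "oriented K s t" "connected_graph K"
  shows "spanning_trees K = bases (flows s t) (edges K)"
proof -
  interpret unimodular "flows s t" by (rule unimodular_flows)
  have "connected_graph (spanning_subgraph K T) \<longleftrightarrow> edges K \<subseteq> spanned (flows s t) T" if T: "T \<subseteq> edges K" for T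
  proof
    assume c: "connected_graph (spanning_subgraph K T)"
    then show "edges K \<subseteq> spanned (flows s t) T"
      using spanned_iff_joined[OF K(1) T] orientedD[OF K(1)] by (auto simp: connected_graph_def)
  next
    assume sp: "edges K \<subseteq> spanned (flows s t) T"
    have "joined (spanning_subgraph K T) u v" if "joined K u v" for u v
    proof (rule joined_invariant[OF that, of "joined (spanning_subgraph K T) u"])
      show "joined (spanning_subgraph K T) u u" using joined_verts[OF that] by (intro joined_refl) simp
      fix e a b assume e: "e \<in> edges K" "ends K e = {a, b}" and j: "joined (spanning_subgraph K T) u a"
      have "joined (spanning_subgraph K T) (s e) (t e)" using sp spanned_iff_joined[OF K(1) T e(1)] e(1) by auto
      moreover have "{s e, t e} = {a, b}" using orientedD[OF K(1) e(1)] e by simp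
      ultimately have "joined (spanning_subgraph K T) a b" using joined_sym by (auto simp: doubleton_eq_iff)
      then show "joined (spanning_subgraph K T) u b" using j joined_trans by metis
    qed
    then show "connected_graph (spanning_subgraph K T)" using K(2) by (auto simp: connected_graph_def)
  qed
  note conn = this
  have acy: "acyclic_graph (spanning_subgraph K T) \<longleftrightarrow> indep (flows s t) T" if T: "T \<subseteq> edges K" for T
    using acyclic_iff_indep[OF oriented_spanning[OF K(1) T]] by simp
  show ?thesis
  proof (rule set_eqI)
    fix T
    show "T \<in> spanning_trees K \<longleftrightarrow> T \<in> bases (flows s t) (edges K)"
      using conn[of T] acy[of T] basisI[of T "edges K"] basis_spans[of T "edges K"] basesD(1,2)[of T _ "edges K"]
      unfolding spanning_trees_def by auto
  qed
qed

lemma UST_eq: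
  assumes "oriented K s t" "connected_graph K"
  shows "UST K = pmf_of_set (bases (flows s t) (edges K))"
  by (simp add: UST_def spanning_trees_eq_bases[OF assms])

lemma prob_uniform_basis:
  assumes "finite X"
  shows "measure_pmf.prob (pmf_of_set (bases Z X)) {T. F \<subseteq> T} = inclusion_prob Z X F"
proof -
  have "bases Z X \<inter> {T. F \<subseteq> T} = {B \<in> bases Z X. F \<subseteq> B}" "{B \<in> bases Z X. {} \<subseteq> B} = bases Z X" by auto
  then show ?thesis
    using measure_pmf_of_set[OF bases_nonempty[OF assms] finite_bases[OF assms]]
    by (simp add: inclusion_prob_def basis_count_def)
qed

section \<open>Random edge sets\<close>

definition edge_space :: "'e set \<Rightarrow> 'e set measure" where
  "edge_space E = sigma (Pow E) {{T \<in> Pow E. e \<in> T} |e. e \<in> E}"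

text \<open>Only presence is prescribed, never absence. Unlike full cylinders, these events have
  probabilities that are monotone along an exhaustion, and they still determine the law.\<close>

definition cyl :: "'e set \<Rightarrow> 'e set \<Rightarrow> 'e set set" where
  "cyl E F = {T \<in> Pow E. F \<subseteq> T}"

lemma subgraph_space_eq: "subgraph_space G = edge_space (edges G)"
  by (simp add: subgraph_space_def edge_space_def)

lemma space_edge_space [simp]: "space (edge_space E) = Pow E"
  unfolding edge_space_def by (rule space_measure_of) auto

lemma sets_edge_space: "sets (edge_space E) = sigma_sets (Pow E) {{T \<in> Pow E. e \<in> T} |e. e \<in> E}"
  unfolding edge_space_def by (rule sets_measure_of) auto

lemma edge_in_sets: "e \<in> E \<Longrightarrow> {T \<in> Pow E. e \<in> T} \<in> sets (edge_space E)"
  unfolding sets_edge_space by (rule sigma_sets.Basic) auto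

lemma cyl_in_sets:
  assumes "finite F" "F \<subseteq> E"
  shows "cyl E F \<in> sets (edge_space E)"
proof -
  have "cyl E F = Pow E \<inter> (\<Inter>e\<in>F. {T \<in> Pow E. e \<in> T})" by (auto simp: cyl_def)
  also have "\<dots> \<in> sets (edge_space E)"
  proof (cases "F = {}")
    case True
    then show ?thesis using sets.top[of "edge_space E"] by simp
  next
    case False
    have "{T \<in> Pow E. e \<in> T} \<in> sets (edge_space E)" if "e \<in> F" for e
      using edge_in_sets[of e E] that assms by auto
    then show ?thesis
      using False assms(1) sets.top[of "edge_space E"]
      by (intro sets.Int sets.finite_INT) simp_all
  qed
  finally show ?thesis .
qed

lemma Int_stable_cyl: "Int_stable {cyl E F |F. finite F \<and> F \<subseteq> E}"
proof (rule Int_stableI)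
  fix a b assume "a \<in> {cyl E F |F. finite F \<and> F \<subseteq> E}" "b \<in> {cyl E F |F. finite F \<and> F \<subseteq> E}"
  then obtain F F' where "a = cyl E F" "finite F" "F \<subseteq> E" "b = cyl E F'" "finite F'" "F' \<subseteq> E" by auto
  then show "a \<inter> b \<in> {cyl E F |F. finite F \<and> F \<subseteq> E}"
    by (intro CollectI exI[of _ "F \<union> F'"]) (auto simp: cyl_def)
qed

lemma sets_edge_space_cyl: "sets (edge_space E) = sigma_sets (Pow E) {cyl E F |F. finite F \<and> F \<subseteq> E}"
proof
  show "sets (edge_space E) \<subseteq> sigma_sets (Pow E) {cyl E F |F. finite F \<and> F \<subseteq> E}"
    unfolding sets_edge_space
  proof (rule sigma_sets_subseteq, clarify)
    fix e assume "e \<in> E"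
    then show "\<exists>F. {T \<in> Pow E. e \<in> T} = cyl E F \<and> finite F \<and> F \<subseteq> E"
      by (intro exI[of _ "{e}"]) (auto simp: cyl_def)
  qed
  show "sigma_sets (Pow E) {cyl E F |F. finite F \<and> F \<subseteq> E} \<subseteq> sets (edge_space E)"
    using sets.sigma_sets_subset[of "{cyl E F |F. finite F \<and> F \<subseteq> E}" "edge_space E"] cyl_in_sets[of _ E]
    by auto
qed

lemma edge_measure_eqI:
  assumes "prob_space M" "prob_space N" "sets M = sets (edge_space E)" "sets N = sets (edge_space E)"
    and eq: "\<And>F. finite F \<Longrightarrow> F \<subseteq> E \<Longrightarrow> measure M (cyl E F) = measure N (cyl E F)"
  shows "M = N"
proof -
  interpret M: prob_space M by fact
  interpret N: prob_space N by fact
  show ?thesis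
  proof (rule measure_eqI_generator_eq[where \<Omega> = "Pow E" and E = "{cyl E F |F. finite F \<and> F \<subseteq> E}" and A = "\<lambda>_. cyl E {}"])
    show "Int_stable {cyl E F |F. finite F \<and> F \<subseteq> E}" by (rule Int_stable_cyl)
    show "sets M = sigma_sets (Pow E) {cyl E F |F. finite F \<and> F \<subseteq> E}"
      "sets N = sigma_sets (Pow E) {cyl E F |F. finite F \<and> F \<subseteq> E}"
      unfolding assms(3,4) by (rule sets_edge_space_cyl)+
    fix X assume "X \<in> {cyl E F |F. finite F \<and> F \<subseteq> E}"
    then show "emeasure M X = emeasure N X" using eq by (auto simp: M.emeasure_eq_measure N.emeasure_eq_measure)
  qed (auto simp: cyl_def)
qed

lemma measurable_edge_space:
  assumes "\<And>x. x \<in> space M \<Longrightarrow> f x \<subseteq> E" "\<And>e. e \<in> E \<Longrightarrow> {x \<in> space M. e \<in> f x} \<in> sets M"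
  shows "f \<in> measurable M (edge_space E)"
  unfolding edge_space_def
proof (rule measurable_measure_of)
  show "f \<in> space M \<rightarrow> Pow E" using assms(1) by auto
  fix y assume "y \<in> {{T \<in> Pow E. e \<in> T} |e. e \<in> E}"
  then obtain e where e: "e \<in> E" "y = {T \<in> Pow E. e \<in> T}" by auto
  have "f -` y \<inter> space M = {x \<in> space M. e \<in> f x}" using e assms(1) by auto
  then show "f -` y \<inter> space M \<in> sets M" using assms(2)[OF e(1)] by simp
qed auto

lemma trace_in_sets:
  assumes "finite Y" "Y \<subseteq> E"
  shows "{T \<in> Pow E. R (T \<inter> Y)} \<in> sets (edge_space E)"
proof -
  have 1: "{T \<in> Pow E. T \<inter> Y = A} \<in> sets (edge_space E)" if "A \<subseteq> Y" for A
  proof -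
    have "{T \<in> Pow E. T \<inter> Y = A} = cyl E A - (\<Union>e\<in>Y-A. {T \<in> Pow E. e \<in> T})"
      using that by (auto simp: cyl_def)
    also have "\<dots> \<in> sets (edge_space E)"
      using assms that edge_in_sets[of _ E] finite_subset[OF that]
      by (intro sets.Diff cyl_in_sets sets.finite_UN) auto
    finally show ?thesis .
  qed
  have "{T \<in> Pow E. R (T \<inter> Y)} = (\<Union>A\<in>{A\<in>Pow Y. R A}. {T \<in> Pow E. T \<inter> Y = A})" by auto
  also have "\<dots> \<in> sets (edge_space E)" using 1 assms by (intro sets.finite_UN) auto
  finally show ?thesis .
qed

lemma trace_function_eq:
  assumes "finite Y"
  shows "h (T \<inter> Y) = (\<Sum>A\<in>Pow Y. h A * indicator {T. T \<inter> Y = A} T :: real)"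
proof -
  have "(\<Sum>A\<in>Pow Y. h A * indicator {T. T \<inter> Y = A} T) = (\<Sum>A\<in>Pow Y. if A = T \<inter> Y then h A else 0)"
    by (rule sum.cong) (auto simp: indicator_def)
  then show ?thesis using assms by simp
qed

lemma trace_function_measurable:
  assumes "finite Y" "Y \<subseteq> E" "sets M = sets (edge_space E)"
  shows "(\<lambda>T. h (T \<inter> Y) :: real) \<in> borel_measurable M"
proof -
  have "(\<lambda>T. h (T \<inter> Y) :: real) \<in> borel_measurable (edge_space E)"
  proof (rule borel_measurableI)
    fix S :: "real set" assume "open S"
    have "(\<lambda>T. h (T \<inter> Y)) -` S \<inter> space (edge_space E) = {T \<in> Pow E. h (T \<inter> Y) \<in> S}" by auto
    then show "(\<lambda>T. h (T \<inter> Y)) -` S \<inter> space (edge_space E) \<in> sets (edge_space E)"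
      using trace_in_sets[OF assms(1,2), of "\<lambda>A. h A \<in> S"] by simp
  qed
  then show ?thesis using measurable_cong_sets[OF assms(3) refl] by blast
qed

lemma integral_trace_function:
  assumes "finite Y" "Y \<subseteq> E" "sets M = sets (edge_space E)" "prob_space M"
  shows "(\<integral>T. h (T \<inter> Y) \<partial>M) = (\<Sum>A\<in>Pow Y. h A * measure M {T \<in> space M. T \<inter> Y = A})"
proof -
  interpret prob_space M by fact
  have sp: "space M = Pow E" using sets_eq_imp_space_eq[OF assms(3)] by simp
  have meas: "{T \<in> space M. T \<inter> Y = A} \<in> sets M" for A
    using trace_in_sets[OF assms(1,2), of "\<lambda>B. B = A"] assms(3) sp by simp
  have "(\<integral>T. h (T \<inter> Y) \<partial>M) = (\<integral>T. (\<Sum>A\<in>Pow Y. h A * indicator {T \<in> space M. T \<inter> Y = A} T) \<partial>M)"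
  proof (rule Bochner_Integration.integral_cong[OF refl])
    fix T assume "T \<in> space M"
    then show "h (T \<inter> Y) = (\<Sum>A\<in>Pow Y. h A * indicator {T \<in> space M. T \<inter> Y = A} T)"
      by (subst trace_function_eq[OF assms(1)]) (auto intro!: sum.cong simp: indicator_def)
  qed
  also have "\<dots> = (\<Sum>A\<in>Pow Y. h A * measure M {T \<in> space M. T \<inter> Y = A})"
    using meas by (subst Bochner_Integration.integral_sum) (auto simp: emeasure_eq_measure)
  finally show ?thesis .
qed

lemma expectation_trace_pmf:
  assumes "finite Y"
  shows "measure_pmf.expectation p (\<lambda>T. h (T \<inter> Y)) = (\<Sum>A\<in>Pow Y. h A * measure_pmf.prob p {T. T \<inter> Y = A})"
  by (subst trace_function_eq[OF assms]) (subst Bochner_Integration.integral_sum, auto simp: measure_pmf.emeasure_eq_measure)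

text \<open>Inclusion-exclusion one edge at a time; it carries convergence from inclusion events to
  the point masses of finite traces.\<close>

lemma prob_avoid_insert:
  assumes "prob_space M" "{T \<in> space M. A \<subseteq> T \<and> T \<inter> D = {}} \<in> sets M"
    "{T \<in> space M. insert d A \<subseteq> T \<and> T \<inter> D = {}} \<in> sets M"
  shows "measure M {T \<in> space M. A \<subseteq> T \<and> T \<inter> insert d D = {}} =
    measure M {T \<in> space M. A \<subseteq> T \<and> T \<inter> D = {}} - measure M {T \<in> space M. insert d A \<subseteq> T \<and> T \<inter> D = {}}"
proof -
  interpret prob_space M by fact
  have "{T \<in> space M. A \<subseteq> T \<and> T \<inter> insert d D = {}} =
    {T \<in> space M. A \<subseteq> T \<and> T \<inter> D = {}} - {T \<in> space M. insert d A \<subseteq> T \<and> T \<inter> D = {}}" by auto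
  then show ?thesis using assms(2,3) by (simp only:) (rule finite_measure_Diff, auto)
qed

lemma trace_split: "A \<subseteq> F \<Longrightarrow> T \<inter> F = A \<longleftrightarrow> A \<subseteq> T \<and> T \<inter> (F - A) = {}"
  by auto

lemma local_weak_limitI:
  assumes M: "prob_space M" "sets M = sets (edge_space (edges G))"
    and lim: "\<And>F. finite F \<Longrightarrow> F \<subseteq> edges G \<Longrightarrow>
      (\<lambda>n. measure_pmf.prob (P n) {T. F \<subseteq> T}) \<longlonglongrightarrow> measure M (cyl (edges G) F)"
  shows "local_weak_limit G P M"
proof -
  let ?E = "edges G"
  have sp: "space M = Pow ?E" using sets_eq_imp_space_eq[OF M(2)] by simp
  have meas: "{T \<in> space M. A \<subseteq> T \<and> T \<inter> D = {}} \<in> sets M" if "finite A" "finite D" "A \<subseteq> ?E" "D \<subseteq> ?E" for A D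
  proof -
    have "{T \<in> space M. A \<subseteq> T \<and> T \<inter> D = {}} = {T \<in> Pow ?E. A \<subseteq> T \<inter> (A \<union> D) \<and> T \<inter> (A \<union> D) \<inter> D = {}}"
      using sp by auto
    then show ?thesis using trace_in_sets[of "A \<union> D" ?E "\<lambda>B. A \<subseteq> B \<and> B \<inter> D = {}"] that M(2) by simp
  qed
  have "(\<lambda>n. measure_pmf.prob (P n) {T. A \<subseteq> T \<and> T \<inter> D = {}}) \<longlonglongrightarrow> measure M {T \<in> space M. A \<subseteq> T \<and> T \<inter> D = {}}"
    if "finite D" "finite A" "A \<subseteq> ?E" "D \<subseteq> ?E" for A D
    using that
  proof (induction D arbitrary: A rule: finite_induct)
    case empty
    have "cyl ?E A = {T \<in> space M. A \<subseteq> T}" using sp by (auto simp: cyl_def)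
    then show ?case using lim[of A] empty by simp
  next
    case (insert d D)
    have "measure_pmf.prob (P n) {T. A \<subseteq> T \<and> T \<inter> insert d D = {}} =
        measure_pmf.prob (P n) {T. A \<subseteq> T \<and> T \<inter> D = {}} - measure_pmf.prob (P n) {T. insert d A \<subseteq> T \<and> T \<inter> D = {}}" for n
      using prob_avoid_insert[OF prob_space_measure_pmf[of "P n"], of A D d] by simp
    moreover have "measure M {T \<in> space M. A \<subseteq> T \<and> T \<inter> insert d D = {}} =
        measure M {T \<in> space M. A \<subseteq> T \<and> T \<inter> D = {}} - measure M {T \<in> space M. insert d A \<subseteq> T \<and> T \<inter> D = {}}"
      using insert by (intro prob_avoid_insert[OF M(1)] meas) auto
    moreover have "(\<lambda>n. measure_pmf.prob (P n) {T. A \<subseteq> T \<and> T \<inter> D = {}} - measure_pmf.prob (P n) {T. insert d A \<subseteq> T \<and> T \<inter> D = {}})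
       \<longlonglongrightarrow> measure M {T \<in> space M. A \<subseteq> T \<and> T \<inter> D = {}} - measure M {T \<in> space M. insert d A \<subseteq> T \<and> T \<inter> D = {}}"
      using insert by (intro tendsto_diff insert.IH) auto
    ultimately show ?case by simp
  qed
  note lim' = this
  show ?thesis unfolding local_weak_limit_def
  proof (intro allI impI)
    fix F A assume F: "finite F" "F \<subseteq> ?E" "A \<subseteq> F"
    show "(\<lambda>n. measure_pmf.prob (P n) {T. T \<inter> F = A}) \<longlonglongrightarrow> measure M {T \<in> space M. T \<inter> F = A}"
      unfolding trace_split[OF F(3)] using F finite_subset[OF F(3,1)] by (intro lim') auto
  qed
qed

lemma local_weak_limitD:
  assumes "local_weak_limit G P M" "sets M = sets (edge_space (edges G))" "finite F" "F \<subseteq> edges G"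
  shows "(\<lambda>n. measure_pmf.prob (P n) {T. F \<subseteq> T}) \<longlonglongrightarrow> measure M (cyl (edges G) F)"
proof -
  have sp: "space M = Pow (edges G)" using sets_eq_imp_space_eq[OF assms(2)] by simp
  have "{T. T \<inter> F = F} = {T. F \<subseteq> T}" "{T \<in> space M. T \<inter> F = F} = cyl (edges G) F"
    using sp by (auto simp: cyl_def)
  moreover have "(\<lambda>n. measure_pmf.prob (P n) {T. T \<inter> F = F}) \<longlonglongrightarrow> measure M {T \<in> space M. T \<inter> F = F}"
    using assms unfolding local_weak_limit_def by blast
  ultimately show ?thesis by simp
qed

text \<open>Kolmogorov extension: the limits of the laws of finite traces form a consistent family,
  since taking a smaller trace commutes with the limit. Prescribing only limits of inclusion
  probabilities suffices, because \<open>prob_avoid_insert\<close> recovers all point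
  masses.\<close>

theorem cylinder_limit_exists:
  fixes P :: "nat \<Rightarrow> 'e set pmf" and E :: "'e set"
  assumes lim: "\<And>F. finite F \<Longrightarrow> F \<subseteq> E \<Longrightarrow> (\<lambda>n. measure_pmf.prob (P n) {T. F \<subseteq> T}) \<longlonglongrightarrow> L F"
  shows "\<exists>M. prob_space M \<and> sets M = sets (edge_space E) \<and>
    (\<forall>F. finite F \<longrightarrow> F \<subseteq> E \<longrightarrow> measure M (cyl E F) = L F)"
proof -
  have conv: "convergent (\<lambda>n. measure_pmf.prob (P n) {T. A \<subseteq> T \<and> T \<inter> D = {}})"
    if "finite D" "finite A" "A \<subseteq> E" "D \<subseteq> E" for A D
    using that
  proof (induction D arbitrary: A rule: finite_induct)
    case empty
    then show ?case using lim[of A] by (auto simp: convergent_def)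
  next
    case (insert d D)
    have "measure_pmf.prob (P n) {T. A \<subseteq> T \<and> T \<inter> insert d D = {}} =
        measure_pmf.prob (P n) {T. A \<subseteq> T \<and> T \<inter> D = {}} - measure_pmf.prob (P n) {T. insert d A \<subseteq> T \<and> T \<inter> D = {}}" for n
      using prob_avoid_insert[OF prob_space_measure_pmf[of "P n"], of A D d] by simp
    then show ?case using insert by (simp only:) (intro convergent_diff insert.IH, auto)
  qed
  define q where "q J A = Topological_Spaces.lim (\<lambda>n. measure_pmf.prob (P n) {T. T \<inter> J = A})" for J A
  have q: "(\<lambda>n. measure_pmf.prob (P n) {T. T \<inter> J = A}) \<longlonglongrightarrow> q J A"
    if "finite J" "J \<subseteq> E" "A \<subseteq> J" for J A
    unfolding q_def convergent_LIMSEQ_iff[symmetric] trace_split[OF that(3)]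
    using that finite_subset[OF that(3)] by (intro conv) auto
  have qR: "(\<lambda>n. measure_pmf.prob (P n) {T. R (T \<inter> J)}) \<longlonglongrightarrow> (\<Sum>A\<in>{A\<in>Pow J. R A}. q J A)"
    if J: "finite J" "J \<subseteq> E" for J R
  proof -
    have "measure_pmf.prob (P n) {T. R (T \<inter> J)} = (\<Sum>A\<in>{A\<in>Pow J. R A}. measure_pmf.prob (P n) {T. T \<inter> J = A})" for n
    proof -
      have "{T. R (T \<inter> J)} = (\<Union>A\<in>{A\<in>Pow J. R A}. {T. T \<inter> J = A})" by auto
      then show ?thesis
        using J by (simp only:) (rule measure_pmf.finite_measure_finite_Union, auto simp: disjoint_family_on_def)
    qed
    then show ?thesis using q[OF J] by (simp only:) (intro tendsto_sum, auto)
  qed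
  define Q where "Q J = embed_pmf (\<lambda>A. if A \<subseteq> J then q J A else 0)" for J
  have pmfQ: "pmf (Q J) A = (if A \<subseteq> J then q J A else 0)" if J: "finite J" "J \<subseteq> E" for J A
    unfolding Q_def
  proof (rule pmf_embed_pmf)
    have nn: "q J A \<ge> 0" if "A \<subseteq> J" for A
      by (rule LIMSEQ_le_const[OF q[OF J that]]) auto
    then show "(if A \<subseteq> J then q J A else 0) \<ge> 0" for A by simp
    have "(\<integral>\<^sup>+ A. ennreal (if A \<subseteq> J then q J A else 0) \<partial>count_space UNIV) = (\<Sum>A\<in>Pow J. ennreal (if A \<subseteq> J then q J A else 0))"
      using J by (intro nn_integral_count_space') auto
    also have "\<dots> = ennreal (\<Sum>A\<in>Pow J. q J A)"
      by (subst sum_ennreal[symmetric]) (use nn in auto)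
    also have "(\<Sum>A\<in>Pow J. q J A) = 1"
      using LIMSEQ_unique[OF qR[OF J, of "\<lambda>_. True"], of 1] measure_pmf.prob_space by (simp add: Pow_def)
    finally show "(\<integral>\<^sup>+ A. ennreal (if A \<subseteq> J then q J A else 0) \<partial>count_space UNIV) = 1" by simp
  qed
  have QR: "(\<lambda>n. measure_pmf.prob (P n) {T. R (T \<inter> J)}) \<longlonglongrightarrow> measure_pmf.prob (Q J) {A. R A}"
    if J: "finite J" "J \<subseteq> E" for J R
  proof -
    have s: "set_pmf (Q J) \<subseteq> Pow J" using pmfQ[OF J] by (auto simp: set_pmf_eq split: if_splits)
    have "measure_pmf.prob (Q J) {A. R A} = measure_pmf.prob (Q J) {A\<in>Pow J. R A}"
      by (rule measure_eq_AE) (use s in \<open>auto simp: AE_measure_pmf_iff\<close>)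
    also have "\<dots> = (\<Sum>A\<in>{A\<in>Pow J. R A}. pmf (Q J) A)"
      using J by (intro measure_measure_pmf_finite) auto
    also have "\<dots> = (\<Sum>A\<in>{A\<in>Pow J. R A}. q J A)" using pmfQ[OF J] by (intro sum.cong) auto
    finally show ?thesis using qR[OF J] by simp
  qed
  have Qcons: "map_pmf (\<lambda>A. A \<inter> J) (Q H) = Q J" if "J \<subseteq> H" "finite H" "H \<subseteq> E" for J H
  proof (rule pmf_eqI)
    fix B
    have J: "finite J" "J \<subseteq> E" using that finite_subset by auto
    have "T \<inter> H \<inter> J = T \<inter> J" for T using that by auto
    then have lim: "(\<lambda>n. measure_pmf.prob (P n) {T. T \<inter> J = B}) \<longlonglongrightarrow> measure_pmf.prob (Q H) {A. A \<inter> J = B}"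
      using QR[OF that(2,3), of "\<lambda>A. A \<inter> J = B"] by simp
    have "pmf (map_pmf (\<lambda>A. A \<inter> J) (Q H)) B = measure_pmf.prob (Q H) {A. A \<inter> J = B}"
      by (simp add: pmf_map vimage_def)
    also have "\<dots> = measure_pmf.prob (Q J) {A. A = B}"
      by (rule LIMSEQ_unique[OF lim QR[OF J, of "\<lambda>A. A = B"]])
    finally show "pmf (map_pmf (\<lambda>A. A \<inter> J) (Q H)) B = pmf (Q J) B" by (simp add: pmf.rep_eq)
  qed
  \<comment> \<open>Traces are encoded as 0/1 vectors of reals, since the projective limit is taken
    over copies of a Polish space.\<close>
  define ind where "ind J A = (\<lambda>e\<in>J. indicator A e :: real)" for J A :: "'e set"
  have ind_meas: "ind J \<in> measurable (count_space UNIV) (PiM J (\<lambda>_. borel))" for J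
  proof -
    have "ind J A \<in> space (PiM J (\<lambda>_. borel))" for A unfolding ind_def space_PiM by simp
    then show ?thesis unfolding measurable_count_space_eq1 by (rule Pi_I)
  qed
  define PP where "PP J = distr (measure_pmf (Q J)) (PiM J (\<lambda>_. borel)) (ind J)" for J
  interpret PF: polish_projective E PP
  proof (intro polish_projective.intro projective_family.intro)
    fix J H assume JH: "J \<subseteq> H" "finite H" "H \<subseteq> E"
    have "PP J = distr (measure_pmf (map_pmf (\<lambda>A. A \<inter> J) (Q H))) (PiM J (\<lambda>_. borel)) (ind J)"
      using Qcons[OF JH] by (simp add: PP_def)
    also have "\<dots> = distr (measure_pmf (Q H)) (PiM J (\<lambda>_. borel)) (ind J \<circ> (\<lambda>A. A \<inter> J))"
      unfolding map_pmf_rep_eq by (rule distr_distr[OF ind_meas]) simp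
    also have "ind J \<circ> (\<lambda>A. A \<inter> J) = (\<lambda>f. restrict f J) \<circ> ind H"
      using JH by (auto simp: ind_def fun_eq_iff indicator_def restrict_def)
    also have "distr (measure_pmf (Q H)) (PiM J (\<lambda>_. borel)) ((\<lambda>f. restrict f J) \<circ> ind H)
        = distr (PP H) (PiM J (\<lambda>_. borel)) (\<lambda>f. restrict f J)"
      unfolding PP_def using JH ind_meas[of H]
      by (intro distr_distr[symmetric] measurable_restrict_subset) auto
    finally show "PP J = distr (PP H) (PiM J (\<lambda>_. borel)) (\<lambda>f. restrict f J)" .
  next
    fix J show "prob_space (PP J)"
      unfolding PP_def using ind_meas[of J]
      by (intro prob_space.prob_space_distr measure_pmf.prob_space_axioms) auto
  qed
  \<comment> \<open>Decoding: any value other than 1 counts as absence, so the map is defined and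
    measurable on the whole product.\<close>
  let ?f = "\<lambda>f. {e \<in> E. f e = (1::real)}"
  have sl: "sets PF.lim = sets (PiM E (\<lambda>_. borel))" by simp
  have f_meas: "?f \<in> measurable PF.lim (edge_space E)"
  proof (rule measurable_edge_space)
    fix e assume e: "e \<in> E"
    have "{x \<in> space PF.lim. e \<in> ?f x} = (\<lambda>f. f e) -` {1} \<inter> space PF.lim" using e by auto
    also have "\<dots> \<in> sets PF.lim"
      using measurable_component_singleton[OF e, of "\<lambda>_. borel"]
      by (intro measurable_sets[of _ _ borel]) (simp_all add: measurable_cong_sets[OF sl refl])
    finally show "{x \<in> space PF.lim. e \<in> ?f x} \<in> sets PF.lim" .
  qed auto
  let ?M = "distr PF.lim (edge_space E) ?f"
  have "measure ?M (cyl E F) = L F" if F: "finite F" "F \<subseteq> E" for F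
  proof -
    define X where "X = PiE F (\<lambda>_. {1::real})"
    have X: "X \<in> sets (PiM F (\<lambda>_. borel))" unfolding X_def using F by (intro sets_PiM_I_finite) auto
    have restr: "restrict x F \<in> X \<longleftrightarrow> (\<forall>e\<in>F. x e = 1)" for x unfolding X_def PiE_iff by simp
    have "?f -` cyl E F \<inter> space PF.lim = PF.emb E F X"
      using F by (auto simp: cyl_def prod_emb_def space_PiM restr)
    then have "emeasure ?M (cyl E F) = emeasure (PP F) X"
      using PF.emeasure_lim_emb[OF F(2,1) X] cyl_in_sets[OF F] by (simp add: emeasure_distr[OF f_meas])
    also have "\<dots> = emeasure (Q F) (ind F -` X \<inter> space (Q F))"
      unfolding PP_def using X ind_meas[of F] by (intro emeasure_distr) auto
    also have "ind F -` X \<inter> space (Q F) = {A. F \<subseteq> A}"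
      by (auto simp: ind_def restr indicator_eq_1_iff)
    finally have M: "measure ?M (cyl E F) = measure_pmf.prob (Q F) {A. F \<subseteq> A}" by (simp add: measure_def)
    have "(\<lambda>n. measure_pmf.prob (P n) {T. F \<subseteq> T}) \<longlonglongrightarrow> measure_pmf.prob (Q F) {A. F \<subseteq> A}"
      using QR[OF F, of "\<lambda>A. F \<subseteq> A"] by simp
    then show ?thesis unfolding M by (rule LIMSEQ_unique[OF _ lim[OF F]])
  qed
  moreover have "prob_space ?M" by (rule PF.P.prob_space_distr[OF f_meas])
  ultimately show ?thesis by (intro exI[of _ ?M]) auto
qed

section \<open>Existence of the two forests\<close>

lemma (in unimodular) inclusion_prob_antimono_edges:
  "finite X' \<Longrightarrow> X \<subseteq> X' \<Longrightarrow> F \<subseteq> X \<Longrightarrow> inclusion_prob Z X' F \<le> inclusion_prob Z X F"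
  by (rule inclusion_prob_antimono[OF unimodular_axioms unimodular_axioms]) auto

text \<open>An infimum because inclusion probabilities fall as edges are added; this makes the limit
  independent of the exhaustion. The sets \<open>X\<close> range over all finite ones, connected or
  not.\<close>

definition free_prob :: "('e \<Rightarrow> real) set \<Rightarrow> 'e set \<Rightarrow> 'e set \<Rightarrow> real" where
  "free_prob Z E F = Inf {inclusion_prob Z X F |X. finite X \<and> F \<subseteq> X \<and> X \<subseteq> E}"

lemma finite_subset_incseq:
  assumes "finite F" "F \<subseteq> (\<Union>n. X n)" "incseq X"
  shows "\<exists>N. \<forall>n\<ge>N. F \<subseteq> X n"
proof -
  have "\<forall>e\<in>F. \<exists>n. e \<in> X n" using assms(2) by auto
  then obtain k where k: "\<forall>e\<in>F. e \<in> X (k e)" by (rule bchoice[THEN exE])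
  \<comment> \<open>The sum serves as an upper bound of all the indices, also when \<open>F\<close>
    is empty.\<close>
  have "F \<subseteq> X n" if "n \<ge> (\<Sum>e\<in>F. k e)" for n
  proof
    fix e assume e: "e \<in> F"
    then have "k e \<le> n" using that member_le_sum[of e F k] assms(1) by simp
    then show "e \<in> X n" using k e incseqD[OF assms(3)] by blast
  qed
  then show ?thesis by blast
qed

text \<open>Any finite set nearly attaining the infimum is eventually contained in
  \<open>X n\<close>, and monotonicity keeps later values below it.\<close>

lemma (in unimodular) free_prob_limit:
  assumes X: "incseq X" "\<And>n. finite (X n)" "(\<Union>n. X n) = E" and F: "finite F" "F \<subseteq> E"
  shows "(\<lambda>n. inclusion_prob Z (X n) F) \<longlonglongrightarrow> free_prob Z E F"
proof -
  let ?S = "{inclusion_prob Z X F |X. finite X \<and> F \<subseteq> X \<and> X \<subseteq> E}"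
  have bdd: "bdd_below ?S" by (rule bdd_belowI[of _ 0]) (auto simp: inclusion_prob_nonneg)
  have ne: "?S \<noteq> {}" using F by auto
  obtain N where N: "\<forall>n\<ge>N. F \<subseteq> X n" using finite_subset_incseq[of F X] F X by auto
  show ?thesis
  proof (rule order_tendstoI)
    fix a assume a: "a < free_prob Z E F"
    have "a < inclusion_prob Z (X n) F" if "n \<ge> N" for n
    proof -
      have "inclusion_prob Z (X n) F \<in> ?S" using N that X by blast
      then have "free_prob Z E F \<le> inclusion_prob Z (X n) F" unfolding free_prob_def using bdd by (rule cInf_lower)
      then show ?thesis using a by simp
    qed
    then show "\<forall>\<^sub>F n in sequentially. a < inclusion_prob Z (X n) F" using eventually_sequentially by auto
  next
    fix a assume "free_prob Z E F < a"
    then obtain b where "b \<in> ?S" "b < a" unfolding free_prob_def cInf_less_iff[OF ne bdd] by blast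
    then obtain X0 where X0: "finite X0" "F \<subseteq> X0" "X0 \<subseteq> E" "inclusion_prob Z X0 F < a" by blast
    obtain N0 where N0: "\<forall>n\<ge>N0. X0 \<subseteq> X n" using finite_subset_incseq[of X0 X] X0 X by auto
    have "inclusion_prob Z (X n) F < a" if "n \<ge> N0" for n
      using inclusion_prob_antimono_edges[OF X(2) N0[rule_format, OF that] X0(2)] X0(4) by simp
    then show "\<forall>\<^sub>F n in sequentially. inclusion_prob Z (X n) F < a" using eventually_sequentially by auto
  qed
qed

lemma oriented_wf: "oriented K s t \<Longrightarrow> wf_graph K"
  unfolding oriented_def wf_graph_def by blast

lemma oriented_subgraph:
  assumes "oriented G s t" "subgraph H G"
  shows "oriented H s t"
  unfolding oriented_def
proof
  fix e assume e: "e \<in> edges H"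
  then have "ends H e = {s e, t e}" using assms orientedD(1)[OF assms(1)] by (auto simp: subgraph_def)
  moreover have "ends H e \<subseteq> verts H" using assms(2) e by (auto simp: subgraph_def wf_graph_def)
  ultimately show "ends H e = {s e, t e} \<and> s e \<in> verts H \<and> t e \<in> verts H" by simp
qed

section \<open>Exhaustions and the free limit\<close>

definition induced :: "('v, 'e) mgraph \<Rightarrow> 'v set \<Rightarrow> ('v, 'e) mgraph" where
  "induced G W = \<lparr>verts = W, edges = {e \<in> edges G. ends G e \<subseteq> W}, ends = ends G\<rparr>"

lemma induced_simps [simp]:
  "verts (induced G W) = W"
  "edges (induced G W) = {e \<in> edges G. ends G e \<subseteq> W}"
  "ends (induced G W) = ends G"
  by (simp_all add: induced_def)

lemma wf_induced: "wf_graph G \<Longrightarrow> wf_graph (induced G W)"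
  unfolding wf_graph_def
proof
  fix e assume wf: "\<forall>e\<in>edges G. \<exists>u\<in>verts G. \<exists>v\<in>verts G. ends G e = {u, v}" and e: "e \<in> edges (induced G W)"
  then obtain u v where "ends G e = {u, v}" by auto
  then show "\<exists>u\<in>verts (induced G W). \<exists>v\<in>verts (induced G W). ends (induced G W) e = {u, v}"
    using e by auto
qed

lemma finite_incident:
  assumes "locally_finite G" "finite W" "W \<subseteq> verts G"
  shows "finite {e \<in> edges G. ends G e \<inter> W \<noteq> {}}"
proof -
  have "{e \<in> edges G. ends G e \<inter> W \<noteq> {}} = (\<Union>v\<in>W. {e \<in> edges G. v \<in> ends G e})" by auto
  then show ?thesis using assms by (auto simp: locally_finite_def)
qed

lemma finite_induced_edges:
  assumes "wf_graph G" "locally_finite G" "finite W" "W \<subseteq> verts G"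
  shows "finite (edges (induced G W))"
proof (rule finite_subset[OF _ finite_incident[OF assms(2-4)]])
  show "edges (induced G W) \<subseteq> {e \<in> edges G. ends G e \<inter> W \<noteq> {}}"
    using assms(1) by (auto simp: wf_graph_def)
qed

text \<open>The balls around a vertex: they are finite by local finiteness, and connected because
  the suffixes of a short walk to the centre are short walks, so the walk stays in the ball.\<close>

theorem induced_exhaustion_exists:
  assumes G: "wf_graph G" "locally_finite G" "connected_graph G"
  shows "\<exists>Gs. exhaustion G Gs \<and> (\<forall>n. induced_subgraph (Gs n) G)"
proof -
  obtain v0 where v0: "v0 \<in> verts G" using G(3) by (auto simp: connected_graph_def)
  define W where "W n = {u. \<exists>es. length es \<le> n \<and> walk G u es v0}" for n :: nat
  have Wv: "W n \<subseteq> verts G" for n unfolding W_def by (auto dest: walk_verts)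
  have v0W: "v0 \<in> W n" for n unfolding W_def using v0 by (auto intro!: exI[of _ "[]"])
  have fin: "finite (W n)" for n
  proof (induction n)
    case 0
    have "W 0 \<subseteq> {v0}" by (auto simp: W_def)
    then show ?case using finite_subset by blast
  next
    case (Suc n)
    have "W (Suc n) \<subseteq> {v0} \<union> (\<Union>e\<in>{e \<in> edges G. ends G e \<inter> W n \<noteq> {}}. ends G e)"
    proof
      fix u assume "u \<in> W (Suc n)"
      then obtain es where es: "length es \<le> Suc n" "walk G u es v0" by (auto simp: W_def)
      show "u \<in> {v0} \<union> (\<Union>e\<in>{e \<in> edges G. ends G e \<inter> W n \<noteq> {}}. ends G e)"
      proof (cases es)
        case (Cons e fs)
        then obtain w where "e \<in> edges G" "ends G e = {u, w}" "walk G w fs v0" using es by auto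
        moreover then have "w \<in> W n" using es Cons by (auto simp: W_def)
        ultimately show ?thesis by auto
      qed (use es in auto)
    qed
    moreover have "finite (ends G e)" if "e \<in> edges G" for e using G(1) that by (auto simp: wf_graph_def)
    ultimately show ?case
      using finite_incident[OF G(2) Suc Wv] by (elim finite_subset) auto
  qed
  have mono: "W n \<subseteq> W (Suc n)" for n unfolding W_def using le_SucI by blast
  have un: "(\<Union>n. W n) = verts G"
  proof
    show "verts G \<subseteq> (\<Union>n. W n)"
    proof
      fix u assume "u \<in> verts G"
      then obtain es where "walk G u es v0" using G(3) v0 by (auto simp: connected_graph_def joined_def)
      then have "u \<in> W (length es)" by (auto simp: W_def)
      then show "u \<in> (\<Union>n. W n)" by blast
    qed
  qed (use Wv in auto)
  have conn: "joined (induced G (W n)) u v0" if "u \<in> W n" for u n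
  proof -
    have "walk (induced G (W n)) u es v0" if "walk G u es v0" "length es \<le> n" for es
      using that
    proof (induction es arbitrary: u)
      case Nil
      then show ?case using v0W by auto
    next
      case (Cons e es)
      then obtain w where w: "e \<in> edges G" "ends G e = {u, w}" "walk G w es v0" by auto
      have "w \<in> W n" unfolding W_def using Cons(3) w(3) by (auto intro!: exI[of _ es])
      moreover have "u \<in> W n" unfolding W_def by (rule CollectI, rule exI[of _ "e # es"]) (use Cons(2,3) in simp)
      ultimately have "u \<in> W n" "w \<in> W n" by auto
      then show ?case using w Cons.IH[OF w(3)] Cons(3) by auto
    qed
    then show ?thesis using that unfolding W_def joined_def by blast
  qed
  let ?Gs = "\<lambda>n. induced G (W n)"
  have sub: "subgraph (?Gs n) G" for n
    using wf_induced[OF G(1)] Wv by (auto simp: subgraph_def)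
  have "connected_graph (?Gs n)" for n
    unfolding connected_graph_def using conn v0W joined_trans joined_sym by (metis empty_iff induced_simps(1))
  moreover have "finite_graph (?Gs n)" for n
    using fin finite_induced_edges[OF G(1,2) fin Wv] by (auto simp: finite_graph_def)
  moreover have "subgraph (?Gs n) (?Gs (Suc n))" for n
    using wf_induced[OF G(1)] mono[of n] by (auto simp: subgraph_def)
  moreover have "(\<Union>n. edges (?Gs n)) = edges G"
  proof -
    have "\<exists>n. ends G e \<subseteq> W n" if "e \<in> edges G" for e
    proof -
      have "finite (ends G e)" "ends G e \<subseteq> (\<Union>n. W n)" using G(1) that un by (auto simp: wf_graph_def)
      then show ?thesis using finite_subset_incseq[of "ends G e" W] incseq_SucI[of W, OF mono] by blast
    qed
    then show ?thesis by auto
  qed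
  ultimately have "exhaustion G ?Gs" using sub un by (auto simp: exhaustion_def)
  moreover have "induced_subgraph (?Gs n) G" for n using sub by (auto simp: induced_subgraph_def)
  ultimately show ?thesis by blast
qed

lemma exhaustionD:
  assumes "exhaustion G Gs"
  shows "subgraph (Gs n) G" "finite_graph (Gs n)" "connected_graph (Gs n)"
    "incseq (\<lambda>n. verts (Gs n))" "incseq (\<lambda>n. edges (Gs n))"
    "(\<Union>n. verts (Gs n)) = verts G" "(\<Union>n. edges (Gs n)) = edges G"
  using assms by (auto simp: exhaustion_def subgraph_def intro!: incseq_SucI)

lemma UST_free_limit:
  assumes G: "oriented G s t" and Gs: "exhaustion G Gs" and F: "finite F" "F \<subseteq> edges G"
  shows "(\<lambda>n. measure_pmf.prob (UST (Gs n)) {T. F \<subseteq> T}) \<longlonglongrightarrow> free_prob (flows s t) (edges G) F"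
proof -
  interpret unimodular "flows s t" by (rule unimodular_flows)
  have fin: "finite (edges (Gs n))" for n using exhaustionD(2)[OF Gs] by (simp add: finite_graph_def)
  have "measure_pmf.prob (UST (Gs n)) {T. F \<subseteq> T} = inclusion_prob (flows s t) (edges (Gs n)) F" for n
    using UST_eq[OF oriented_subgraph[OF G exhaustionD(1)[OF Gs]] exhaustionD(3)[OF Gs]]
      prob_uniform_basis[OF fin] by simp
  then show ?thesis using free_prob_limit[OF exhaustionD(5)[OF Gs] fin exhaustionD(7)[OF Gs] F] by simp
qed

text \<open>Serves both forests: \<open>R\<close> selects the admissible exhaustions and
  \<open>P\<close> the finite laws. One exhaustion constructs a candidate; since \<open>L\<close>
  does not depend on the exhaustion, the candidate is a limit along all of them, and its cylinder
  probabilities make it unique.\<close>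

lemma the_limit_law:
  assumes ex: "\<exists>Gs. R Gs"
    and lim: "\<And>Gs F. R Gs \<Longrightarrow> finite F \<Longrightarrow> F \<subseteq> edges G \<Longrightarrow>
      (\<lambda>n. measure_pmf.prob (P Gs n) {T. F \<subseteq> T}) \<longlonglongrightarrow> L F"
  defines "M \<equiv> (THE M. prob_space M \<and> sets M = sets (subgraph_space G) \<and> (\<forall>Gs. R Gs \<longrightarrow> local_weak_limit G (P Gs) M))"
  shows "prob_space M" "sets M = sets (edge_space (edges G))"
    "finite F \<Longrightarrow> F \<subseteq> edges G \<Longrightarrow> measure M (cyl (edges G) F) = L F"
proof -
  let ?R = "\<lambda>M. prob_space M \<and> sets M = sets (subgraph_space G) \<and> (\<forall>Gs. R Gs \<longrightarrow> local_weak_limit G (P Gs) M)"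
  obtain Gs where Gs: "R Gs" using ex by auto
  from cylinder_limit_exists[where P = "P Gs" and E = "edges G" and L = L, OF lim[OF Gs]]
  obtain N where N: "prob_space N" "sets N = sets (edge_space (edges G))"
    "\<And>F. finite F \<Longrightarrow> F \<subseteq> edges G \<Longrightarrow> measure N (cyl (edges G) F) = L F" by auto
  have "?R N"
    using N lim by (auto simp: subgraph_space_eq intro!: local_weak_limitI)
  moreover have "N' = N" if "?R N'" for N'
  proof (rule edge_measure_eqI[of _ _ "edges G"])
    have N': "local_weak_limit G (P Gs) N'" "sets N' = sets (edge_space (edges G))"
      using that Gs by (auto simp: subgraph_space_eq)
    fix F assume F: "finite F" "F \<subseteq> edges G"
    show "measure N' (cyl (edges G) F) = measure N (cyl (edges G) F)"
      using LIMSEQ_unique[OF local_weak_limitD[OF N' F] lim[OF Gs F]] N(3)[OF F] by simp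
  qed (use that N in \<open>auto simp: subgraph_space_eq\<close>)
  ultimately have "M = N" unfolding M_def by (rule the_equality)
  then show "prob_space M" "sets M = sets (edge_space (edges G))"
    "finite F \<Longrightarrow> F \<subseteq> edges G \<Longrightarrow> measure M (cyl (edges G) F) = L F"
    using N by auto
qed

theorem FSF_law:
  assumes G: "oriented G s t" "locally_finite G" "connected_graph G"
  shows "prob_space (FSF G)" "sets (FSF G) = sets (edge_space (edges G))"
    "finite F \<Longrightarrow> F \<subseteq> edges G \<Longrightarrow> measure (FSF G) (cyl (edges G) F) = free_prob (flows s t) (edges G) F"
proof -
  have ex: "\<exists>Gs. exhaustion G Gs" using induced_exhaustion_exists[OF oriented_wf[OF G(1)] G(2,3)] by blast
  note * = the_limit_law[where R = "exhaustion G" and P = "\<lambda>Gs n. UST (Gs n)" and G = G, OF ex UST_free_limit[OF G(1)]]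
  show "prob_space (FSF G)" "sets (FSF G) = sets (edge_space (edges G))"
    "finite F \<Longrightarrow> F \<subseteq> edges G \<Longrightarrow> measure (FSF G) (cyl (edges G) F) = free_prob (flows s t) (edges G) F"
    unfolding FSF_def using * by auto
qed

section \<open>The wired limit\<close>

definition collapse :: "'v set \<Rightarrow> 'v \<Rightarrow> 'v option" where
  "collapse W v = (if v \<in> W then Some v else None)"

lemma wire_eq_collapse: "wire H = collapse (verts H)"
  by (auto simp: wire_def collapse_def)

abbreviation wired_flows :: "('e \<Rightarrow> 'v) \<Rightarrow> ('e \<Rightarrow> 'v) \<Rightarrow> 'v set \<Rightarrow> ('e \<Rightarrow> real) set" where
  "wired_flows s t W \<equiv> flows (collapse W \<circ> s) (collapse W \<circ> t)"

abbreviation incident :: "('v, 'e) mgraph \<Rightarrow> 'v set \<Rightarrow> 'e set" where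
  "incident G W \<equiv> {e \<in> edges G. ends G e \<inter> W \<noteq> {}}"

text \<open>A dependent singleton, that is a loop, lies in no basis. This allows graphs wired at
  different vertex sets to be put on a common edge set.\<close>

lemma bases_drop_loops:
  assumes "X \<subseteq> X'" "\<And>e. e \<in> X' - X \<Longrightarrow> \<not> indep Z {e}"
  shows "bases Z X' = bases Z X"
proof -
  have no: "B \<subseteq> X" if "B \<subseteq> X'" "indep Z B" for B
    using that assms(2) indep_mono[of Z B "{_}"] by blast
  have dep: "\<not> indep Z (insert e B)" if "e \<in> X' - X" for e B
    using assms(2)[OF that] indep_mono[of Z "insert e B" "{e}"] by blast
  show ?thesis
    using no dep assms(1) unfolding bases_def by blast
qed

text \<open>Edges that meet \<open>W'\<close> but not \<open>W\<close> are loops at the wired vertex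
  of the smaller set, so both graphs may be taken on the edges incident to \<open>W'\<close>.
  Passing from \<open>W'\<close> back to \<open>W\<close> then only identifies vertices, which
  enlarges the circulations and lowers the probability.\<close>

lemma wired_bp_mono:
  assumes G: "oriented G s t" "locally_finite G" and W: "W \<subseteq> W'" "finite W'" "W' \<subseteq> verts G"
  shows "inclusion_prob (wired_flows s t W) (incident G W) F \<le> inclusion_prob (wired_flows s t W') (incident G W') F"
proof (cases "F \<subseteq> incident G W")
  case True
  have fin: "finite (incident G W')" by (rule finite_incident[OF G(2) W(2,3)])
  have sub: "incident G W \<subseteq> incident G W'" using W by auto
  have loops: "\<not> indep (wired_flows s t W) {e}" if "e \<in> incident G W' - incident G W" for e
  proof -
    have "ends G e = {s e, t e}" using orientedD(1)[OF G(1)] that by auto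
    then have "s e \<notin> W" "t e \<notin> W" using that by auto
    then have "(\<lambda>f. of_bool (f = e)) \<in> wired_flows s t W"
      by (intro flowsI[of "{e}"]) (auto simp: supp_def collapse_def)
    moreover have "supp (\<lambda>f. of_bool (f = e)) = {e}" by (auto simp: supp_def)
    ultimately show ?thesis unfolding indep_def by (metis insert_not_empty order_refl)
  qed
  have "inclusion_prob (wired_flows s t W) (incident G W) F = inclusion_prob (wired_flows s t W) (incident G W') F"
    unfolding inclusion_prob_def basis_count_def by (simp only: bases_drop_loops[OF sub loops])
  also have "\<dots> \<le> inclusion_prob (wired_flows s t W') (incident G W') F"
  proof (rule inclusion_prob_antimono[OF unimodular_flows unimodular_flows fin order_refl])
    fix z assume "z \<in> wired_flows s t W'"
    then have "z \<in> flows ((\<lambda>x. Option.bind x (collapse W)) \<circ> (collapse W' \<circ> s)) ((\<lambda>x. Option.bind x (collapse W)) \<circ> (collapse W' \<circ> t))"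
      using flows_comp by blast
    \<comment> \<open>Since \<open>W \<subseteq> W'\<close>, the coarser identification factors
      through the finer one; \<open>Option.bind\<close> leaves the wired vertex \<open>None\<close>
      fixed.\<close>
    moreover have "(\<lambda>x. Option.bind x (collapse W)) \<circ> (collapse W' \<circ> g) = collapse W \<circ> g" for g :: "'b \<Rightarrow> 'a"
      using W(1) by (auto simp: fun_eq_iff collapse_def)
    ultimately show "z \<in> wired_flows s t W" by simp
  qed (use True sub in auto)
  finally show ?thesis .
next
  case False
  then show ?thesis using inclusion_prob_eq_0[OF False] inclusion_prob_nonneg by simp
qed

text \<open>A supremum here, because wired inclusion probabilities rise as the wiring moves
  outwards.\<close>

definition wired_prob :: "('v, 'e) mgraph \<Rightarrow> ('e \<Rightarrow> 'v) \<Rightarrow> ('e \<Rightarrow> 'v) \<Rightarrow> 'e set \<Rightarrow> real" where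
  "wired_prob G s t F = Sup {inclusion_prob (wired_flows s t W) (incident G W) F |W. finite W \<and> W \<subseteq> verts G}"

lemma wired_prob_limit:
  assumes G: "oriented G s t" "locally_finite G"
    and W: "incseq W" "\<And>n. finite (W n)" "(\<Union>n. W n) = verts G"
  shows "(\<lambda>n. inclusion_prob (wired_flows s t (W n)) (incident G (W n)) F) \<longlonglongrightarrow> wired_prob G s t F"
proof -
  let ?b = "\<lambda>W. inclusion_prob (wired_flows s t W) (incident G W) F"
  let ?S = "{?b W |W. finite W \<and> W \<subseteq> verts G}"
  have Wv: "W n \<subseteq> verts G" for n using W(3) by auto
  have bdd: "bdd_above ?S"
    by (rule bdd_aboveI[of _ 1]) (auto intro!: inclusion_prob_le_1 finite_incident[OF G(2)])
  have ne: "?S \<noteq> {}" by auto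
  show ?thesis
  proof (rule order_tendstoI)
    fix a assume "wired_prob G s t F < a"
    moreover have "?b (W n) \<le> wired_prob G s t F" for n
      unfolding wired_prob_def by (rule cSup_upper[OF _ bdd]) (use W(2) Wv in blast)
    ultimately show "\<forall>\<^sub>F n in sequentially. ?b (W n) < a" by (meson always_eventually le_less_trans)
  next
    fix a assume "a < wired_prob G s t F"
    then obtain W0 where W0: "finite W0" "W0 \<subseteq> verts G" "a < ?b W0"
      unfolding wired_prob_def less_cSup_iff[OF ne bdd] by blast
    obtain N where N: "\<forall>n\<ge>N. W0 \<subseteq> W n" using finite_subset_incseq[of W0 W] W0 W by auto
    have "a < ?b (W n)" if "n \<ge> N" for n
      using wired_bp_mono[OF G N[rule_format, OF that] W(2) Wv, of F] W0(3) by simp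
    then show "\<forall>\<^sub>F n in sequentially. a < ?b (W n)" using eventually_sequentially by auto
  qed
qed

lemma wired_graph_oriented:
  assumes "oriented G s t"
  shows "oriented (wired_graph G H) (collapse (verts H) \<circ> s) (collapse (verts H) \<circ> t)"
  using assms by (auto simp: oriented_def wired_graph_def wire_eq_collapse)

text \<open>Walks of \<open>G\<close> project to walks of the wired graph: an edge that was dropped
  has both ends at \<open>None\<close>, so its step is trivial.\<close>

lemma wired_graph_connected:
  assumes "connected_graph G"
  shows "connected_graph (wired_graph G H)"
proof -
  let ?K = "wired_graph G H"
  have j: "joined ?K (wire H u) (wire H v)" if "joined G u v" for u v
  proof (rule joined_invariant[OF that, of "\<lambda>v. joined ?K (wire H u) (wire H v)"])
    show "joined ?K (wire H u) (wire H u)"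
      using joined_verts[OF that] by (intro joined_refl) (simp add: wired_graph_def)
    fix e a b assume e: "e \<in> edges G" "ends G e = {a, b}" "a \<in> verts G" "b \<in> verts G"
      and ja: "joined ?K (wire H u) (wire H a)"
    show "joined ?K (wire H u) (wire H b)"
    proof (cases "ends G e \<inter> verts H = {}")
      case True
      then have "wire H a = wire H b" using e by (auto simp: wire_def)
      then show ?thesis using ja by simp
    next
      case False
      then have "joined ?K (wire H a) (wire H b)"
        using e by (intro joined_edge[of e]) (auto simp: wired_graph_def)
      then show ?thesis using ja joined_trans by metis
    qed
  qed
  then show ?thesis using assms by (auto simp: connected_graph_def wired_graph_def)
qed

lemma UST_wired:
  assumes "oriented G s t" "connected_graph G"
  shows "UST (wired_graph G H) = pmf_of_set (bases (wired_flows s t (verts H)) (incident G (verts H)))"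
  using UST_eq[OF wired_graph_oriented[OF assms(1)] wired_graph_connected[OF assms(2)], of H]
  by (simp add: wired_graph_def)

lemma UST_wired_limit:
  assumes G: "oriented G s t" "locally_finite G" "connected_graph G" and Gs: "exhaustion G Gs"
  shows "(\<lambda>n. measure_pmf.prob (UST (wired_graph G (Gs n))) {T. F \<subseteq> T}) \<longlonglongrightarrow> wired_prob G s t F"
proof -
  have fin: "finite (verts (Gs n))" for n using exhaustionD(2)[OF Gs] by (simp add: finite_graph_def)
  have "verts (Gs n) \<subseteq> verts G" for n using exhaustionD(1)[OF Gs] by (simp add: subgraph_def)
  then have "measure_pmf.prob (UST (wired_graph G (Gs n))) {T. F \<subseteq> T} =
      inclusion_prob (wired_flows s t (verts (Gs n))) (incident G (verts (Gs n))) F" for n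
    unfolding UST_wired[OF G(1,3)] by (intro prob_uniform_basis finite_incident[OF G(2) fin])
  then show ?thesis using wired_prob_limit[OF G(1,2) exhaustionD(4)[OF Gs] fin exhaustionD(6)[OF Gs]] by simp
qed

theorem WSF_law:
  assumes G: "oriented G s t" "locally_finite G" "connected_graph G"
  shows "prob_space (WSF G)" "sets (WSF G) = sets (edge_space (edges G))"
    "finite F \<Longrightarrow> F \<subseteq> edges G \<Longrightarrow> measure (WSF G) (cyl (edges G) F) = wired_prob G s t F"
proof -
  let ?R = "\<lambda>Gs. exhaustion G Gs \<and> (\<forall>n. induced_subgraph (Gs n) G)"
  have ex: "\<exists>Gs. ?R Gs" using induced_exhaustion_exists[OF oriented_wf[OF G(1)] G(2,3)] by blast
  note * = the_limit_law[where R = ?R and P = "\<lambda>Gs n. UST (wired_graph G (Gs n))" and G = G and L = "wired_prob G s t", OF ex]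
  have "(\<lambda>n. measure_pmf.prob (UST (wired_graph G (Gs n))) {T. F \<subseteq> T}) \<longlonglongrightarrow> wired_prob G s t F"
    if "?R Gs" for Gs F using UST_wired_limit[OF G] that by blast
  note ** = *[OF this, unfolded conj_imp_eq_imp_imp]
  show "prob_space (WSF G)" "sets (WSF G) = sets (edge_space (edges G))"
    "finite F \<Longrightarrow> F \<subseteq> edges G \<Longrightarrow> measure (WSF G) (cyl (edges G) F) = wired_prob G s t F"
    unfolding WSF_def using ** by (auto simp: imp_conjL)
qed

section \<open>Forests on the components of a subgraph\<close>

lemma component_of_simps [simp]:
  "verts (component_of H v) = {u. joined H v u}"
  "edges (component_of H v) = {e \<in> edges H. ends H e \<subseteq> {u. joined H v u}}"
  "ends (component_of H v) = ends H"
  by (simp_all add: component_of_def)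

lemma component_of_cong:
  assumes "joined H u v"
  shows "component_of H u = component_of H v"
proof -
  have "{w. joined H u w} = {w. joined H v w}"
    using joined_trans[OF assms] joined_trans[OF joined_sym[OF assms]] by auto
  then show ?thesis by (simp add: component_of_def)
qed

lemma component_joined:
  assumes "joined H v u"
  shows "joined (component_of H v) v u"
proof (rule joined_invariant[OF assms, of "joined (component_of H v) v"])
  show "joined (component_of H v) v v"
    using joined_verts[OF assms] by (intro joined_refl) (simp add: joined_refl)
  fix e a b assume e: "e \<in> edges H" "ends H e = {a, b}" "a \<in> verts H" "b \<in> verts H"
    and j: "joined (component_of H v) v a"
  have a: "joined H v a" using joined_verts[OF j] by simp
  then have b: "joined H v b" using joined_trans[OF _ joined_edge[OF e]] by blast
  have "joined (component_of H v) a b" by (rule joined_edge[of e]) (use e a b in auto)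
  then show "joined (component_of H v) v b" using j joined_trans by metis
qed

lemma component_connected:
  assumes "v \<in> verts H"
  shows "connected_graph (component_of H v)"
  unfolding connected_graph_def
proof (intro conjI ballI)
  show "verts (component_of H v) \<noteq> {}" using joined_refl[OF assms] by auto
  fix a b assume "a \<in> verts (component_of H v)" "b \<in> verts (component_of H v)"
  then have "joined (component_of H v) v a" "joined (component_of H v) v b"
    using component_joined[of H v] by auto
  then show "joined (component_of H v) a b" using joined_trans[OF joined_sym] by metis
qed

lemma edge_ends_joined:
  assumes "oriented H s t" "e \<in> edges H"
  shows "joined H (s e) (t e)"
  by (rule joined_edge) (use orientedD[OF assms] assms(2) in auto)

lemma component_oriented:
  assumes "oriented H s t"
  shows "oriented (component_of H v) s t"
  unfolding oriented_def using orientedD[OF assms] by auto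

lemma component_locally_finite:
  assumes "locally_finite H"
  shows "locally_finite (component_of H v)"
  unfolding locally_finite_def
proof
  fix u assume u: "u \<in> verts (component_of H v)"
  then have "u \<in> verts H" using joined_verts[of H v u] by simp
  then have "finite {e \<in> edges H. u \<in> ends H e}" using assms by (simp add: locally_finite_def)
  then show "finite {e \<in> edges (component_of H v). u \<in> ends (component_of H v) e}"
    by (rule rev_finite_subset) auto
qed

lemma component_edge_iff:
  assumes "oriented H s t" "C \<in> graph_components H" "e \<in> edges H"
  shows "e \<in> edges C \<longleftrightarrow> s e \<in> verts C" "e \<in> edges C \<longleftrightarrow> t e \<in> verts C"
proof -
  obtain v where C: "C = component_of H v" using assms(2) by (auto simp: graph_components_def)
  note e = orientedD[OF assms(1,3)] edge_ends_joined[OF assms(1,3)]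
  have "joined H v (s e) \<longleftrightarrow> joined H v (t e)" using e(4) joined_trans joined_sym by metis
  then show "e \<in> edges C \<longleftrightarrow> s e \<in> verts C" "e \<in> edges C \<longleftrightarrow> t e \<in> verts C"
    using e assms(3) by (auto simp: C)
qed

lemma component_verts_unique:
  assumes "C \<in> graph_components H" "D \<in> graph_components H" "u \<in> verts C" "u \<in> verts D"
  shows "C = D"
proof -
  obtain v w where "C = component_of H v" "D = component_of H w"
    using assms(1,2) by (auto simp: graph_components_def)
  then show ?thesis using component_of_cong[of H v u] component_of_cong[of H w u] assms(3,4) by simp
qed

lemma component_edges_disjoint:
  assumes "oriented H s t" "C \<in> graph_components H" "D \<in> graph_components H" "e \<in> edges C" "e \<in> edges D"
  shows "C = D"
proof -
  have "e \<in> edges H" using assms(2,4) by (auto simp: graph_components_def)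
  then have "s e \<in> verts C" "s e \<in> verts D"
    using component_edge_iff(1)[OF assms(1)] assms(2-5) by auto
  then show ?thesis by (rule component_verts_unique[OF assms(2,3)])
qed

lemma component_edges_cover:
  assumes "oriented H s t" "e \<in> edges H"
  shows "\<exists>C\<in>graph_components H. e \<in> edges C"
proof (rule bexI)
  note e = orientedD[OF assms] edge_ends_joined[OF assms]
  show "component_of H (s e) \<in> graph_components H" using e by (auto simp: graph_components_def)
  show "e \<in> edges (component_of H (s e))" using e assms(2) joined_refl[OF e(2)] by simp
qed

lemma component_edges_subset: "C \<in> graph_components H \<Longrightarrow> edges C \<subseteq> edges H"
  by (auto simp: graph_components_def)

lemma component_FSF_law:
  assumes "oriented H s t" "locally_finite H" "C \<in> graph_components H"
  shows "prob_space (FSF C)" "sets (FSF C) = sets (edge_space (edges C))"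
    "finite F \<Longrightarrow> F \<subseteq> edges C \<Longrightarrow> measure (FSF C) (cyl (edges C) F) = free_prob (flows s t) (edges C) F"
proof -
  obtain v where v: "v \<in> verts H" "C = component_of H v" using assms(3) by (auto simp: graph_components_def)
  note * = FSF_law[OF component_oriented[OF assms(1)] component_locally_finite[OF assms(2)] component_connected[OF v(1)]]
  show "prob_space (FSF C)" "sets (FSF C) = sets (edge_space (edges C))"
    "finite F \<Longrightarrow> F \<subseteq> edges C \<Longrightarrow> measure (FSF C) (cyl (edges C) F) = free_prob (flows s t) (edges C) F"
    unfolding v(2) by (rule *; assumption)+
qed

text \<open>Components are split off one at a time: cutting a circulation down to the edges of one
  component leaves a circulation.\<close>

lemma inclusion_prob_components:
  assumes H: "oriented H s t" and X: "finite X" "X \<subseteq> edges H" and F: "F \<subseteq> X"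
    and J: "finite J" "J \<subseteq> graph_components H"
  shows "inclusion_prob (flows s t) X F =
    (\<Prod>C\<in>J. inclusion_prob (flows s t) (X \<inter> edges C) (F \<inter> edges C)) *
    inclusion_prob (flows s t) (X - (\<Union>C\<in>J. edges C)) (F - (\<Union>C\<in>J. edges C))"
  using J
proof (induction J rule: finite_induct)
  case (insert C J)
  interpret unimodular "flows s t" by (rule unimodular_flows)
  let ?R = "\<Union>D\<in>J. edges D" and ?Z = "flows s t"
  have C: "C \<in> graph_components H" using insert by auto
  have disj: "edges C \<inter> ?R = {}"
    using component_edges_disjoint[OF H C] insert by blast
  have "inclusion_prob ?Z (X - ?R) (F - ?R) = inclusion_prob ?Z ((X \<inter> edges C) \<union> (X - (?R \<union> edges C))) (F - ?R)"
    by (rule arg_cong[where f = "\<lambda>A. inclusion_prob ?Z A (F - ?R)"]) (use disj in blast)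
  also have "\<dots> = inclusion_prob ?Z (X \<inter> edges C) ((F - ?R) \<inter> (X \<inter> edges C)) *
      inclusion_prob ?Z (X - (?R \<union> edges C)) ((F - ?R) \<inter> (X - (?R \<union> edges C)))"
  proof (rule inclusion_prob_union)
    fix z assume z: "z \<in> ?Z" "supp z \<subseteq> X \<inter> edges C \<union> (X - (?R \<union> edges C))"
    then have sz: "supp z \<subseteq> X" by auto
    show "(\<lambda>e. if e \<in> X \<inter> edges C then z e else 0) \<in> ?Z"
    proof (rule flowsI[OF X(1)])
      fix g :: "'a \<Rightarrow> real"
      \<comment> \<open>An edge of \<open>H\<close> has both ends in \<open>C\<close> or neither, so
        the truncated potential has the differences of \<open>g\<close> on \<open>C\<close> and 0
        elsewhere.\<close>
      let ?g = "\<lambda>v. if v \<in> verts C then g v else 0"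
      have "(\<Sum>e\<in>X. (if e \<in> X \<inter> edges C then z e else 0) * (g (s e) - g (t e))) =
          (\<Sum>e\<in>X. z e * (?g (s e) - ?g (t e)))"
      proof (rule sum.cong[OF refl])
        fix e assume e: "e \<in> X"
        then have "e \<in> edges H" using X by auto
        then show "(if e \<in> X \<inter> edges C then z e else 0) * (g (s e) - g (t e)) = z e * (?g (s e) - ?g (t e))"
          using component_edge_iff[OF H C, of e] e by auto
      qed
      then show "(\<Sum>e\<in>X. (if e \<in> X \<inter> edges C then z e else 0) * (g (s e) - g (t e))) = 0"
        using flowsD[OF z(1) X(1) sz, of ?g] by simp
    qed (auto simp: supp_def)
  qed (use X F disj in auto)
  also have "(F - ?R) \<inter> (X \<inter> edges C) = F \<inter> edges C" using F disj by auto
  also have "(F - ?R) \<inter> (X - (?R \<union> edges C)) = F - (\<Union>D\<in>insert C J. edges D)" using F by auto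
  also have "X - (?R \<union> edges C) = X - (\<Union>D\<in>insert C J. edges D)" by auto
  finally show ?case using insert by (simp add: mult.assoc mult.left_commute)
qed simp

section \<open>Independent free forests on the components of a fixed subgraph\<close>

locale forest_graph =
  fixes G :: "('v, 'e) mgraph" and s t :: "'e \<Rightarrow> 'v"
  assumes oriented: "oriented G s t"
    and locally_finite: "locally_finite G"
    and connected: "connected_graph G"
begin

abbreviation "Z \<equiv> flows s t"
abbreviation "E \<equiv> edges G"
abbreviation "sub \<equiv> spanning_subgraph G"

sublocale unimodular Z by (rule unimodular_flows)

lemma edge_exhaustion:
  "\<exists>Y :: nat \<Rightarrow> 'e set. incseq Y \<and> (\<forall>n. finite (Y n)) \<and> (\<Union>n. Y n) = E"
proof -
  obtain Gs where Gs: "exhaustion G Gs"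
    using induced_exhaustion_exists[OF oriented_wf[OF oriented] locally_finite connected] by blast
  have "finite (edges (Gs n))" for n using exhaustionD(2)[OF Gs] by (simp add: finite_graph_def)
  then show ?thesis using exhaustionD(5,7)[OF Gs] by (intro exI[of _ "\<lambda>n. edges (Gs n)"]) auto
qed

lemma countable_edges: "countable E"
proof -
  obtain Y where "\<And>n::nat. finite (Y n)" "(\<Union>n. Y n) = E" using edge_exhaustion by metis
  then show ?thesis using countable_UN[of UNIV Y] by (auto intro: countable_finite)
qed

lemma countable_verts: "countable (verts G)"
proof -
  obtain Gs where Gs: "exhaustion G Gs"
    using induced_exhaustion_exists[OF oriented_wf[OF oriented] locally_finite connected] by blast
  have "countable (\<Union>n. verts (Gs n))"
    using exhaustionD(2)[OF Gs] by (intro countable_UN) (auto simp: finite_graph_def intro: countable_finite)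
  then show ?thesis using exhaustionD(6)[OF Gs] by simp
qed

lemma sub_oriented: "T \<subseteq> E \<Longrightarrow> oriented (sub T) s t"
  by (rule oriented_spanning[OF oriented])

lemma sub_locally_finite: 
  assumes "T \<subseteq> E" shows "locally_finite (sub T)"
  unfolding locally_finite_def
proof
  fix v assume "v \<in> verts (sub T)"
  then have "finite {e \<in> E. v \<in> ends G e}" using locally_finite by (simp add: locally_finite_def)
  then show "finite {e \<in> edges (sub T). v \<in> ends (sub T) e}"
    by (rule rev_finite_subset) (use assms in auto)
qed

text \<open>The finite factorisation passes to the limit along \<open>T \<inter> Y n\<close>. Once
  \<open>F\<close> is covered by the components in \<open>J\<close>, the remaining factor is the
  probability of containing the empty set, namely 1.\<close>

lemma free_prob_components:
  assumes T: "T \<subseteq> E" and F: "finite F" "F \<subseteq> T"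
    and J: "finite J" "J \<subseteq> graph_components (sub T)" "F \<subseteq> (\<Union>C\<in>J. edges C)"
  shows "free_prob Z T F = (\<Prod>C\<in>J. free_prob Z (edges C) (F \<inter> edges C))"
proof -
  obtain Y where Y: "incseq Y" "\<And>n. finite (Y n)" "(\<Union>n. Y n) = E" using edge_exhaustion by blast
  let ?X = "\<lambda>n. T \<inter> Y n"
  have inc: "incseq (\<lambda>n. A \<inter> Y n)" for A using Y(1) by (auto simp: incseq_def)
  have un: "(\<Union>n. A \<inter> Y n) = A" if "A \<subseteq> E" for A using Y(3) that by blast
  have CT: "edges C \<subseteq> T" if "C \<in> J" for C using component_edges_subset[of C "sub T"] J(2) that by auto
  have lim: "(\<lambda>n. inclusion_prob Z (?X n) F) \<longlonglongrightarrow> free_prob Z T F"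
    using inc un[OF T] Y(2) F by (intro free_prob_limit) auto
  have "(\<lambda>n. \<Prod>C\<in>J. inclusion_prob Z (edges C \<inter> Y n) (F \<inter> edges C)) \<longlonglongrightarrow> (\<Prod>C\<in>J. free_prob Z (edges C) (F \<inter> edges C))"
  proof (rule tendsto_prod)
    fix C assume C: "C \<in> J"
    show "(\<lambda>n. inclusion_prob Z (edges C \<inter> Y n) (F \<inter> edges C)) \<longlonglongrightarrow> free_prob Z (edges C) (F \<inter> edges C)"
      using inc un[of "edges C"] CT[OF C] T Y(2) F by (intro free_prob_limit) auto
  qed
  moreover obtain N where N: "\<forall>n\<ge>N. F \<subseteq> ?X n"
    using finite_subset_incseq[OF F(1), of ?X] inc un[OF T] F(2) by metis
  have "\<forall>\<^sub>F n in sequentially. (\<Prod>C\<in>J. inclusion_prob Z (edges C \<inter> Y n) (F \<inter> edges C)) = inclusion_prob Z (?X n) F"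
  proof (rule eventually_sequentiallyI)
    fix n assume n: "n \<ge> N"
    have "inclusion_prob Z (?X n) F = (\<Prod>C\<in>J. inclusion_prob Z (?X n \<inter> edges C) (F \<inter> edges C)) *
      inclusion_prob Z (?X n - (\<Union>C\<in>J. edges C)) (F - (\<Union>C\<in>J. edges C))"
      using N[rule_format, OF n] Y(2) J(2) T
      by (intro inclusion_prob_components[OF sub_oriented[OF T]] J(1)) auto
    moreover have "F - (\<Union>C\<in>J. edges C) = {}" using J(3) by auto
    moreover have "inclusion_prob Z (?X n - (\<Union>C\<in>J. edges C)) {} = 1"
      using basis_count_empty_pos[of "?X n - (\<Union>C\<in>J. edges C)" Z] Y(2) by (simp add: inclusion_prob_def)
    moreover have "?X n \<inter> edges C = edges C \<inter> Y n" if "C \<in> J" for C using CT[OF that] by auto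
    ultimately show "(\<Prod>C\<in>J. inclusion_prob Z (edges C \<inter> Y n) (F \<inter> edges C)) = inclusion_prob Z (?X n) F" by simp
  qed
  ultimately have "(\<lambda>n. inclusion_prob Z (?X n) F) \<longlonglongrightarrow> (\<Prod>C\<in>J. free_prob Z (edges C) (F \<inter> edges C))"
    by (rule Lim_transform_eventually)
  then show ?thesis by (rule LIMSEQ_unique[OF lim])
qed

abbreviation "comps T \<equiv> graph_components (sub T)"
abbreviation "product_law T \<equiv> PiM (comps T) FSF"
abbreviation "join_parts T f \<equiv> (\<Union>C\<in>comps T. f C)"

lemma product_law_facts:
  assumes T: "T \<subseteq> E"
  shows "prob_space (product_law T)"
    and "f \<in> space (product_law T) \<Longrightarrow> C \<in> comps T \<Longrightarrow> f C \<subseteq> edges C"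
    and "\<And>J A. finite J \<Longrightarrow> J \<subseteq> comps T \<Longrightarrow> (\<And>C. C \<in> J \<Longrightarrow> A C \<in> sets (FSF C)) \<Longrightarrow>
      measure (product_law T) {f \<in> space (product_law T). \<forall>C\<in>J. f C \<in> A C} = (\<Prod>C\<in>J. measure (FSF C) (A C))"
    and "C \<in> comps T \<Longrightarrow> distr (product_law T) (FSF C) (\<lambda>f. f C) = FSF C"
proof -
  note law = component_FSF_law[OF sub_oriented[OF T] sub_locally_finite[OF T]]
  \<comment> \<open>A product probability space needs a probability measure at every index, while
    \<open>FSF\<close> of an arbitrary graph is an unspecified description. A point mass fills the
    indices that are not components.\<close>
  define M where "M C = (if C \<in> comps T then FSF C else return (count_space UNIV) {})" for C
  have eq: "product_law T = PiM (comps T) M" by (rule PiM_cong) (auto simp: M_def)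
  interpret product_prob_space M "comps T"
    by (rule product_prob_spaceI) (auto simp: M_def law intro!: prob_space_return)
  show "prob_space (product_law T)" unfolding eq by (rule prob_space_axioms)
  show "f C \<subseteq> edges C" if "f \<in> space (product_law T)" "C \<in> comps T"
  proof -
    have "f C \<in> space (FSF C)" using that by (auto simp: space_PiM PiE_iff)
    then show ?thesis using sets_eq_imp_space_eq[OF law(2)[OF that(2)]] by simp
  qed
  show "distr (product_law T) (FSF C) (\<lambda>f. f C) = FSF C" if "C \<in> comps T"
    using PiM_component[OF that] that unfolding eq by (simp add: M_def)
  fix J A assume J: "finite J" "J \<subseteq> comps T" "\<And>C. C \<in> J \<Longrightarrow> A C \<in> sets (FSF C)"
  have JM: "C \<in> J \<Longrightarrow> M C = FSF C" for C using J(2) by (auto simp: M_def)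
  have "measure (PiM (comps T) M) {f \<in> space (PiM (comps T) M). \<forall>C\<in>J. f C \<in> A C} =
      (\<Prod>C\<in>J. measure (M C) (A C))"
    using emeasure_PiM_Collect[of J A] J JM unfolding emeasure_eq_measure M.emeasure_eq_measure
    by (simp add: prod_ennreal prod_nonneg)
  then show "measure (product_law T) {f \<in> space (product_law T). \<forall>C\<in>J. f C \<in> A C} = (\<Prod>C\<in>J. measure (FSF C) (A C))"
    unfolding eq using JM by simp
qed

text \<open>An edge of \<open>T\<close> can only be contributed by the one component containing it,
  so its presence is an event of a single coordinate.\<close>

lemma join_parts_measurable:
  assumes T: "T \<subseteq> E"
  shows "join_parts T \<in> measurable (product_law T) (edge_space E)"
proof (rule measurable_edge_space)
  fix f assume "f \<in> space (product_law T)"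
  then show "join_parts T f \<subseteq> E"
    using product_law_facts(2)[OF T] component_edges_subset[of _ "sub T"] T by fastforce
next
  fix e assume e: "e \<in> E"
  show "{f \<in> space (product_law T). e \<in> join_parts T f} \<in> sets (product_law T)"
  proof (cases "e \<in> T")
    case False
    then have "{f \<in> space (product_law T). e \<in> join_parts T f} = {}"
      using product_law_facts(2)[OF T] component_edges_subset[of _ "sub T"] by fastforce
    then show ?thesis by (simp only: sets.empty_sets)
  next
    case True
    then obtain C where C: "C \<in> comps T" "e \<in> edges C"
      using component_edges_cover[OF sub_oriented[OF T], of e] by auto
    have "{f \<in> space (product_law T). e \<in> join_parts T f} = {f \<in> space (product_law T). e \<in> f C}"
      using product_law_facts(2)[OF T] component_edges_disjoint[OF sub_oriented[OF T]] C by blast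
    also have "\<dots> = (\<lambda>f. f C) -` {S \<in> Pow (edges C). e \<in> S} \<inter> space (product_law T)"
      using product_law_facts(2)[OF T _ C(1)] by auto
    also have "\<dots> \<in> sets (product_law T)"
      using edge_in_sets[OF C(2)] component_FSF_law(2)[OF sub_oriented[OF T] sub_locally_finite[OF T] C(1)]
      by (intro measurable_sets[OF measurable_component_singleton[OF C(1)]]) simp
    finally show ?thesis .
  qed
qed

abbreviation "components_law T \<equiv> FSF_on_components G (sub T)"

lemma components_law_eq: "components_law T = distr (product_law T) (edge_space E) (join_parts T)"
  by (simp add: FSF_on_components_def subgraph_space_eq)

lemma components_law_sets [simp]: "sets (components_law T) = sets (edge_space E)"
  by (simp add: components_law_eq)

lemma components_law_prob_space:
  assumes T: "T \<subseteq> E"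
  shows "prob_space (components_law T)"
  unfolding components_law_eq
  by (rule prob_space.prob_space_distr[OF product_law_facts(1)[OF T] join_parts_measurable[OF T]])

text \<open>\<open>F\<close> meets finitely many components; independence gives a product over
  these, which recombines to the free probability in \<open>T\<close>. The right-hand side no longer
  mentions components, which makes both limits and measurability in \<open>T\<close>
  accessible.\<close>

lemma components_law_cyl:
  assumes T: "T \<subseteq> E" and F: "finite F" "F \<subseteq> E"
  shows "measure (components_law T) (cyl E F) = (if F \<subseteq> T then free_prob Z T F else 0)"
proof -
  note disj = component_edges_disjoint[OF sub_oriented[OF T]]
  note spc = product_law_facts(2)[OF T]
  have 1: "measure (components_law T) (cyl E F) = measure (product_law T) {f \<in> space (product_law T). F \<subseteq> join_parts T f}"
  proof -
    have "join_parts T -` cyl E F \<inter> space (product_law T) = {f \<in> space (product_law T). F \<subseteq> join_parts T f}"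
      using measurable_space[OF join_parts_measurable[OF T]] by (auto simp: cyl_def)
    then show ?thesis unfolding components_law_eq
      by (simp add: measure_distr[OF join_parts_measurable[OF T] cyl_in_sets[OF F]])
  qed
  show ?thesis
  proof (cases "F \<subseteq> T")
    case False
    then have "{f \<in> space (product_law T). F \<subseteq> join_parts T f} = {}"
      using spc component_edges_subset[of _ "sub T"] by fastforce
    then show ?thesis unfolding 1 using False by (simp only: measure_empty if_False)
  next
    case True
    have "\<forall>e\<in>F. \<exists>C. C \<in> comps T \<and> e \<in> edges C"
      using component_edges_cover[OF sub_oriented[OF T]] True by auto
    then obtain c where c: "\<forall>e\<in>F. c e \<in> comps T \<and> e \<in> edges (c e)" by (rule bchoice[THEN exE])
    let ?J = "c ` F"
    have J: "finite ?J" "?J \<subseteq> comps T" "F \<subseteq> (\<Union>C\<in>?J. edges C)" using F c by auto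
    have "{f \<in> space (product_law T). F \<subseteq> join_parts T f} =
      {f \<in> space (product_law T). \<forall>C\<in>?J. f C \<in> cyl (edges C) (F \<inter> edges C)}"
    proof (intro Collect_cong conj_cong refl)
      fix f assume f: "f \<in> space (product_law T)"
      show "F \<subseteq> join_parts T f \<longleftrightarrow> (\<forall>C\<in>?J. f C \<in> cyl (edges C) (F \<inter> edges C))"
      proof
        assume Ff: "F \<subseteq> join_parts T f"
        show "\<forall>C\<in>?J. f C \<in> cyl (edges C) (F \<inter> edges C)"
        proof
          fix C assume C: "C \<in> ?J"
          then have "C \<in> comps T" using J(2) by auto
          moreover have "F \<inter> edges C \<subseteq> f C"
          proof
            fix e assume e: "e \<in> F \<inter> edges C"
            then obtain D where D: "D \<in> comps T" "e \<in> f D" using Ff by auto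
            then have "D = C" using disj[OF D(1) \<open>C \<in> comps T\<close>] spc[OF f D(1)] e by blast
            then show "e \<in> f C" using D by simp
          qed
          ultimately show "f C \<in> cyl (edges C) (F \<inter> edges C)" using spc[OF f] by (auto simp: cyl_def)
        qed
      next
        assume "\<forall>C\<in>?J. f C \<in> cyl (edges C) (F \<inter> edges C)"
        then show "F \<subseteq> join_parts T f" using c by (fastforce simp: cyl_def)
      qed
    qed
    note eq = this
    have "cyl (edges C) (F \<inter> edges C) \<in> sets (FSF C)" if "C \<in> ?J" for C
      unfolding component_FSF_law(2)[OF sub_oriented[OF T] sub_locally_finite[OF T] subsetD[OF J(2) that]]
      using F by (intro cyl_in_sets) auto
    then have "measure (components_law T) (cyl E F) = (\<Prod>C\<in>?J. measure (FSF C) (cyl (edges C) (F \<inter> edges C)))"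
      unfolding 1 eq by (rule product_law_facts(3)[OF T J(1,2)])
    also have "\<dots> = (\<Prod>C\<in>?J. free_prob Z (edges C) (F \<inter> edges C))"
      using J F by (intro prod.cong refl component_FSF_law(3)[OF sub_oriented[OF T] sub_locally_finite[OF T]]) auto
    also have "\<dots> = free_prob Z T F"
      by (rule free_prob_components[OF T F(1) True J, symmetric])
    finally show ?thesis using True by simp
  qed
qed

lemma components_law_limit:
  assumes T: "T \<subseteq> E" and F: "finite F" "F \<subseteq> E"
    and X: "incseq X" "\<And>n. finite (X n)" "(\<Union>n. X n) = T"
  shows "(\<lambda>n. inclusion_prob Z (X n) F) \<longlonglongrightarrow> measure (components_law T) (cyl E F)"
proof (cases "F \<subseteq> T")
  case True
  then show ?thesis using components_law_cyl[OF T F] free_prob_limit[OF X F(1) True] by simp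
next
  case False
  then have "inclusion_prob Z (X n) F = 0" for n using X(3) by (intro inclusion_prob_eq_0) auto
  then show ?thesis using components_law_cyl[OF T F] False by simp
qed

text \<open>For each cylinder the probability is a pointwise limit of functions of the finite traces
  \<open>T \<inter> Y n\<close>, hence measurable in \<open>T\<close>. This makes the laws a kernel
  that can be bound to a random \<open>T\<close>.\<close>

lemma components_law_measurable:
  "components_law \<in> measurable (edge_space E) (prob_algebra (edge_space E))"
proof (rule measurable_prob_algebra_generated[OF sets_edge_space_cyl Int_stable_cyl])
  obtain Y where Y: "incseq Y" "\<And>n. finite (Y n)" "(\<Union>n. Y n) = E" using edge_exhaustion by blast
  fix A assume "A \<in> {cyl E F |F. finite F \<and> F \<subseteq> E}"
  then obtain F where F: "A = cyl E F" "finite F" "F \<subseteq> E" by auto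
  have "(\<lambda>T. measure (components_law T) (cyl E F)) \<in> borel_measurable (edge_space E)"
  proof (rule borel_measurable_LIMSEQ_real)
    fix T assume "T \<in> space (edge_space E)"
    then have T: "T \<subseteq> E" by simp
    have "incseq (\<lambda>n. T \<inter> Y n)" using Y(1) by (auto simp: incseq_def)
    moreover have "(\<Union>n. T \<inter> Y n) = T" using Y(3) T by blast
    ultimately show "(\<lambda>n. inclusion_prob Z (T \<inter> Y n) F) \<longlonglongrightarrow> measure (components_law T) (cyl E F)"
      using Y(2) by (intro components_law_limit[OF T F(2,3)]) auto
  next
    show "(\<lambda>T. inclusion_prob Z (T \<inter> Y n) F) \<in> borel_measurable (edge_space E)" for n
      using Y by (intro trace_function_measurable[where h = "\<lambda>A. inclusion_prob Z A F" and E = E]) auto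
  qed
  then have "(\<lambda>T. ennreal (measure (components_law T) (cyl E F))) \<in> borel_measurable (edge_space E)"
    by measurable
  then show "(\<lambda>T. emeasure (components_law T) A) \<in> borel_measurable (edge_space E)"
    by (rule measurable_cong[THEN iffD1, rotated])
      (auto simp: F(1) finite_measure.emeasure_eq_measure prob_space.finite_measure[OF components_law_prob_space])
qed (auto simp: cyl_def components_law_prob_space)

end

section \<open>Resampling a forest inside its components\<close>

text \<open>\<open>Z'\<close> belongs to the finite, possibly wired, graph and \<open>Z\<close> to
  the infinite one. As they agree on \<open>Y\<close>, resampling inside \<open>Y\<close> may be
  written with \<open>Z\<close>, so the integrand does not change along the exhaustion.\<close>

lemma resampled_basis_expectation:
  assumes Z: "unimodular Z'" and X: "finite X" "Y \<subseteq> X" and F: "F \<subseteq> Y"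
    and cong: "\<And>z. supp z \<subseteq> Y \<Longrightarrow> z \<in> Z \<longleftrightarrow> z \<in> Z'"
  shows "measure_pmf.expectation (pmf_of_set (bases Z' X)) (\<lambda>B. inclusion_prob Z (Y \<inter> spanned Z (B \<inter> Y)) F) = inclusion_prob Z' X F"
proof -
  interpret unimodular Z' by fact
  have eq: "inclusion_prob Z (Y \<inter> spanned Z (B \<inter> Y)) F = inclusion_prob Z' (Y \<inter> spanned Z' (B \<inter> Y)) F" for B
    using spanned_cong[of Y Z Z' "B \<inter> Y", OF cong] inclusion_prob_cong[of Y Z Z', OF cong] by simp
  have "card (bases Z' X) = basis_count Z' X {}" by (simp add: basis_count_def)
  then show ?thesis
    unfolding eq using integral_pmf_of_set[OF bases_nonempty[OF X(1)] finite_bases[OF X(1)], of Z']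
      inclusion_prob_resample[OF X F] by (simp add: inclusion_prob_def)
qed

context forest_graph
begin

definition closure_edges :: "'e set \<Rightarrow> 'e set" where
  "closure_edges T = {e \<in> E. joined (sub T) (s e) (t e)}"

lemma closure_edges_eq: "edges (induced_component_graph G (sub T)) = closure_edges T"
proof -
  have "(\<exists>C\<in>comps T. ends G e \<subseteq> verts C) \<longleftrightarrow> joined (sub T) (s e) (t e)" if e: "e \<in> E" for e
  proof
    assume "\<exists>C\<in>comps T. ends G e \<subseteq> verts C"
    then obtain v where "joined (sub T) v (s e)" "joined (sub T) v (t e)"
      using orientedD[OF oriented e] by (auto simp: graph_components_def)
    then show "joined (sub T) (s e) (t e)" using joined_trans joined_sym by metis
  next
    assume "joined (sub T) (s e) (t e)"
    then have "ends G e \<subseteq> verts (component_of (sub T) (s e))"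
      using orientedD[OF oriented e] joined_refl[of "s e" "sub T"] by simp
    then show "\<exists>C\<in>comps T. ends G e \<subseteq> verts C"
      using orientedD(2)[OF oriented e] by (auto simp: graph_components_def)
  qed
  then show ?thesis by (auto simp: induced_component_graph_def closure_edges_def)
qed

lemma closure_edges_subset: "closure_edges T \<subseteq> E"
  by (auto simp: closure_edges_def)

lemma joined_closure_edges:
  assumes "joined (sub (closure_edges T)) u v"
  shows "joined (sub T) u v"
proof (rule joined_invariant[OF assms, of "joined (sub T) u"])
  show "joined (sub T) u u" using joined_verts[OF assms] by (intro joined_refl) simp
  fix e a b assume e: "e \<in> edges (sub (closure_edges T))" "ends (sub (closure_edges T)) e = {a, b}"
    and a: "joined (sub T) u a"
  then have "joined (sub T) (s e) (t e)" "{s e, t e} = {a, b}"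
    using orientedD(1)[OF oriented, of e] by (auto simp: closure_edges_def)
  then have "joined (sub T) a b" using joined_sym by (auto simp: doubleton_eq_iff)
  then show "joined (sub T) u b" using a joined_trans by metis
qed

lemma closure_trace:
  assumes "Y \<subseteq> E"
  shows "Y \<inter> spanned Z (T \<inter> Y) = {e \<in> Y. joined (sub (T \<inter> Y)) (s e) (t e)}"
  using spanned_iff_joined[OF oriented, of "T \<inter> Y"] assms by auto

text \<open>A connection in \<open>T\<close> uses a finite path. As soon as \<open>Y n\<close>
  contains the edge and this path, the trace on \<open>Y n\<close> spans the edge, so the
  connections visible in \<open>Y n\<close> increase to all of them.\<close>

lemma closure_exhaustion:
  assumes T: "T \<subseteq> E" and Y: "incseq Y" "(\<Union>n. Y n) = E"
  shows "incseq (\<lambda>n. Y n \<inter> spanned Z (T \<inter> Y n))"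
    and "(\<Union>n. Y n \<inter> spanned Z (T \<inter> Y n)) = closure_edges T"
proof -
  have YE: "Y n \<subseteq> E" for n using Y(2) by auto
  show "incseq (\<lambda>n. Y n \<inter> spanned Z (T \<inter> Y n))"
    unfolding incseq_def
  proof (intro allI impI)
    fix m n :: nat assume "m \<le> n"
    then have "Y m \<subseteq> Y n" using incseqD[OF Y(1)] by blast
    then show "Y m \<inter> spanned Z (T \<inter> Y m) \<subseteq> Y n \<inter> spanned Z (T \<inter> Y n)"
      using spanned_mono[of "T \<inter> Y m" "T \<inter> Y n" Z] by blast
  qed
  show "(\<Union>n. Y n \<inter> spanned Z (T \<inter> Y n)) = closure_edges T"
    unfolding closure_trace[OF YE]
  proof
    show "(\<Union>n. {e \<in> Y n. joined (sub (T \<inter> Y n)) (s e) (t e)}) \<subseteq> closure_edges T"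
    proof
      fix e assume "e \<in> (\<Union>n. {e \<in> Y n. joined (sub (T \<inter> Y n)) (s e) (t e)})"
      then obtain n where "e \<in> Y n" "joined (sub (T \<inter> Y n)) (s e) (t e)" by auto
      then show "e \<in> closure_edges T"
        using YE joined_spanning_mono[of G "T \<inter> Y n" "s e" "t e" T] by (auto simp: closure_edges_def)
    qed
    show "closure_edges T \<subseteq> (\<Union>n. {e \<in> Y n. joined (sub (T \<inter> Y n)) (s e) (t e)})"
    proof
      fix e assume "e \<in> closure_edges T"
      then have e: "e \<in> E" "joined (sub T) (s e) (t e)" by (auto simp: closure_edges_def)
      obtain F where F: "finite F" "F \<subseteq> T" "joined (sub F) (s e) (t e)"
        using joined_finite[OF e(2)] by blast
      have "finite (insert e F)" "insert e F \<subseteq> (\<Union>n. Y n)" using e F T Y(2) by auto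
      then obtain N where "\<forall>n\<ge>N. insert e F \<subseteq> Y n" using finite_subset_incseq Y(1) by metis
      then have "insert e F \<subseteq> Y N" by blast
      then have "e \<in> Y N" "joined (sub (T \<inter> Y N)) (s e) (t e)"
        using joined_spanning_mono[OF F(3), of "T \<inter> Y N"] F(2) by auto
      then show "e \<in> (\<Union>n. {e \<in> Y n. joined (sub (T \<inter> Y n)) (s e) (t e)})" by blast
    qed
  qed
qed

text \<open>There are only countably many finite edge sets, and connection means containing one that
  joins \<open>u\<close> to \<open>v\<close>.\<close>

lemma joined_in_sets: "{T \<in> Pow E. joined (sub T) u v} \<in> sets (edge_space E)"
proof -
  let ?I = "{F. finite F \<and> F \<subseteq> E \<and> joined (sub F) u v}"
  have "countable {F. finite F \<and> F \<subseteq> E}" by (rule countable_Collect_finite_subset[OF countable_edges])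
  then have ctb: "countable ?I" by (rule countable_subset[rotated]) auto
  have eq: "{T \<in> Pow E. joined (sub T) u v} = (\<Union>F\<in>?I. cyl E F)"
  proof
    show "{T \<in> Pow E. joined (sub T) u v} \<subseteq> (\<Union>F\<in>?I. cyl E F)"
    proof
      fix T assume "T \<in> {T \<in> Pow E. joined (sub T) u v}"
      then have T: "T \<subseteq> E" "joined (sub T) u v" by auto
      obtain F where "finite F" "F \<subseteq> T" "joined (sub F) u v" using joined_finite[OF T(2)] by blast
      then have "F \<in> ?I" "T \<in> cyl E F" using T(1) by (auto simp: cyl_def)
      then show "T \<in> (\<Union>F\<in>?I. cyl E F)" by (rule UN_I)
    qed
    show "(\<Union>F\<in>?I. cyl E F) \<subseteq> {T \<in> Pow E. joined (sub T) u v}"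
    proof
      fix T assume "T \<in> (\<Union>F\<in>?I. cyl E F)"
      then obtain F where "joined (sub F) u v" "F \<subseteq> T" "T \<subseteq> E" by (auto simp: cyl_def)
      then show "T \<in> {T \<in> Pow E. joined (sub T) u v}" using joined_spanning_mono[of G F u v T] by simp
    qed
  qed
  have "cyl E F \<in> sets (edge_space E)" if "F \<in> ?I" for F using cyl_in_sets[of F E] that by simp
  then show ?thesis unfolding eq by (rule sets.countable_UN''[OF ctb])
qed

lemma closure_edges_measurable: "closure_edges \<in> measurable (edge_space E) (edge_space E)"
proof (rule measurable_edge_space)
  fix e assume "e \<in> E"
  then have "{T \<in> space (edge_space E). e \<in> closure_edges T} = {T \<in> Pow E. joined (sub T) (s e) (t e)}"
    by (auto simp: closure_edges_def)
  then show "{T \<in> space (edge_space E). e \<in> closure_edges T} \<in> sets (edge_space E)"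
    using joined_in_sets by simp
qed (rule closure_edges_subset)

text \<open>The integrated Gibbs property: resampling the trace on a finite \<open>Y\<close> within
  its own span preserves inclusion probabilities inside \<open>Y\<close>. The integrand depends only
  on \<open>T \<inter> Y\<close>, which is what lets the property survive local weak limits.\<close>

definition resampling_invariant :: "'e set measure \<Rightarrow> bool" where
  "resampling_invariant N \<longleftrightarrow> (\<forall>Y F. finite Y \<longrightarrow> Y \<subseteq> E \<longrightarrow> F \<subseteq> Y \<longrightarrow>
     (\<integral>T. inclusion_prob Z (Y \<inter> spanned Z (T \<inter> Y)) F \<partial>N) = measure N (cyl E F))"

lemma resampling_invariantI:
  assumes N: "prob_space N" "sets N = sets (edge_space E)" and lim: "local_weak_limit G P N"
    and ev: "\<And>Y F. finite Y \<Longrightarrow> Y \<subseteq> E \<Longrightarrow> F \<subseteq> Y \<Longrightarrow> \<forall>\<^sub>F n in sequentially.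
      measure_pmf.expectation (P n) (\<lambda>T. inclusion_prob Z (Y \<inter> spanned Z (T \<inter> Y)) F) = measure_pmf.prob (P n) {T. F \<subseteq> T}"
  shows "resampling_invariant N"
  unfolding resampling_invariant_def
proof (intro allI impI)
  fix Y F assume Y: "finite Y" "Y \<subseteq> E" and F: "F \<subseteq> Y"
  let ?h = "\<lambda>A. inclusion_prob Z (Y \<inter> spanned Z A) F"
  have "(\<lambda>n. \<Sum>A\<in>Pow Y. ?h A * measure_pmf.prob (P n) {T. T \<inter> Y = A}) \<longlonglongrightarrow>
      (\<Sum>A\<in>Pow Y. ?h A * measure N {T \<in> space N. T \<inter> Y = A})"
    using lim Y unfolding local_weak_limit_def by (intro tendsto_sum tendsto_mult_left) auto
  then have "(\<lambda>n. measure_pmf.expectation (P n) (\<lambda>T. ?h (T \<inter> Y))) \<longlonglongrightarrow> (\<integral>T. ?h (T \<inter> Y) \<partial>N)"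
    unfolding expectation_trace_pmf[OF Y(1), where h = ?h] integral_trace_function[OF Y N(2,1), where h = ?h] .
  then have "(\<lambda>n. measure_pmf.prob (P n) {T. F \<subseteq> T}) \<longlonglongrightarrow> (\<integral>T. ?h (T \<inter> Y) \<partial>N)"
    by (rule Lim_transform_eventually) (rule ev[OF Y F])
  moreover have "(\<lambda>n. measure_pmf.prob (P n) {T. F \<subseteq> T}) \<longlonglongrightarrow> measure N (cyl E F)"
    by (rule local_weak_limitD[OF lim N(2) finite_subset[OF F Y(1)] subset_trans[OF F Y(2)]])
  ultimately show "(\<integral>T. ?h (T \<inter> Y) \<partial>N) = measure N (cyl E F)" by (rule LIMSEQ_unique)
qed

lemma FSF_resampling_invariant: "resampling_invariant (FSF G)"
proof -
  note law = FSF_law[OF oriented locally_finite connected]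
  obtain Gs where Gs: "exhaustion G Gs"
    using induced_exhaustion_exists[OF oriented_wf[OF oriented] locally_finite connected] by blast
  show ?thesis
  proof (rule resampling_invariantI[OF law(1,2)])
    show "local_weak_limit G (\<lambda>n. UST (Gs n)) (FSF G)"
      using UST_free_limit[OF oriented Gs] law by (intro local_weak_limitI) auto
    fix Y F assume Y: "finite Y" "Y \<subseteq> E" and F: "F \<subseteq> Y"
    have fin: "finite (edges (Gs n))" for n using exhaustionD(2)[OF Gs] by (simp add: finite_graph_def)
    obtain N where N: "\<forall>n\<ge>N. Y \<subseteq> edges (Gs n)"
      using finite_subset_incseq[of Y "\<lambda>n. edges (Gs n)"] exhaustionD(5,7)[OF Gs] Y by auto
    show "\<forall>\<^sub>F n in sequentially. measure_pmf.expectation (UST (Gs n)) (\<lambda>T. inclusion_prob Z (Y \<inter> spanned Z (T \<inter> Y)) F)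
        = measure_pmf.prob (UST (Gs n)) {T. F \<subseteq> T}"
    proof (rule eventually_sequentiallyI)
      fix n assume "n \<ge> N"
      then have "Y \<subseteq> edges (Gs n)" using N by blast
      then show "measure_pmf.expectation (UST (Gs n)) (\<lambda>T. inclusion_prob Z (Y \<inter> spanned Z (T \<inter> Y)) F)
          = measure_pmf.prob (UST (Gs n)) {T. F \<subseteq> T}"
        unfolding UST_eq[OF oriented_subgraph[OF oriented exhaustionD(1)[OF Gs]] exhaustionD(3)[OF Gs]]
          prob_uniform_basis[OF fin]
        by (intro resampled_basis_expectation[OF unimodular_flows fin _ F]) auto
    qed
  qed
qed

text \<open>Edges of \<open>Y\<close> do not touch the wired vertex, so a potential on
  \<open>G\<close> may be given the value 0 there without affecting the test. This is the reason why
  free forests appear in the identity for the wired forest as well.\<close>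

lemma wired_flows_local:
  assumes Y: "Y \<subseteq> E" "\<And>e. e \<in> Y \<Longrightarrow> s e \<in> W \<and> t e \<in> W" and z: "supp z \<subseteq> Y"
  shows "z \<in> Z \<longleftrightarrow> z \<in> wired_flows s t W"
proof
  assume z': "z \<in> wired_flows s t W"
  note fin = flows_finite[OF z']
  show "z \<in> Z"
  proof (rule flowsI[OF fin order_refl])
    fix g :: "'v \<Rightarrow> real"
    let ?g = "\<lambda>x. case x of None \<Rightarrow> 0 | Some v \<Rightarrow> g v"
    have "(\<Sum>e\<in>supp z. z e * (g (s e) - g (t e))) =
      (\<Sum>e\<in>supp z. z e * (?g ((collapse W \<circ> s) e) - ?g ((collapse W \<circ> t) e)))"
      by (rule sum.cong) (use Y(2) z in \<open>auto simp: collapse_def\<close>)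
    then show "(\<Sum>e\<in>supp z. z e * (g (s e) - g (t e))) = 0" using flowsD[OF z' fin order_refl, of ?g] by simp
  qed
qed (use flows_comp in blast)

lemma WSF_resampling_invariant: "resampling_invariant (WSF G)"
proof -
  note law = WSF_law[OF oriented locally_finite connected]
  obtain Gs where Gs: "exhaustion G Gs"
    using induced_exhaustion_exists[OF oriented_wf[OF oriented] locally_finite connected] by blast
  show ?thesis
  proof (rule resampling_invariantI[OF law(1,2)])
    show "local_weak_limit G (\<lambda>n. UST (wired_graph G (Gs n))) (WSF G)"
      using UST_wired_limit[OF oriented locally_finite connected Gs] law by (intro local_weak_limitI) auto
    fix Y F assume Y: "finite Y" "Y \<subseteq> E" and F: "F \<subseteq> Y"
    have fin: "finite (incident G (verts (Gs n)))" for n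
      using finite_incident[OF locally_finite] exhaustionD(1,2)[OF Gs] by (simp add: finite_graph_def subgraph_def)
    have "s ` Y \<union> t ` Y \<subseteq> (\<Union>n. verts (Gs n))"
      using orientedD(2,3)[OF oriented] Y exhaustionD(6)[OF Gs] by auto
    then obtain N where N: "\<forall>n\<ge>N. s ` Y \<union> t ` Y \<subseteq> verts (Gs n)"
      using finite_subset_incseq[OF _ _ exhaustionD(4)[OF Gs], of "s ` Y \<union> t ` Y"] Y by auto
    show "\<forall>\<^sub>F n in sequentially. measure_pmf.expectation (UST (wired_graph G (Gs n))) (\<lambda>T. inclusion_prob Z (Y \<inter> spanned Z (T \<inter> Y)) F)
        = measure_pmf.prob (UST (wired_graph G (Gs n))) {T. F \<subseteq> T}"
    proof (rule eventually_sequentiallyI)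
      fix n assume "n \<ge> N"
      \<comment> \<open>Both ends must lie inside, not merely one as membership in
        \<open>incident\<close> requires; otherwise wiring would create new circulations on
        \<open>Y\<close>.\<close>
      then have YW: "s e \<in> verts (Gs n) \<and> t e \<in> verts (Gs n)" if "e \<in> Y" for e using N that by blast
      have "Y \<subseteq> incident G (verts (Gs n))" using YW Y orientedD(1)[OF oriented] by fastforce
      then show "measure_pmf.expectation (UST (wired_graph G (Gs n))) (\<lambda>T. inclusion_prob Z (Y \<inter> spanned Z (T \<inter> Y)) F)
          = measure_pmf.prob (UST (wired_graph G (Gs n))) {T. F \<subseteq> T}"
        unfolding UST_wired[OF oriented connected] prob_uniform_basis[OF fin]
        by (intro resampled_basis_expectation[OF unimodular_flows fin _ F] wired_flows_local[OF Y(2) YW])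
    qed
  qed
qed

lemma closure_kernel_measurable:
  assumes "sets N = sets (edge_space E)"
  shows "(\<lambda>T. components_law (closure_edges T)) \<in> measurable N (subprob_algebra (edge_space E))"
proof -
  have "components_law \<in> measurable (edge_space E) (subprob_algebra (edge_space E))"
    by (rule measurable_prob_algebraD[OF components_law_measurable])
  then have "(\<lambda>T. components_law (closure_edges T)) \<in> measurable (edge_space E) (subprob_algebra (edge_space E))"
    by (rule measurable_compose[OF closure_edges_measurable])
  then show ?thesis using measurable_cong_sets[OF assms refl] by blast
qed

lemma FSF_random_closure:
  assumes N: "prob_space N" "sets N = sets (edge_space E)"
  shows "FSF_random G (induced_component_law G N) = N \<bind> (\<lambda>T. components_law (closure_edges T))"
proof -
  have "closure_edges \<in> measurable N (edge_space E)"
    using closure_edges_measurable measurable_cong_sets[OF N(2) refl] by blast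
  moreover have "components_law \<in> measurable (edge_space E) (subprob_algebra (edge_space E))"
    by (rule measurable_prob_algebraD[OF components_law_measurable])
  ultimately show ?thesis
    unfolding FSF_random_def induced_component_law_def subgraph_space_eq closure_edges_eq
    by (rule bind_distr) (use prob_space.not_empty[OF N(1)] in auto)
qed

theorem FSF_random_induced_component_law:
  assumes N: "prob_space N" "sets N = sets (edge_space E)" and inv: "resampling_invariant N"
  shows "FSF_random G (induced_component_law G N) = N"
proof -
  interpret N: prob_space N by fact
  let ?K = "\<lambda>T. components_law (closure_edges T)"
  note K = closure_kernel_measurable[OF N(2)]
  have sp: "space N = Pow E" using sets_eq_imp_space_eq[OF N(2)] by simp
  have "N \<bind> ?K = N"
  proof (rule edge_measure_eqI[of _ _ E])
    show "prob_space (N \<bind> ?K)"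
      by (rule N.prob_space_bind[OF _ K]) (simp add: components_law_prob_space closure_edges_subset)
    show "sets (N \<bind> ?K) = sets (edge_space E)" by (rule sets_bind) (auto simp: sp)
    fix F assume F: "finite F" "F \<subseteq> E"
    obtain Y where Y: "incseq Y" "\<And>n. finite (Y n)" "(\<Union>n. Y n) = E" using edge_exhaustion by blast
    let ?b = "\<lambda>n T. inclusion_prob Z (Y n \<inter> spanned Z (T \<inter> Y n)) F"
    have YE: "Y n \<subseteq> E" for n using Y(3) by auto
    \<comment> \<open>The integrands converge at every \<open>T\<close>, because the edge sets in
      \<open>?b n\<close> increase to \<open>closure_edges T\<close>; as probabilities they are
      dominated by 1.\<close>
    have lim: "(\<lambda>n. \<integral>T. ?b n T \<partial>N) \<longlonglongrightarrow> (\<integral>T. measure (?K T) (cyl E F) \<partial>N)"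
    proof (rule integral_dominated_convergence[where w = "\<lambda>_. 1"])
      show "(\<lambda>T. measure (?K T) (cyl E F)) \<in> borel_measurable N"
        by (rule measure_measurable_subprob_algebra2[OF _ K]) (use cyl_in_sets[OF F] in simp)
      show "?b n \<in> borel_measurable N" for n
        using trace_function_measurable[OF Y(2) YE N(2), where h = "\<lambda>A. inclusion_prob Z (Y n \<inter> spanned Z A) F"] .
      show "AE T in N. (\<lambda>n. ?b n T) \<longlonglongrightarrow> measure (?K T) (cyl E F)"
      proof (rule AE_I2)
        fix T assume "T \<in> space N"
        then have T: "T \<subseteq> E" using sp by auto
        show "(\<lambda>n. ?b n T) \<longlonglongrightarrow> measure (?K T) (cyl E F)"
          by (rule components_law_limit[OF closure_edges_subset F closure_exhaustion(1)[OF T Y(1,3)] _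
                closure_exhaustion(2)[OF T Y(1,3)]]) (use Y(2) in auto)
      qed
      show "AE T in N. norm (?b n T) \<le> 1" for n
        using inclusion_prob_nonneg[of Z] inclusion_prob_le_1[of "Y n \<inter> spanned Z (_ \<inter> Y n)" Z F] Y(2)
        by (intro AE_I2) (simp add: abs_of_nonneg)
    qed simp
    \<comment> \<open>Once \<open>Y n\<close> contains \<open>F\<close>, invariance makes the
      integrals constantly equal to the probability under \<open>N\<close>, which identifies the
      limit.\<close>
    obtain n0 where n0: "\<forall>n\<ge>n0. F \<subseteq> Y n" using finite_subset_incseq[OF F(1) _ Y(1)] Y(3) F(2) by auto
    have "\<forall>\<^sub>F n in sequentially. (\<integral>T. ?b n T \<partial>N) = measure N (cyl E F)"
    proof (rule eventually_sequentiallyI)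
      fix n assume "n \<ge> n0"
      then have "F \<subseteq> Y n" using n0 by simp
      then show "(\<integral>T. ?b n T \<partial>N) = measure N (cyl E F)"
        using inv Y(2) YE unfolding resampling_invariant_def by simp
    qed
    then have "(\<lambda>n. \<integral>T. ?b n T \<partial>N) \<longlonglongrightarrow> measure N (cyl E F)" by (rule tendsto_eventually)
    then have "(\<integral>T. measure (?K T) (cyl E F) \<partial>N) = measure N (cyl E F)" by (rule LIMSEQ_unique[OF lim])
    then show "measure (N \<bind> ?K) (cyl E F) = measure N (cyl E F)"
      using N.measure_bind[OF K cyl_in_sets[OF F]] by simp
  qed (use N in auto)
  then show ?thesis using FSF_random_closure[OF N] by simp
qed

text \<open>The resampled forest refines the components of the original one but has the same law, so
  the inclusion of the connection events is almost surely an equality.\<close>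

lemma closure_kernel_joined:
  assumes N: "prob_space N" "sets N = sets (edge_space E)" and inv: "resampling_invariant N"
  shows "AE T in N. joined (sub T) u v \<longrightarrow>
    (AE f in product_law (closure_edges T). joined (sub (join_parts (closure_edges T) f)) u v)"
proof -
  interpret N: prob_space N by fact
  let ?K = "\<lambda>T. components_law (closure_edges T)" and ?J = "{T \<in> Pow E. joined (sub T) u v}"
  note K = closure_kernel_measurable[OF N(2)] and J = joined_in_sets[of u v]
  have sp: "space N = Pow E" using sets_eq_imp_space_eq[OF N(2)] by simp
  have JN: "?J \<in> sets N" using J N(2) by simp
  have meas: "measure (?K T) ?J = measure (product_law (closure_edges T))
      {f \<in> space (product_law (closure_edges T)). joined (sub (join_parts (closure_edges T) f)) u v}" for T
  proof -
    have "join_parts (closure_edges T) -` ?J \<inter> space (product_law (closure_edges T)) =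
        {f \<in> space (product_law (closure_edges T)). joined (sub (join_parts (closure_edges T) f)) u v}"
      using measurable_space[OF join_parts_measurable[OF closure_edges_subset[of T]]] by auto
    then show ?thesis
      unfolding components_law_eq by (simp only: measure_distr[OF join_parts_measurable[OF closure_edges_subset] J])
  qed
  \<comment> \<open>The resampled forest uses only closure edges, whose ends \<open>T\<close>
    already joins; it cannot connect \<open>u\<close> and \<open>v\<close> unless \<open>T\<close>
    does.\<close>
  have le: "measure (?K T) ?J \<le> indicator ?J T" if "T \<in> space N" for T
  proof (cases "T \<in> ?J")
    case True
    then show ?thesis using prob_space.prob_le_1[OF components_law_prob_space[OF closure_edges_subset]] by simp
  next
    case False
    have "\<not> joined (sub (join_parts (closure_edges T) f)) u v" if f: "f \<in> space (product_law (closure_edges T))" for f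
    proof
      have "join_parts (closure_edges T) f \<subseteq> closure_edges T"
        using product_law_facts(2)[OF closure_edges_subset f] component_edges_subset[of _ "sub (closure_edges T)"] by fastforce
      moreover assume "joined (sub (join_parts (closure_edges T) f)) u v"
      ultimately have "joined (sub (closure_edges T)) u v" by (rule joined_spanning_mono[rotated])
      then show False using joined_closure_edges False that \<open>T \<in> space N\<close> sp by auto
    qed
    then have "{f \<in> space (product_law (closure_edges T)). joined (sub (join_parts (closure_edges T) f)) u v} = {}" by blast
    then show ?thesis unfolding meas by (simp only: measure_empty indicator_pos_le)
  qed
  have Kb: "(\<lambda>T. measure (?K T) ?J) \<in> borel_measurable N"
    by (rule measure_measurable_subprob_algebra2[OF _ K]) (use J in simp)
  have intK: "integrable N (\<lambda>T. measure (?K T) ?J)"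
    by (rule N.integrable_const_bound[of _ 1, OF _ Kb])
      (simp add: prob_space.prob_le_1[OF components_law_prob_space[OF closure_edges_subset]])
  \<comment> \<open>By the identity of laws, the two sides of the pointwise inequality have the same
    integral, so they agree almost everywhere.\<close>
  have "(\<integral>T. measure (?K T) ?J \<partial>N) = measure N ?J"
    using N.measure_bind[OF K J] FSF_random_induced_component_law[OF assms] FSF_random_closure[OF N] by simp
  then have "(\<integral>T. indicator ?J T - measure (?K T) ?J \<partial>N) = 0"
    using JN intK by (subst Bochner_Integration.integral_diff) (auto simp: N.emeasure_eq_measure)
  moreover have "integrable N (\<lambda>T. indicator ?J T - measure (?K T) ?J)"
    using JN intK by (intro Bochner_Integration.integrable_diff) (auto simp: N.emeasure_eq_measure)
  moreover have "AE T in N. 0 \<le> indicator ?J T - measure (?K T) ?J"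
    using le by (intro AE_I2) simp
  ultimately have ae: "AE T in N. indicator ?J T - measure (?K T) ?J = 0"
    by (simp add: integral_nonneg_eq_0_iff_AE)
  show ?thesis
  proof (rule AE_mp[OF ae], rule AE_I2, intro impI)
    fix T assume T: "T \<in> space N" "indicator ?J T - measure (?K T) ?J = 0" "joined (sub T) u v"
    let ?P = "product_law (closure_edges T)"
    interpret P: prob_space ?P by (rule product_law_facts(1)[OF closure_edges_subset])
    have "T \<in> ?J" using T(1,3) sp by auto
    then have "measure ?P {f \<in> space ?P. joined (sub (join_parts (closure_edges T) f)) u v} = 1"
      using T(2) meas[of T] by simp
    then show "AE f in ?P. joined (sub (join_parts (closure_edges T) f)) u v"
      by (rule P.AE_prob_1[THEN AE_mp]) simp
  qed
qed

text \<open>Each part \<open>f D\<close> has its edges in \<open>D\<close>, so a path that starts in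
  \<open>C\<close> can only use edges of \<open>f C\<close>.\<close>

lemma join_parts_restrict:
  assumes T: "T \<subseteq> E" and f: "f \<in> space (product_law T)" and C: "C \<in> comps T"
    and j: "joined (sub (join_parts T f)) u v" and u: "u \<in> verts C"
  shows "joined (spanning_subgraph C (f C)) u v"
proof (rule joined_invariant[OF j, of "joined (spanning_subgraph C (f C)) u"])
  show "joined (spanning_subgraph C (f C)) u u" using u by (intro joined_refl) simp
  fix e a b
  assume e: "e \<in> edges (sub (join_parts T f))" "ends (sub (join_parts T f)) e = {a, b}"
    and a: "joined (spanning_subgraph C (f C)) u a"
  obtain D where D: "D \<in> comps T" "e \<in> f D" using e(1) by auto
  have eD: "e \<in> edges D" using product_law_facts(2)[OF T f D(1)] D(2) by auto
  obtain w where w: "D = component_of (sub T) w" using D(1) by (auto simp: graph_components_def)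
  have ab: "ends D e = {a, b}" "a \<in> verts D" "b \<in> verts D" using e(2) eD by (auto simp: w)
  have "a \<in> verts C" using joined_verts[OF a] by simp
  then have "D = C" using component_verts_unique[OF D(1) C ab(2)] by simp
  then have "joined (spanning_subgraph C (f C)) a b" using D(2) ab by (intro joined_edge[of e]) auto
  then show "joined (spanning_subgraph C (f C)) u b" using a joined_trans by metis
qed

lemma connected_unique_component:
  assumes "connected_graph H"
  shows "\<exists>!D. D \<in> graph_components H"
proof -
  obtain v where v: "v \<in> verts H" using assms by (auto simp: connected_graph_def)
  show ?thesis
  proof (rule ex1I[of _ "component_of H v"])
    show "component_of H v \<in> graph_components H" using v by (auto simp: graph_components_def)
    fix D assume "D \<in> graph_components H"
    then obtain u where "u \<in> verts H" "D = component_of H u" by (auto simp: graph_components_def)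
    then show "D = component_of H v"
      using component_of_cong[of H u v] assms v by (simp add: connected_graph_def)
  qed
qed

text \<open>Connection of a single pair in the joined forest becomes connection inside its
  component, and the marginal of the product law at \<open>C\<close> is \<open>FSF C\<close>.
  Countability of the vertices then gives all pairs of a component at once.\<close>

theorem induced_component_forest_connected:
  assumes N: "prob_space N" "sets N = sets (edge_space E)" and inv: "resampling_invariant N"
  shows "AE T in N. \<forall>C\<in>comps (closure_edges T). AE S in FSF C. \<exists>!D. D \<in> graph_components (spanning_subgraph C S)"
proof -
  have sp: "space N = Pow E" using sets_eq_imp_space_eq[OF N(2)] by simp
  \<comment> \<open>One null set for all pairs is fixed before the components of \<open>T\<close>
    are considered, since these depend on \<open>T\<close>.\<close>
  have ae: "AE T in N. \<forall>u\<in>verts G. \<forall>v\<in>verts G. joined (sub T) u v \<longrightarrow>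
    (AE f in product_law (closure_edges T). joined (sub (join_parts (closure_edges T) f)) u v)"
    by (intro AE_ball_countable[THEN iffD2] countable_verts ballI closure_kernel_joined[OF assms])
  show ?thesis
  proof (rule AE_mp[OF ae], rule AE_I2, intro impI ballI)
    fix T C assume "T \<in> space N" and j: "\<forall>u\<in>verts G. \<forall>v\<in>verts G. joined (sub T) u v \<longrightarrow>
        (AE f in product_law (closure_edges T). joined (sub (join_parts (closure_edges T) f)) u v)"
      and C: "C \<in> comps (closure_edges T)"
    let ?T = "closure_edges T" and ?P = "product_law (closure_edges T)"
    note T = closure_edges_subset[of T]
    obtain w where w: "w \<in> verts G" "C = component_of (sub ?T) w" using C by (auto simp: graph_components_def)
    have CG: "verts C \<subseteq> verts G" using w joined_verts[of "sub ?T" w] by auto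
    have cC: "countable (verts C)" using countable_subset[OF CG countable_verts] .
    \<comment> \<open>The component is itself an ambient graph; this supplies measurability of its
      connection events.\<close>
    interpret C: forest_graph C s t
      unfolding w(2) using w(1)
      by unfold_locales (auto intro!: component_oriented component_locally_finite component_connected sub_oriented sub_locally_finite T)
    note law = component_FSF_law[OF sub_oriented[OF T] sub_locally_finite[OF T] C]
    have "AE S in FSF C. joined (spanning_subgraph C S) u v" if uv: "u \<in> verts C" "v \<in> verts C" for u v
    proof -
      have "joined (sub ?T) u v" using uv w joined_trans joined_sym by (metis component_of_simps(1) mem_Collect_eq)
      then have "joined (sub T) u v" by (rule joined_closure_edges)
      then have "AE f in ?P. joined (sub (join_parts ?T f)) u v" using j uv CG by blast
      then have ae: "AE f in ?P. joined (spanning_subgraph C (f C)) u v"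
        by (rule AE_mp) (use join_parts_restrict[OF T _ C _ uv(1)] in \<open>auto intro: AE_I2\<close>)
      have spC: "space (FSF C) = Pow (edges C)" using sets_eq_imp_space_eq[OF law(2)] by simp
      have "{S \<in> space (FSF C). joined (spanning_subgraph C S) u v} \<in> sets (FSF C)"
        unfolding law(2) spC by (rule C.joined_in_sets)
      \<comment> \<open>The almost sure statement about the coordinate \<open>f C\<close> is
        transported to its law, which needs the event to be measurable in
        \<open>FSF C\<close>.\<close>
      then have "AE S in distr ?P (FSF C) (\<lambda>f. f C). joined (spanning_subgraph C S) u v"
        using ae by (subst AE_distr_iff[OF measurable_component_singleton[OF C]])
      then show ?thesis unfolding product_law_facts(4)[OF T C] .
    qed
    then have ae_C: "AE S in FSF C. \<forall>u\<in>verts C. \<forall>v\<in>verts C. joined (spanning_subgraph C S) u v"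
      by (intro AE_ball_countable[THEN iffD2] cC ballI)
    show "AE S in FSF C. \<exists>!D. D \<in> graph_components (spanning_subgraph C S)"
    proof (rule AE_mp[OF ae_C], rule AE_I2, intro impI)
      fix S assume "\<forall>u\<in>verts C. \<forall>v\<in>verts C. joined (spanning_subgraph C S) u v"
      then have "connected_graph (spanning_subgraph C S)"
        using C.connected by (simp add: connected_graph_def)
      then show "\<exists>!D. D \<in> graph_components (spanning_subgraph C S)" by (rule connected_unique_component)
    qed
  qed
qed

lemma induced_component_graph_eq: "induced_component_graph G (sub T) = sub (closure_edges T)"
  using closure_edges_eq[of T] by (simp add: induced_component_graph_def spanning_subgraph_def)

end

theorem theorem1p5:
  fixes G :: "('v, 'e) mgraph"
  assumes "wf_graph G"
    and "locally_finite G"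
    and "infinite (verts G)"
    and "connected_graph G"
  shows "FSF_random G (induced_component_law G (WSF G)) = WSF G \<and>
    FSF_random G (induced_component_law G (FSF G)) = FSF G \<and>
    (AE T in WSF G.
       \<forall>C\<in>graph_components (induced_component_graph G (spanning_subgraph G T)).
         AE S in FSF C. \<exists>!D. D \<in> graph_components (spanning_subgraph C S)) \<and>
    (AE T in FSF G.
       \<forall>C\<in>graph_components (induced_component_graph G (spanning_subgraph G T)).
         AE S in FSF C. \<exists>!D. D \<in> graph_components (spanning_subgraph C S))"
proof -
  obtain s t where st: "oriented G s t" using orientation_exists[OF assms(1)] by blast
  interpret forest_graph G s t by (rule forest_graph.intro[OF st assms(2,4)])
  note W = WSF_law(1,2)[OF st assms(2,4)] WSF_resampling_invariant
    and F = FSF_law(1,2)[OF st assms(2,4)] FSF_resampling_invariant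
  show ?thesis
    unfolding induced_component_graph_eq
    using FSF_random_induced_component_law[OF W] FSF_random_induced_component_law[OF F]
      induced_component_forest_connected[OF W] induced_component_forest_connected[OF F]
    by blast
qed

end
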